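(* Let $g_E=\bigl(1+EH(t)+E^2G(t)+\mathcal{O}(E^3)\bigr)g_o$ be a deformation of the flat metric $g_o=dt^2+dy^2$ on the torus $T^2$ such that $H(t)=H(1-t)$ for all $t$ and $$\int_0^1 H(t)\sin^2(2\pi t)\,dt\neq\int_0^1 H(t)\cos^2(2\pi t)\,dt .$$ Then for all parameters $E\neq 0$ near zero the strict inequality $\mu_1(g_E)<\lambda_1^2(g_E)$ holds.
   Context: $T^2=\mathbb{R}^2/\mathbb{Z}^2$ with coordinates $0\le t\le 1$, $0\le y\le 1$ and the trivial spin structure. A deformation of the flat metric means a family $g_E=h_E^4(t)g_o$, where $h_E$ is a positive $1$-periodic function depending smoothly on $(E,t)$, for $E$ in an interval around $0$, with $h_0\equiv1$; here $h_E^4(t)=1+EH(t)+E^2G(t)+\mathcal{O}(E^3)$. For a metric $g$ on $T^2$, $\mu_1(g)$ denotes the first positive eigenvalue of the (positive) Laplace operator $\Delta_g$ on functions, and $\lambda_1^2(g)$ the first positive eigenvalue of the square $D_g^2$ of the Dirac operator with respect to the trivial spin structure. *)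

theory Defs
  imports "HOL-Analysis.Analysis"
begin

section \<open>Smooth functions\<close>

primrec Ck_on ::
  "nat \<Rightarrow> 'a::real_normed_vector set \<Rightarrow> ('a \<Rightarrow> 'b::real_normed_vector) \<Rightarrow> bool" where
  "Ck_on 0 S f \<longleftrightarrow> continuous_on S f"
| "Ck_on (Suc k) S f \<longleftrightarrow>
     (\<forall>x\<in>S. f differentiable (at x)) \<and> (\<forall>v. Ck_on k S (\<lambda>x. frechet_derivative f (at x) v))"

text \<open>Meant for open \<open>S\<close> in a finite-dimensional space.\<close>

definition smooth_on :: "'a::real_normed_vector set \<Rightarrow> ('a \<Rightarrow> 'b::real_normed_vector) \<Rightarrow> bool" where
  "smooth_on S f \<longleftrightarrow> (\<forall>k. Ck_on k S f)"


section \<open>Functions, metrics and vector fields on the torus\<close>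

text \<open>Objects on the torus \<open>\<real>\<^sup>2/\<int>\<^sup>2\<close> are periodic objects on \<open>\<real>\<^sup>2\<close>; a point \<open>x\<close> has the
  coordinates \<open>t = x $ 1\<close> and \<open>y = x $ 2\<close>. A metric is given by its coefficient matrices,
  a vector field by its components with respect to \<open>\<partial>\<^sub>t, \<partial>\<^sub>y\<close>.\<close>

type_synonym metric = "real^2 \<Rightarrow> real^2^2"
type_synonym vfield = "real^2 \<Rightarrow> real^2"

definition torus_smooth :: "(real^2 \<Rightarrow> 'b::real_normed_vector) \<Rightarrow> bool" where
  "torus_smooth f \<longleftrightarrow> smooth_on UNIV f \<and> (\<forall>x i. f (x + axis i 1) = f x)"

definition pd :: "2 \<Rightarrow> (real^2 \<Rightarrow> 'b::real_normed_vector) \<Rightarrow> real^2 \<Rightarrow> 'b" where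
  "pd i f x = frechet_derivative f (at x) (axis i 1)"

definition flat_metric :: metric where
  "flat_metric x = mat 1"

text \<open>The metric \<open>h\<^sup>4(t) g\<^sub>o\<close>.\<close>

definition conformal_metric :: "(real \<Rightarrow> real) \<Rightarrow> metric" where
  "conformal_metric h x = (h (x $ 1)) ^ 4 *\<^sub>R flat_metric x"

definition metric_inner :: "metric \<Rightarrow> real^2 \<Rightarrow> real^2 \<Rightarrow> real^2 \<Rightarrow> real" where
  "metric_inner g x v w = (\<Sum>i\<in>UNIV. \<Sum>j\<in>UNIV. g x $ i $ j * v $ i * w $ j)"


section \<open>The Laplace operator\<close>

text \<open>Sign convention: \<open>\<Delta> = - div grad\<close> is nonnegative.\<close>

definition laplace :: "metric \<Rightarrow> (real^2 \<Rightarrow> real) \<Rightarrow> real^2 \<Rightarrow> real" where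
  "laplace g f x =
     - (1 / sqrt (det (g x))) *
       (\<Sum>i\<in>UNIV. pd i (\<lambda>z. sqrt (det (g z)) *
                              (\<Sum>j\<in>UNIV. matrix_inv (g z) $ i $ j * pd j f z)) x)"


section \<open>The Levi-Civita connection\<close>

definition christoffel :: "metric \<Rightarrow> 2 \<Rightarrow> 2 \<Rightarrow> 2 \<Rightarrow> real^2 \<Rightarrow> real" where
  "christoffel g k i j x =
     1 / 2 * (\<Sum>l\<in>UNIV. matrix_inv (g x) $ k $ l *
       (pd i (\<lambda>z. g z $ j $ l) x + pd j (\<lambda>z. g z $ i $ l) x - pd l (\<lambda>z. g z $ i $ j) x))"

definition levi_civita :: "metric \<Rightarrow> vfield \<Rightarrow> vfield \<Rightarrow> vfield" where
  "levi_civita g X Y x =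
     (\<chi> k. (\<Sum>i\<in>UNIV. X x $ i * pd i (\<lambda>z. Y z $ k) x)
         + (\<Sum>i\<in>UNIV. \<Sum>j\<in>UNIV. christoffel g k i j x * X x $ i * Y x $ j))"


section \<open>The Dirac operator for the trivial spin structure\<close>

text \<open>The oriented orthonormal frame obtained from \<open>\<partial>\<^sub>t, \<partial>\<^sub>y\<close> by the Gram--Schmidt process. It is
  globally defined on the torus, and the trivial spin structure is the one to which it lifts.
  In this trivialization spinor fields are therefore periodic maps into \<open>\<complex>\<^sup>2\<close>.\<close>

definition frame :: "metric \<Rightarrow> 2 \<Rightarrow> vfield" where
  "frame g i x =
     (let d1 = axis 1 1; d2 = axis 2 1;
          e1 = (1 / sqrt (metric_inner g x d1 d1)) *\<^sub>R d1;
          w = d2 - metric_inner g x d2 e1 *\<^sub>R e1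
      in if i = 1 then e1 else (1 / sqrt (metric_inner g x w w)) *\<^sub>R w)"

text \<open>Clifford multiplication by the frame vectors, normalized by \<open>v \<cdot> v = - |v|\<^sup>2\<close>.\<close>

definition clifford :: "2 \<Rightarrow> complex^2^2" where
  "clifford i =
     (if i = 1 then vector [vector [0, \<i>], vector [\<i>, 0]]
      else vector [vector [0, -1], vector [1, 0]])"

text \<open>The spinor connection
  \<open>\<nabla>\<^sub>X \<psi> = X(\<psi>) + 1/2 \<Sum>\<^sub>i\<^sub><\<^sub>j g(\<nabla>\<^sub>X e\<^sub>i, e\<^sub>j) e\<^sub>i \<cdot> e\<^sub>j \<cdot> \<psi>\<close>; in dimension two the sum has one term.\<close>

definition spin_connection ::
  "metric \<Rightarrow> vfield \<Rightarrow> (real^2 \<Rightarrow> complex^2) \<Rightarrow> real^2 \<Rightarrow> complex^2" where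
  "spin_connection g X \<psi> x =
     frechet_derivative \<psi> (at x) (X x)
     + (1 / 2 * metric_inner g x (levi_civita g X (frame g 1) x) (frame g 2 x)) *\<^sub>R
       (clifford 1 *v (clifford 2 *v \<psi> x))"

definition dirac :: "metric \<Rightarrow> (real^2 \<Rightarrow> complex^2) \<Rightarrow> real^2 \<Rightarrow> complex^2" where
  "dirac g \<psi> x = (\<Sum>i\<in>UNIV. clifford i *v spin_connection g (frame g i) \<psi> x)"


section \<open>First positive eigenvalues\<close>

text \<open>Both operators below are symmetric and nonnegative, so only real eigenvalues matter.\<close>

definition is_eigenvalue ::
  "((real^2 \<Rightarrow> 'b::real_normed_vector) \<Rightarrow> real^2 \<Rightarrow> 'b) \<Rightarrow> real \<Rightarrow> bool" where
  "is_eigenvalue T \<mu> \<longleftrightarrow>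
     (\<exists>f. torus_smooth f \<and> f \<noteq> (\<lambda>x. 0) \<and> (\<forall>x. T f x = \<mu> *\<^sub>R f x))"

text \<open>On the closed surface the spectra are discrete and unbounded,
  so this infimum is attained: it is the smallest positive eigenvalue.\<close>

definition first_positive_eigenvalue ::
  "((real^2 \<Rightarrow> 'b::real_normed_vector) \<Rightarrow> real^2 \<Rightarrow> 'b) \<Rightarrow> real" where
  "first_positive_eigenvalue T = Inf {\<mu>. \<mu> > 0 \<and> is_eigenvalue T \<mu>}"

definition mu1 :: "metric \<Rightarrow> real" where
  "mu1 g = first_positive_eigenvalue (laplace g)"

definition lambda1_sq :: "metric \<Rightarrow> real" where
  "lambda1_sq g = first_positive_eigenvalue (\<lambda>\<psi>. dirac g (dirac g \<psi>))"

end

(*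
Write rho = h^2, so that the metric is rho^2 (dt^2 + dy^2).

Lower bound for lambda_1^2: D psi = h^(-3) D_0 (h psi) for the flat Dirac operator D_0, so an
eigenspinor yields a solution of D_0 chi = lam rho chi. Since rho depends on t only, its Fourier
coefficients in y satisfy an ordinary differential system in t. For the frequency 0 the system is
solved by phases and gives |lam| r >= 2 pi with r the mean of rho. For the other frequencies a gauge
transformation replaces rho by r up to a phase 2 lam S, where S' = rho - r. A monotonicity argument
then gives |lam| r >= 2 pi (1 - 2 lam^2 sup S^2). As S = O(E), this means
lambda_1^2 >= 4 pi^2 (1 - E int H) - O(E^2).

Upper bound for mu_1: a periodic function f(t) is an eigenfunction iff f'' = - mu h^4 f. The number mu is a
periodic eigenvalue iff F(mu) = det (M(mu) - 1) vanishes, where M(mu) is the monodromy matrix.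
F is continuous and F(pi^2) > 0. Variation of constants shows that F(m) < 0 for a number m that lies
below 4 pi^2 (1 - E int H) by a multiple of |E|, because the integrals of H cos^2 and H sin^2 differ.
*)

theory Submission
  imports Defs
begin

section \<open>Calculus of smooth functions\<close>

text \<open>For the flat metric F(mu) = 2 - 2 cos(sqrt mu), so 4 pi^2 is a double zero and F does
  not change sign there. A perturbation can split it into two zeros with F < 0 between them. This
  negativity is only of second order in E and has to beat errors of third order, hence the explicit
  constants throughout. To first order the two zeros are 4 pi^2 (1 - E nu) for the eigenvalues nu of
  the matrix of H in the basis sqrt 2 cos(2 pi t), sqrt 2 sin(2 pi t). Its trace is 2 int H, and
  unequal diagonal entries force unequal eigenvalues. One zero therefore falls below 4 pi^2 (1 - E
  int H) by an amount of first order. On the Dirac side only the mean of h^2 = 1 + E H / 2 + ... may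
  enter to first order. A pointwise bound of rho in the monotonicity argument would lose a term of
  order E, as large as the gap itself; the gauge phase reduces this loss to order E^2.\<close>

lemma Ck_on_SucI:
  assumes "\<And>x. (f has_derivative f' x) (at x)" "\<And>v. Ck_on k UNIV (\<lambda>x. f' x v)"
  shows "Ck_on (Suc k) UNIV f"
proof -
  have "frechet_derivative f (at x) = f' x" for x
    using frechet_derivative_at[OF assms(1)] by simp
  then show ?thesis using assms by (auto simp: differentiable_def)
qed

lemma Ck_on_has_derivative:
  assumes "Ck_on (Suc k) S f" "x \<in> S"
  shows "(f has_derivative frechet_derivative f (at x)) (at x)"
  using assms by (auto simp: frechet_derivative_works)

lemma Ck_on_SucD: "Ck_on (Suc k) S f \<Longrightarrow> Ck_on k S f"
proof (induction k arbitrary: f)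
  case 0
  then show ?case
    by (auto simp: differentiable_imp_continuous_within continuous_at_imp_continuous_on)
qed auto

lemma Ck_on_const: "Ck_on k UNIV (\<lambda>x. c)"
proof (induction k arbitrary: c)
  case (Suc k)
  show ?case by (rule Ck_on_SucI[where f' = "\<lambda>x v. 0"]) (use Suc in auto)
qed simp

lemma Ck_on_add:
  assumes "Ck_on k UNIV f" "Ck_on k UNIV g"
  shows "Ck_on k UNIV (\<lambda>x. f x + g x)"
  using assms
proof (induction k arbitrary: f g)
  case 0
  then show ?case by (auto intro: continuous_intros)
next
  case (Suc k)
  show ?case
    by (rule Ck_on_SucI[OF has_derivative_add[OF Ck_on_has_derivative[OF Suc.prems(1)]
            Ck_on_has_derivative[OF Suc.prems(2)]]])
      (use Suc in auto)
qed

lemma Ck_on_bounded_linear: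
  assumes "bounded_linear L" "Ck_on k UNIV f"
  shows "Ck_on k UNIV (\<lambda>x. L (f x))"
  using assms(2)
proof (induction k arbitrary: f)
  case 0
  then show ?case using assms(1) by (auto intro: bounded_linear.continuous_on)
next
  case (Suc k)
  show ?case
    by (rule Ck_on_SucI[OF bounded_linear.has_derivative[OF assms(1) Ck_on_has_derivative[OF Suc.prems]]])
      (use Suc in auto)
qed

text \<open>The Leibniz rule yields two terms of the same bilinear shape, each with one factor
  differentiated. The other factor is then needed only at order \<open>k\<close>, which
  \<open>Ck_on_SucD\<close> supplies.\<close>

lemma Ck_on_bounded_bilinear:
  assumes "bounded_bilinear B" "Ck_on k UNIV f" "Ck_on k UNIV g"
  shows "Ck_on k UNIV (\<lambda>x. B (f x) (g x))"
  using assms(2,3)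
proof (induction k arbitrary: f g)
  case 0
  then have "continuous_on UNIV f" "continuous_on UNIV g" by simp_all
  from bounded_bilinear.continuous_on[OF assms(1) this] show ?case by simp
next
  case (Suc k)
  have "Ck_on k UNIV (\<lambda>x. B (f x) (frechet_derivative g (at x) v) + B (frechet_derivative f (at x) v) (g x))"
    for v
    using Suc.prems by (intro Ck_on_add Suc.IH) (simp_all add: Ck_on_SucD)
  then show ?case
    by (rule Ck_on_SucI[OF bounded_bilinear.FDERIV[OF assms(1) Ck_on_has_derivative[OF Suc.prems(1) UNIV_I]
            Ck_on_has_derivative[OF Suc.prems(2) UNIV_I]]])
qed

text \<open>Affine inner maps cover both uses: the projection to the coordinate t and the
  restriction of a family in (E, t) to fixed E. For them the chain rule only replaces the direction
  \<open>v\<close> by \<open>L v\<close>, which does not depend on the point, so the induction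
  closes.\<close>

lemma Ck_on_comp_affine:
  fixes L :: "'a::real_normed_vector \<Rightarrow> 'b::real_normed_vector"
  assumes "bounded_linear L" "\<And>x. c + L x \<in> S" "Ck_on k S f"
  shows "Ck_on k UNIV (\<lambda>x. f (c + L x))"
  using assms(3)
proof (induction k arbitrary: f)
  case 0
  have cont: "continuous_on UNIV (\<lambda>x. c + L x)"
    by (rule continuous_on_add[OF continuous_on_const linear_continuous_on[OF assms(1)]])
  have "continuous_on S f" using 0 by simp
  from continuous_on_compose2[OF this cont] have "continuous_on UNIV (\<lambda>x. f (c + L x))"
    using assms(2) by blast
  then show ?case by simp
next
  case (Suc k)
  have der: "((\<lambda>x. f (c + L x)) has_derivative (\<lambda>v. frechet_derivative f (at (c + L x)) (L v))) (at x)" for x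
  proof -
    have "((\<lambda>x. c + L x) has_derivative L) (at x)"
      using has_derivative_add[OF has_derivative_const bounded_linear_imp_has_derivative[OF assms(1)], of c] by simp
    from has_derivative_compose[OF this Ck_on_has_derivative[OF Suc.prems assms(2)]]
    show ?thesis .
  qed
  have "Ck_on k UNIV (\<lambda>x. frechet_derivative f (at (c + L x)) (L v))" for v
    using Suc.prems by (intro Suc.IH) simp
  then show ?case by (rule Ck_on_SucI[OF der])
qed

lemma Ck_on_vector_derivativeI:
  fixes f :: "real \<Rightarrow> 'b::real_normed_vector"
  assumes "\<And>t. (f has_vector_derivative f' t) (at t)" "Ck_on k UNIV f'"
  shows "Ck_on (Suc k) UNIV f"
  by (rule Ck_on_SucI[OF assms(1)[unfolded has_vector_derivative_def]])
    (use Ck_on_bounded_linear[OF bounded_linear_scaleR_right assms(2)] in simp)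

lemma smooth_on_const: "smooth_on UNIV (\<lambda>x. c)"
  by (simp add: smooth_on_def Ck_on_const)

lemma smooth_on_add:
  "smooth_on UNIV f \<Longrightarrow> smooth_on UNIV g \<Longrightarrow> smooth_on UNIV (\<lambda>x. f x + g x)"
  by (simp add: smooth_on_def Ck_on_add)

lemma smooth_on_bounded_linear:
  "bounded_linear L \<Longrightarrow> smooth_on UNIV f \<Longrightarrow> smooth_on UNIV (\<lambda>x. L (f x))"
  by (simp add: smooth_on_def Ck_on_bounded_linear)

lemma smooth_on_bounded_bilinear:
  "bounded_bilinear B \<Longrightarrow> smooth_on UNIV f \<Longrightarrow> smooth_on UNIV g \<Longrightarrow> smooth_on UNIV (\<lambda>x. B (f x) (g x))"
  by (simp add: smooth_on_def Ck_on_bounded_bilinear)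

lemmas smooth_on_mult = smooth_on_bounded_bilinear[OF bounded_bilinear_mult]
lemmas smooth_on_scaleR = smooth_on_bounded_bilinear[OF bounded_bilinear_scaleR]

lemma smooth_on_power:
  fixes f :: "'a::real_normed_vector \<Rightarrow> real"
  shows "smooth_on UNIV f \<Longrightarrow> smooth_on UNIV (\<lambda>x. f x ^ n)"
  by (induction n) (auto intro: smooth_on_const smooth_on_mult)

lemma smooth_on_comp_affine:
  assumes "bounded_linear L" "\<And>x. c + L x \<in> S" "smooth_on S f"
  shows "smooth_on UNIV (\<lambda>x. f (c + L x))"
  using assms by (auto simp: smooth_on_def intro: Ck_on_comp_affine)

lemma smooth_on_comp_coord:
  assumes "smooth_on UNIV f"
  shows "smooth_on UNIV (\<lambda>x::real^'n. f (x $ i))"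
  using smooth_on_comp_affine[where c = 0 and L = "\<lambda>x::real^'n. x $ i" and S = UNIV and f = f]
    bounded_linear_vec_nth[of i] assms by simp

lemma smooth_on_has_derivative:
  assumes "smooth_on S f" "x \<in> S"
  shows "(f has_derivative frechet_derivative f (at x)) (at x)"
proof (rule Ck_on_has_derivative[OF _ assms(2)])
  show "Ck_on (Suc 0) S f" using assms(1) unfolding smooth_on_def by blast
qed

lemma smooth_on_frechet_derivative:
  "smooth_on S f \<Longrightarrow> smooth_on S (\<lambda>x. frechet_derivative f (at x) v)"
  unfolding smooth_on_def
proof
  fix k
  assume "\<forall>k. Ck_on k S f"
  then have "Ck_on (Suc k) S f" by blast
  then show "Ck_on k S (\<lambda>x. frechet_derivative f (at x) v)" by simp
qed

lemma smooth_on_continuous_on: "smooth_on S f \<Longrightarrow> continuous_on S f"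
  unfolding smooth_on_def using Ck_on.simps(1) by blast

lemma smooth_on_vector_derivative:
  fixes f :: "real \<Rightarrow> 'b::real_normed_vector"
  assumes "smooth_on UNIV f"
  obtains f' where "\<And>t. (f has_vector_derivative f' t) (at t)" "smooth_on UNIV f'"
proof (rule that[of "\<lambda>t. frechet_derivative f (at t) 1"])
  show "(f has_vector_derivative frechet_derivative f (at t) 1) (at t)" for t
  proof -
    have "linear (frechet_derivative f (at t))"
      by (rule has_derivative_linear[OF smooth_on_has_derivative[OF assms UNIV_I]])
    then have "frechet_derivative f (at t) x = x *\<^sub>R frechet_derivative f (at t) 1" for x
      using linear_scale[of "frechet_derivative f (at t)" x 1] by simp
    then have "frechet_derivative f (at t) = (\<lambda>x. x *\<^sub>R frechet_derivative f (at t) 1)" by (rule ext)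
    from has_derivative_eq_rhs[OF smooth_on_has_derivative[OF assms UNIV_I] this]
    show ?thesis unfolding has_vector_derivative_def .
  qed
qed (use smooth_on_frechet_derivative[OF assms] in simp)

text \<open>If the derivative is always as regular as the function, each round gains one order. This
  serves functions that are first known only through a differential equation.\<close>

lemma smooth_on_bootstrap:
  fixes f :: "real \<Rightarrow> 'b::real_normed_vector"
  assumes "\<And>t. (f has_vector_derivative f' t) (at t)"
    and "\<And>k. Ck_on k UNIV f \<Longrightarrow> Ck_on k UNIV f'"
  shows "smooth_on UNIV f"
  unfolding smooth_on_def
proof
  fix k
  show "Ck_on k UNIV f"
  proof (induction k)
    case 0
    show ?case
      using has_vector_derivative_continuous[OF assms(1)] by (simp add: continuous_at_imp_continuous_on)
  next
    case (Suc k)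
    then show ?case by (rule Ck_on_vector_derivativeI[OF assms(1) assms(2)])
  qed
qed

lemma smooth_on_inverse:
  fixes f :: "real \<Rightarrow> real"
  assumes "smooth_on UNIV f" "\<And>t. f t \<noteq> 0"
  shows "smooth_on UNIV (\<lambda>t. 1 / f t)"
proof -
  obtain f' where f': "\<And>t. (f has_vector_derivative f' t) (at t)" "smooth_on UNIV f'"
    using smooth_on_vector_derivative[OF assms(1)] by blast
  show ?thesis
  proof (rule smooth_on_bootstrap)
    \<comment> \<open>The derivative is written as a product with factors \<open>1 / f t\<close>, so
      that the regularity already reached can be fed back.\<close>
    show "((\<lambda>t. 1 / f t) has_vector_derivative (- f' t * ((1 / f t) * (1 / f t)))) (at t)" for t
      using f'(1)[of t] assms(2)[of t]
      by (auto simp: has_real_derivative_iff_has_vector_derivative[symmetric] field_simps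
          intro!: derivative_eq_intros)
    show "Ck_on k UNIV (\<lambda>t. - f' t * ((1 / f t) * (1 / f t)))" if "Ck_on k UNIV (\<lambda>t. 1 / f t)" for k
    proof -
      have "Ck_on k UNIV (\<lambda>t. - f' t)"
        by (rule Ck_on_bounded_linear[OF bounded_linear_minus[OF bounded_linear_ident]])
          (use f'(2) in \<open>simp add: smooth_on_def\<close>)
      moreover have "Ck_on k UNIV (\<lambda>t. 1 / f t * (1 / f t))"
        by (rule Ck_on_bounded_bilinear[OF bounded_bilinear_mult that that])
      ultimately show ?thesis by (rule Ck_on_bounded_bilinear[OF bounded_bilinear_mult])
    qed
  qed
qed

text \<open>Used for the explicit eigenspinor, whose phase is given only by a primitive of
  \<open>h^2\<close>.\<close>

lemma smooth_on_linear_ode: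
  fixes f c :: "real \<Rightarrow> 'b::real_normed_algebra"
  assumes "\<And>t. (f has_vector_derivative c t * f t) (at t)" "smooth_on UNIV c"
  shows "smooth_on UNIV f"
proof (rule smooth_on_bootstrap[OF assms(1)])
  show "Ck_on k UNIV (\<lambda>t. c t * f t)" if "Ck_on k UNIV f" for k
    by (rule Ck_on_bounded_bilinear[OF bounded_bilinear_mult _ that]) (use assms(2) in \<open>simp add: smooth_on_def\<close>)
qed

section \<open>Partial derivatives of functions of t alone\<close>

lemma pd_const: "pd i (\<lambda>z. c) x = 0"
  unfolding pd_def using frechet_derivative_at[OF has_derivative_const, of c x] by metis

lemma pd_eqI: "(f has_derivative f') (at x) \<Longrightarrow> pd i f x = f' (axis i 1)"
  unfolding pd_def using frechet_derivative_at by metis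

lemma has_derivative_fst_coord:
  fixes f :: "real \<Rightarrow> 'b::real_normed_vector"
  assumes "(f has_vector_derivative f') (at (x $ 1))"
  shows "((\<lambda>z::real^2. f (z $ 1)) has_derivative (\<lambda>v. (v $ 1) *\<^sub>R f')) (at x)"
  using has_derivative_compose[OF bounded_linear_imp_has_derivative[OF bounded_linear_vec_nth]
      assms[unfolded has_vector_derivative_def]] by simp

lemma pd_fst_coord:
  fixes f :: "real \<Rightarrow> 'b::real_normed_vector"
  assumes "(f has_vector_derivative f') (at (x $ 1))"
  shows "pd i (\<lambda>z. f (z $ 1)) x = (if i = 1 then f' else 0)"
  using pd_eqI[OF has_derivative_fst_coord[OF assms], of i] by (auto simp: axis_def)

lemma torus_smooth_fst_coord:
  assumes "smooth_on UNIV f" "\<And>t. f (t + 1) = f t"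
  shows "torus_smooth (\<lambda>x. f (x $ 1))"
  unfolding torus_smooth_def
proof (intro conjI allI)
  show "smooth_on UNIV (\<lambda>x::real^2. f (x $ 1))" by (rule smooth_on_comp_coord[OF assms(1)])
  show "f ((x + axis i 1) $ 1) = f (x $ 1)" for x :: "real^2" and i
    using assms(2) by (cases "i = 1") (simp_all add: axis_def)
qed

section \<open>The conformal metric\<close>

lemma conformal_metric_nth:
  "conformal_metric h x $ i $ j = (if i = j then h (x $ 1) ^ 4 else 0)"
  by (simp add: conformal_metric_def flat_metric_def mat_def)

lemma det_conformal_metric: "det (conformal_metric h x) = h (x $ 1) ^ 8"
  by (simp add: det_2 conformal_metric_nth flip: power_add)

lemma sqrt_det_conformal_metric: "sqrt (det (conformal_metric h x)) = h (x $ 1) ^ 4"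
proof -
  have "h (x $ 1) ^ 8 = (h (x $ 1) ^ 4)\<^sup>2" by (simp flip: power_mult)
  then show ?thesis by (simp only: det_conformal_metric real_sqrt_abs) simp
qed

lemma matrix_inv_eqI:
  fixes A B :: "real^'n^'n"
  assumes "A ** B = mat 1" "B ** A = mat 1"
  shows "matrix_inv A = B"
  unfolding matrix_inv_def
proof (rule some_equality)
  fix C assume "A ** C = mat 1 \<and> C ** A = mat 1"
  then show "C = B" by (metis assms(1) matrix_mul_assoc matrix_mul_lid matrix_mul_rid)
qed (use assms in simp)

lemma matrix_inv_conformal_metric:
  assumes "h (x $ 1) \<noteq> 0"
  shows "matrix_inv (conformal_metric h x) = (1 / h (x $ 1) ^ 4) *\<^sub>R mat 1"
proof (rule matrix_inv_eqI)
  show "conformal_metric h x ** ((1 / h (x $ 1) ^ 4) *\<^sub>R mat 1) = mat 1"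
    using assms by (simp add: conformal_metric_def flat_metric_def vec_eq_iff matrix_matrix_mult_def forall_2 sum_2 mat_def)
  show "((1 / h (x $ 1) ^ 4) *\<^sub>R mat 1) ** conformal_metric h x = mat 1"
    using assms by (simp add: conformal_metric_def flat_metric_def vec_eq_iff matrix_matrix_mult_def forall_2 sum_2 mat_def)
qed

lemma metric_inner_conformal_metric:
  "metric_inner (conformal_metric h) x v w = h (x $ 1) ^ 4 * (v $ 1 * w $ 1 + v $ 2 * w $ 2)"
  by (simp add: metric_inner_def sum_2 conformal_metric_nth algebra_simps)

text \<open>In dimension two the density \<open>h^4\<close> cancels the inverse metric
  \<open>h^-4\<close>, so the flux is the flat one and the conformal factor survives only in the
  prefactor.\<close>

lemma laplace_conformal_metric_fst_coord:
  assumes "\<And>t. h t > 0"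
    and "\<And>t. (f has_vector_derivative f' t) (at t)" "\<And>t. (f' has_vector_derivative f'' t) (at t)"
  shows "laplace (conformal_metric h) (\<lambda>z. f (z $ 1)) x = - f'' (x $ 1) / h (x $ 1) ^ 4"
proof -
  have h0: "h t \<noteq> 0" for t using assms(1)[of t] by simp
  have pdf: "pd j (\<lambda>z. f (z $ 1)) z = (if j = 1 then f' (z $ 1) else 0)" for j z
    by (rule pd_fst_coord[OF assms(2)])
  have flux: "sqrt (det (conformal_metric h z)) *
      (\<Sum>j\<in>UNIV. matrix_inv (conformal_metric h z) $ i $ j * pd j (\<lambda>z. f (z $ 1)) z)
      = (if i = 1 then f' (z $ 1) else 0)" for i :: 2 and z
    using h0 exhaust_2[of i]
    by (auto simp: sqrt_det_conformal_metric matrix_inv_conformal_metric pdf sum_2 mat_def)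
  have "laplace (conformal_metric h) (\<lambda>z. f (z $ 1)) x
      = - (1 / h (x $ 1) ^ 4) * (\<Sum>i\<in>UNIV. pd i (\<lambda>z. if i = 1 then f' (z $ 1) else 0) x)"
    unfolding laplace_def flux by (simp only: sqrt_det_conformal_metric)
  then show ?thesis by (simp add: sum_2 pd_const pd_fst_coord[OF assms(3)])
qed

lemma frame_conformal_metric:
  assumes "h (x $ 1) > 0"
  shows "frame (conformal_metric h) i x = (1 / (h (x $ 1))\<^sup>2) *\<^sub>R axis i 1"
proof -
  have s: "sqrt (h (x $ 1) ^ 4) = (h (x $ 1))\<^sup>2"
    using real_sqrt_abs[of "(h (x $ 1))\<^sup>2"] by (simp flip: power_mult)
  show ?thesis
    using exhaust_2[of i]
    by (auto simp: frame_def Let_def metric_inner_conformal_metric s axis_def)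
qed

text \<open>The spin connection pairs the derivative of the first frame vector with the second one,
  so only this component matters. The first frame vector is a multiple of the first coordinate
  vector; its second component vanishes identically and only Christoffel symbols contribute.\<close>

lemma levi_civita_conformal_metric:
  assumes "\<And>t. h t > 0" "\<And>t. (h has_real_derivative h' t) (at t)"
  shows "levi_civita (conformal_metric h) X (frame (conformal_metric h) 1) x $ 2
    = X x $ 2 * (2 * h' (x $ 1) / h (x $ 1)) * (1 / (h (x $ 1))\<^sup>2)"
proof -
  have h0: "h t \<noteq> 0" for t using assms(1)[of t] by simp
  have "((\<lambda>t. h t ^ 4) has_vector_derivative 4 * h t ^ 3 * h' t) (at t)" for t
    using assms(2)[of t]
    by (auto simp: has_real_derivative_iff_has_vector_derivative[symmetric] intro!: derivative_eq_intros)
  note pdh = pd_fst_coord[OF this]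
  have pdg: "pd i (\<lambda>z. conformal_metric h z $ j $ k) x
      = (if j = k \<and> i = 1 then 4 * h (x $ 1) ^ 3 * h' (x $ 1) else 0)" for i j k
    by (cases "j = k") (simp_all add: conformal_metric_nth pdh pd_const)
  have chr: "christoffel (conformal_metric h) 2 1 1 x = 0"
    "christoffel (conformal_metric h) 2 2 1 x = 2 * h' (x $ 1) / h (x $ 1)"
    using h0[of "x $ 1"]
    by (simp_all add: christoffel_def sum_2 pdg matrix_inv_conformal_metric[OF h0] mat_def field_simps eval_nat_numeral)
  have "(\<lambda>z. frame (conformal_metric h) 1 z $ 2) = (\<lambda>z. 0)"
    by (simp add: frame_conformal_metric assms(1) axis_def)
  then show ?thesis
    by (simp add: levi_civita_def sum_2 pd_const chr frame_conformal_metric[OF assms(1)] axis_def)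
qed

section \<open>The Dirac operator\<close>

lemma clifford_mult [simp]:
  "(clifford 1 *v s) $ 1 = \<i> * s $ 2" "(clifford 1 *v s) $ 2 = \<i> * s $ 1"
  "(clifford 2 *v s) $ 1 = - s $ 2" "(clifford 2 *v s) $ 2 = s $ 1"
  by (simp_all add: clifford_def matrix_vector_mult_def sum_2)

lemma bounded_linear_clifford: "bounded_linear (\<lambda>s. clifford i *v s)"
proof -
  have "linear (\<lambda>s. clifford i *v s)"
    using exhaust_2[of i]
    by (intro linearI) (auto simp: vec_eq_iff forall_2 algebra_simps)
  then show ?thesis by (simp add: linear_conv_bounded_linear)
qed

text \<open>The connection form vanishes on the first frame vector. On the second one it contributes
  a multiple of e_1 e_2, and e_2 e_1 e_2 = e_1 turns this into the zero order term
  \<open>h' / h\<close> next to \<open>pd 1\<close>. That term disappears when the spinor is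
  multiplied by \<open>h\<close>.\<close>

lemma dirac_conformal_metric:
  assumes "\<And>t. h t > 0" "\<And>t. (h has_real_derivative h' t) (at t)" "\<psi> differentiable (at x)"
  shows "dirac (conformal_metric h) \<psi> x = (1 / (h (x $ 1))\<^sup>2) *\<^sub>R
    (clifford 1 *v (pd 1 \<psi> x + (h' (x $ 1) / h (x $ 1)) *\<^sub>R \<psi> x) + clifford 2 *v pd 2 \<psi> x)"
proof -
  let ?g = "conformal_metric h"
  let ?r = "(h (x $ 1))\<^sup>2"
  have h0: "h t \<noteq> 0" for t using assms(1)[of t] by simp
  have lin: "frechet_derivative \<psi> (at x) (c *\<^sub>R v) = c *\<^sub>R frechet_derivative \<psi> (at x) v" for c v
    using linear_scale[OF linear_frechet_derivative[OF assms(3)]] .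
  have om: "metric_inner ?g x (levi_civita ?g (frame ?g i) (frame ?g 1) x) (frame ?g 2 x)
      = (if i = 2 then 2 * h' (x $ 1) / (h (x $ 1) * ?r) else 0)" for i
    using h0[of "x $ 1"] exhaust_2[of i]
    by (auto simp: metric_inner_conformal_metric frame_conformal_metric[OF assms(1)]
        levi_civita_conformal_metric[OF assms(1,2)] axis_def field_simps eval_nat_numeral)
  have "spin_connection ?g (frame ?g 1) \<psi> x = (1 / ?r) *\<^sub>R pd 1 \<psi> x"
    "spin_connection ?g (frame ?g 2) \<psi> x = (1 / ?r) *\<^sub>R pd 2 \<psi> x
      + (h' (x $ 1) / (h (x $ 1) * ?r)) *\<^sub>R (clifford 1 *v (clifford 2 *v \<psi> x))"
    unfolding spin_connection_def om
    by (simp_all add: frame_conformal_metric[OF assms(1)] lin pd_def)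
  note S = this
  show ?thesis
    unfolding dirac_def sum_2 S
    using h0[of "x $ 1"]
    by (simp add: vec_eq_iff forall_2 scaleR_conv_of_real[where 'a = complex] field_simps)
qed

section \<open>Mapping properties of the Dirac operator on smooth periodic spinors\<close>

lemma smooth_on_pd: "smooth_on UNIV f \<Longrightarrow> smooth_on UNIV (pd i f)"
  unfolding pd_def[abs_def] by (rule smooth_on_frechet_derivative)

lemma torus_smooth_pd:
  assumes "torus_smooth f"
  shows "torus_smooth (pd i f)"
  unfolding torus_smooth_def
proof (intro conjI allI)
  show "smooth_on UNIV (pd i f)" using assms smooth_on_pd by (auto simp: torus_smooth_def)
  fix x :: "real^2" and j :: 2
  have sm: "smooth_on UNIV f" and per: "(\<lambda>z. f (z + axis j 1)) = f"
    using assms by (auto simp: torus_smooth_def)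
  have "((\<lambda>z. z + axis j 1) has_derivative (\<lambda>v. v)) (at x)"
    by (auto intro!: derivative_eq_intros)
  from has_derivative_compose[where f = "\<lambda>z. z + axis j 1" and g = f, OF this smooth_on_has_derivative[OF sm UNIV_I]]
  have "(f has_derivative frechet_derivative f (at (x + axis j 1))) (at x)" by (simp add: per)
  from pd_eqI[OF this, of i] show "pd i f (x + axis j 1) = pd i f x" by (simp add: pd_def)
qed

lemma torus_smooth_add: "torus_smooth f \<Longrightarrow> torus_smooth g \<Longrightarrow> torus_smooth (\<lambda>x. f x + g x)"
  by (simp add: torus_smooth_def smooth_on_add)

lemma torus_smooth_bounded_linear:
  "bounded_linear L \<Longrightarrow> torus_smooth f \<Longrightarrow> torus_smooth (\<lambda>x. L (f x))"
  by (simp add: torus_smooth_def smooth_on_bounded_linear)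

lemma torus_smooth_scaleR:
  "torus_smooth f \<Longrightarrow> torus_smooth g \<Longrightarrow> torus_smooth (\<lambda>x. f x *\<^sub>R g x)"
  by (simp add: torus_smooth_def smooth_on_scaleR)

lemma torus_smooth_differentiable: "torus_smooth f \<Longrightarrow> f differentiable (at x)"
  unfolding torus_smooth_def using smooth_on_has_derivative differentiable_def by blast

lemma periodic_derivative:
  fixes f :: "real \<Rightarrow> 'b::real_normed_vector"
  assumes "\<And>t. (f has_vector_derivative f' t) (at t)" "\<And>t. f (t + 1) = f t"
  shows "f' (t + 1) = f' t"
proof -
  have "((\<lambda>s. s + 1) has_vector_derivative 1) (at t)"
    unfolding has_vector_derivative_def by (auto intro!: derivative_eq_intros)
  from vector_diff_chain_at[OF this assms(1)]
  have "((\<lambda>s. f (s + 1)) has_vector_derivative f' (t + 1)) (at t)" by (simp add: o_def)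
  then have "(f has_vector_derivative f' (t + 1)) (at t)" by (simp add: assms(2))
  then show ?thesis using vector_derivative_unique_at assms(1) by blast
qed

lemma torus_smooth_dirac:
  assumes h: "smooth_on UNIV h" "\<And>t. h t > 0" "\<And>t. h (t + 1) = h t" and "torus_smooth \<psi>"
  shows "torus_smooth (dirac (conformal_metric h) \<psi>)"
proof -
  obtain h' where h': "\<And>t. (h has_vector_derivative h' t) (at t)" "smooth_on UNIV h'"
    using smooth_on_vector_derivative[OF h(1)] by blast
  have h0: "h t \<noteq> 0" for t using h(2)[of t] by simp
  have per': "h' (t + 1) = h' t" for t by (rule periodic_derivative[OF h'(1) h(3)])
  have r: "torus_smooth (\<lambda>x. 1 / (h (x $ 1))\<^sup>2)"
    by (rule torus_smooth_fst_coord[where f = "\<lambda>t. 1 / (h t)\<^sup>2"])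
      (use h h0 in \<open>auto intro!: smooth_on_inverse smooth_on_power\<close>)
  have "smooth_on UNIV (\<lambda>t. h' t / h t)"
    using smooth_on_mult[OF h'(2) smooth_on_inverse[OF h(1) h0]] by simp
  then have l: "torus_smooth (\<lambda>x. h' (x $ 1) / h (x $ 1))"
    by (rule torus_smooth_fst_coord[where f = "\<lambda>t. h' t / h t"]) (use h per' in auto)
  have "dirac (conformal_metric h) \<psi> = (\<lambda>x. (1 / (h (x $ 1))\<^sup>2) *\<^sub>R
    (clifford 1 *v (pd 1 \<psi> x + (h' (x $ 1) / h (x $ 1)) *\<^sub>R \<psi> x) + clifford 2 *v pd 2 \<psi> x))"
    by (rule ext, rule dirac_conformal_metric[OF h(2) h'(1)[folded has_real_derivative_iff_has_vector_derivative]
          torus_smooth_differentiable[OF assms(4)]])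
  moreover have "torus_smooth \<dots>"
    by (intro torus_smooth_scaleR r torus_smooth_add torus_smooth_bounded_linear[OF bounded_linear_clifford]
        torus_smooth_pd assms(4) l)
  ultimately show ?thesis by simp
qed

lemma pd_add:
  "f differentiable (at x) \<Longrightarrow> g differentiable (at x) \<Longrightarrow> pd i (\<lambda>z. f z + g z) x = pd i f x + pd i g x"
  by (rule pd_eqI[THEN trans, OF has_derivative_add]) (auto simp: frechet_derivative_works pd_def)

lemma pd_bounded_linear:
  "bounded_linear L \<Longrightarrow> f differentiable (at x) \<Longrightarrow> pd i (\<lambda>z. L (f z)) x = L (pd i f x)"
  by (rule pd_eqI[THEN trans, OF bounded_linear.has_derivative]) (auto simp: frechet_derivative_works pd_def)

lemma dirac_add_scaleR:
  assumes h: "smooth_on UNIV h" "\<And>t. h t > 0" 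
    and "\<phi> differentiable (at x)" "\<psi> differentiable (at x)"
  shows "dirac (conformal_metric h) (\<lambda>z. \<phi> z + c *\<^sub>R \<psi> z) x
    = dirac (conformal_metric h) \<phi> x + c *\<^sub>R dirac (conformal_metric h) \<psi> x"
proof -
  obtain h' where h': "\<And>t. (h has_vector_derivative h' t) (at t)"
    using smooth_on_vector_derivative[OF h(1)] by blast
  note D = dirac_conformal_metric[OF h(2) h'[folded has_real_derivative_iff_has_vector_derivative]]
  have c: "(\<lambda>z. c *\<^sub>R \<psi> z) differentiable (at x)"
    "pd i (\<lambda>z. c *\<^sub>R \<psi> z) x = c *\<^sub>R pd i \<psi> x" for i
    using assms(4) by (auto intro!: pd_bounded_linear bounded_linear_scaleR_right)
  show ?thesis
    using assms(3,4) c
    by (simp add: D pd_add vec_eq_iff forall_2 scaleR_conv_of_real[where 'a = complex] algebra_simps)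
qed

text \<open>With l = sqrt nu the operator D^2 - nu factors as (D - l)(D + l). Either (D + l) psi
  vanishes and psi belongs to -l, or (D + l) psi is an eigenspinor for l.\<close>

lemma dirac_square_eigenvalueE:
  assumes h: "smooth_on UNIV h" "\<And>t. h t > 0" "\<And>t. h (t + 1) = h t"
    and ev: "is_eigenvalue (\<lambda>\<psi>. dirac (conformal_metric h) (dirac (conformal_metric h) \<psi>)) \<nu>" and "\<nu> > 0"
  obtains \<phi> lam where "torus_smooth \<phi>" "\<phi> \<noteq> (\<lambda>x. 0)" "lam\<^sup>2 = \<nu>"
    "\<And>x. dirac (conformal_metric h) \<phi> x = lam *\<^sub>R \<phi> x"
proof -
  let ?D = "dirac (conformal_metric h)"
  define l where "l = sqrt \<nu>"
  have l: "l * l = \<nu>" using \<open>\<nu> > 0\<close> by (simp add: l_def)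
  from ev obtain \<psi> where \<psi>: "torus_smooth \<psi>" "\<psi> \<noteq> (\<lambda>x. 0)" "\<And>x. ?D (?D \<psi>) x = \<nu> *\<^sub>R \<psi> x"
    unfolding is_eigenvalue_def by blast
  define \<phi> where "\<phi> = (\<lambda>x. ?D \<psi> x + l *\<^sub>R \<psi> x)"
  have Ds: "torus_smooth (?D \<psi>)" by (rule torus_smooth_dirac[OF h \<psi>(1)])
  show thesis
  proof (cases "\<phi> = (\<lambda>x. 0)")
    case True
    then have "?D \<psi> x = (- l) *\<^sub>R \<psi> x" for x
      by (metis \<phi>_def eq_neg_iff_add_eq_0 scaleR_minus_left)
    with \<psi> l show thesis by (intro that[of \<psi> "- l"]) (auto simp: power2_eq_square)
  next
    case False
    have "?D \<phi> x = l *\<^sub>R \<phi> x" for x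
      unfolding \<phi>_def dirac_add_scaleR[OF h(1,2) torus_smooth_differentiable[OF Ds]
          torus_smooth_differentiable[OF \<psi>(1)]] \<psi>(3)
      by (simp add: l scaleR_add_right add.commute)
    moreover have "torus_smooth \<phi>"
      unfolding \<phi>_def
      by (rule torus_smooth_add[OF Ds torus_smooth_bounded_linear[OF bounded_linear_scaleR_right \<psi>(1)]])
    ultimately show thesis using False l by (intro that[of \<phi> l]) (auto simp: power2_eq_square)
  qed
qed

text \<open>The spinor \<open>h\<phi>\<close> is an eigenspinor of the flat Dirac operator with respect to the weight
  \<open>h\<^sup>2\<close>. The combinations \<open>p\<close> and \<open>m\<close> diagonalize the Clifford multiplication by \<open>\<partial>\<^sub>t\<close>.\<close>

lemma dirac_eigenspinor_system:
  assumes h: "smooth_on UNIV h" "\<And>t. h t > 0" "\<And>t. h (t + 1) = h t"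
    and \<phi>: "torus_smooth \<phi>" "\<And>x. dirac (conformal_metric h) \<phi> x = lam *\<^sub>R \<phi> x"
  defines "p \<equiv> \<lambda>x. h (x $ 1) *\<^sub>R (\<phi> x $ 1 + \<phi> x $ 2)" and "m \<equiv> \<lambda>x. h (x $ 1) *\<^sub>R (\<phi> x $ 1 - \<phi> x $ 2)"
  shows "torus_smooth p" "torus_smooth m"
    "pd 1 p x = - \<i> * of_real (lam * (h (x $ 1))\<^sup>2) * p x + \<i> * pd 2 m x"
    "pd 1 m x = \<i> * of_real (lam * (h (x $ 1))\<^sup>2) * m x + \<i> * pd 2 p x"
proof -
  obtain h' where h': "\<And>t. (h has_vector_derivative h' t) (at t)"
    using smooth_on_vector_derivative[OF h(1)] by blast
  have th: "torus_smooth (\<lambda>x. h (x $ 1))" by (rule torus_smooth_fst_coord[OF h(1,3)])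
  have bl: "bounded_linear (\<lambda>s::complex^2. s $ 1 + s $ 2)" "bounded_linear (\<lambda>s::complex^2. s $ 1 - s $ 2)"
    by (intro bounded_linear_add bounded_linear_sub bounded_linear_vec_nth)+
  show "torus_smooth p" "torus_smooth m"
    unfolding p_def m_def using torus_smooth_scaleR[OF th torus_smooth_bounded_linear[OF bl(1) \<phi>(1)]] torus_smooth_scaleR[OF th torus_smooth_bounded_linear[OF bl(2) \<phi>(1)]]
    by simp_all
  have dh: "((\<lambda>z::real^2. h (z $ 1)) has_derivative (\<lambda>v. (v $ 1) *\<^sub>R h' (x $ 1))) (at x)"
    by (rule has_derivative_fst_coord[OF h'])
  have d\<phi>: "(\<phi> has_derivative frechet_derivative \<phi> (at x)) (at x)"
    using torus_smooth_differentiable[OF \<phi>(1)] by (simp add: frechet_derivative_works)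
  note dp = pd_eqI[OF has_derivative_scaleR[OF dh bounded_linear.has_derivative[OF bl(1) d\<phi>]], folded p_def pd_def]
  note dm = pd_eqI[OF has_derivative_scaleR[OF dh bounded_linear.has_derivative[OF bl(2) d\<phi>]], folded m_def pd_def]
  have hx: "h (x $ 1) \<noteq> 0" using h(2)[of "x $ 1"] by simp
  note D = dirac_conformal_metric[OF h(2) h'[folded has_real_derivative_iff_has_vector_derivative]
      torus_smooth_differentiable[OF \<phi>(1)], of x, unfolded \<phi>(2)]
  have "clifford 1 *v (pd 1 \<phi> x + (h' (x $ 1) / h (x $ 1)) *\<^sub>R \<phi> x) + clifford 2 *v pd 2 \<phi> x
     = (lam * (h (x $ 1))\<^sup>2) *\<^sub>R \<phi> x"
    using arg_cong[OF D, of "\<lambda>v. (h (x $ 1))\<^sup>2 *\<^sub>R v"] hx by (simp add: mult.commute)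
  then have *: "(clifford 1 *v (pd 1 \<phi> x + (h' (x $ 1) / h (x $ 1)) *\<^sub>R \<phi> x) + clifford 2 *v pd 2 \<phi> x) $ i
     = ((lam * (h (x $ 1))\<^sup>2) *\<^sub>R \<phi> x) $ i" for i by simp
  define H H' Q L where "H = complex_of_real (h (x $ 1))" "H' = complex_of_real (h' (x $ 1))"
    "Q = complex_of_real (h' (x $ 1) / h (x $ 1))" "L = complex_of_real (lam * (h (x $ 1))\<^sup>2)"
  note defs = this
  have q: "H' = H * Q" using hx by (simp add: defs)
  have V1: "\<i> * (pd 1 \<phi> x $ 2 + Q * \<phi> x $ 2) - pd 2 \<phi> x $ 2 = L * \<phi> x $ 1"
    using *[of 1] by (simp add: defs scaleR_conv_of_real[where 'a = complex])
  have V2: "\<i> * (pd 1 \<phi> x $ 1 + Q * \<phi> x $ 1) + pd 2 \<phi> x $ 1 = L * \<phi> x $ 2"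
    using *[of 2] by (simp add: defs scaleR_conv_of_real[where 'a = complex])
  have dp: "pd 1 p x = H * (pd 1 \<phi> x $ 1 + pd 1 \<phi> x $ 2) + H' * (\<phi> x $ 1 + \<phi> x $ 2)"
    "pd 2 p x = H * (pd 2 \<phi> x $ 1 + pd 2 \<phi> x $ 2)"
    unfolding dp by (simp_all add: axis_def defs scaleR_conv_of_real[where 'a = complex])
  have dm: "pd 1 m x = H * (pd 1 \<phi> x $ 1 - pd 1 \<phi> x $ 2) + H' * (\<phi> x $ 1 - \<phi> x $ 2)"
    "pd 2 m x = H * (pd 2 \<phi> x $ 1 - pd 2 \<phi> x $ 2)"
    unfolding dm by (simp_all add: axis_def defs scaleR_conv_of_real[where 'a = complex])
  have pm: "p x = H * (\<phi> x $ 1 + \<phi> x $ 2)" "m x = H * (\<phi> x $ 1 - \<phi> x $ 2)"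
    by (simp_all add: p_def m_def defs scaleR_conv_of_real[where 'a = complex])
  have L: "complex_of_real (lam * (h (x $ 1))\<^sup>2) = L" by (simp add: defs)
  \<comment> \<open>In this form the identity is H times the sum of \<open>V1\<close> and
    \<open>V2\<close> and needs no relation for the square of the imaginary unit; the factor -i is
    applied afterwards.\<close>
  have "\<i> * pd 1 p x = L * p x - pd 2 m x"
    unfolding dp dm pm q using V1 V2 by algebra
  from arg_cong[OF this, of "\<lambda>z. - \<i> * z"]
  show "pd 1 p x = - \<i> * of_real (lam * (h (x $ 1))\<^sup>2) * p x + \<i> * pd 2 m x"
    unfolding L by (simp add: algebra_simps)
  have "\<i> * pd 1 m x = - L * m x - pd 2 p x"
    unfolding dp dm pm q using V1 V2 by algebra
  from arg_cong[OF this, of "\<lambda>z. - \<i> * z"]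
  show "pd 1 m x = \<i> * of_real (lam * (h (x $ 1))\<^sup>2) * m x + \<i> * pd 2 p x"
    unfolding L by (simp add: algebra_simps)
qed

section \<open>Fourier coefficients\<close>

lemma periodic_int:
  fixes f :: "real \<Rightarrow> 'a"
  assumes "\<And>t. f (t + 1) = f t"
  shows "f (t + of_int k) = f t"
proof (induction k rule: int_induct[where k = 0])
  case (step1 i)
  then show ?case using assms[of "t + of_int i"] by (simp add: add.assoc)
next
  case (step2 i)
  then show ?case using assms[of "t + of_int (i - 1)"] by (simp add: add.assoc)
qed simp

text \<open>Multiplication by a polynomial in cos and sin preserves the vanishing of all Fourier
  coefficients: a real linear functional of \<open>cis \<theta>\<close> is a combination of
  \<open>cis \<theta>\<close> and \<open>cis (- \<theta>)\<close>, which shift the index by one. The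
  function \<open>g\<close> stays arbitrary so that products are handled by multiplying
  twice.\<close>

lemma real_polynomial_function_fourier_zero:
  fixes g :: "real \<Rightarrow> complex"
  assumes "real_polynomial_function p" "continuous_on {0..1} g"
    "\<And>k::int. integral {0..1} (\<lambda>t. cis (2 * pi * k * t) * g t) = 0"
  shows "continuous_on {0..1} (\<lambda>t. of_real (p (cis (2 * pi * t))) * g t) \<and>
    (\<forall>k::int. integral {0..1} (\<lambda>t. cis (2 * pi * k * t) * (of_real (p (cis (2 * pi * t))) * g t)) = 0)"
  using assms
proof (induction p arbitrary: g rule: real_polynomial_function.induct)
  case (linear L)
  have int: "(\<lambda>t. cis (2 * pi * of_int k * t) * g t) integrable_on {0..1}" for k :: int
    by (intro integrable_continuous_interval continuous_intros linear.prems(1) continuous_on_cis)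
  let ?\<alpha> = "of_real (L 1) / 2 - \<i> * of_real (L \<i>) / 2 :: complex"
  let ?\<beta> = "of_real (L 1) / 2 + \<i> * of_real (L \<i>) / 2 :: complex"
  have L: "L z = Re z * L 1 + Im z * L \<i>" for z
  proof -
    have "L (Re z *\<^sub>R 1 + Im z *\<^sub>R \<i>) = Re z * L 1 + Im z * L \<i>"
      using linear(1) by (simp only: bounded_linear.linear linear_add linear_scale real_scaleR_def)
    moreover have "Re z *\<^sub>R 1 + Im z *\<^sub>R \<i> = z" by (simp add: complex_eq_iff)
    ultimately show ?thesis by simp
  qed
  have Lcis: "of_real (L (cis \<theta>)) = ?\<alpha> * cis \<theta> + ?\<beta> * cis (- \<theta>)" for \<theta>
    unfolding L[of "cis \<theta>"] by (simp add: complex_eq_iff)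
  have shift: "cis (2 * pi * of_int k * t) * (of_real (L (cis (2 * pi * t))) * g t)
    = ?\<alpha> * (cis (2 * pi * of_int (k + 1) * t) * g t) + ?\<beta> * (cis (2 * pi * of_int (k - 1) * t) * g t)"
    for k :: int and t
  proof -
    have "cis (2 * pi * of_int (k + 1) * t) = cis (2 * pi * of_int k * t) * cis (2 * pi * t)"
      "cis (2 * pi * of_int (k - 1) * t) = cis (2 * pi * of_int k * t) * cis (- (2 * pi * t))"
      by (simp_all add: cis_mult algebra_simps)
    then show ?thesis by (simp only: Lcis) (simp add: algebra_simps)
  qed
  show ?case
  proof (intro conjI allI)
    show "continuous_on {0..1} (\<lambda>t. of_real (L (cis (2 * pi * t))) * g t)"
      unfolding Lcis by (intro continuous_intros linear.prems(1) continuous_on_cis)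
    fix k :: int
    show "integral {0..1} (\<lambda>t. cis (2 * pi * of_int k * t) * (of_real (L (cis (2 * pi * t))) * g t)) = 0"
      unfolding shift
      by (subst integral_add) (use int linear.prems(2) in \<open>simp_all only: integrable_on_mult_right integral_mult_right mult_zero_right add_0_right\<close>)
  qed
next
  case (const c)
  then show ?case
    by (auto intro!: continuous_intros simp: mult.left_commute[of _ "of_real c"])
next
  case (add p q)
  have p: "continuous_on {0..1} (\<lambda>t. of_real (p (cis (2 * pi * t))) * g t)"
    "\<And>k::int. integral {0..1} (\<lambda>t. cis (2 * pi * k * t) * (of_real (p (cis (2 * pi * t))) * g t)) = 0"
    using add.IH(1)[OF add.prems] by auto
  have q: "continuous_on {0..1} (\<lambda>t. of_real (q (cis (2 * pi * t))) * g t)"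
    "\<And>k::int. integral {0..1} (\<lambda>t. cis (2 * pi * k * t) * (of_real (q (cis (2 * pi * t))) * g t)) = 0"
    using add.IH(2)[OF add.prems] by auto
  show ?case
  proof (intro conjI allI)
    show "continuous_on {0..1} (\<lambda>t. of_real (p (cis (2 * pi * t)) + q (cis (2 * pi * t))) * g t)"
      unfolding of_real_add distrib_right by (intro continuous_on_add p q)
    fix k :: int
    show "integral {0..1} (\<lambda>t. cis (2 * pi * k * t) * (of_real (p (cis (2 * pi * t)) + q (cis (2 * pi * t))) * g t)) = 0"
      unfolding of_real_add distrib_right distrib_left
      by (subst integral_add)
        (auto intro!: integrable_continuous_interval continuous_intros continuous_on_cis p q simp: p(2) q(2))
  qed
next
  case (mult p q)
  have q: "continuous_on {0..1} (\<lambda>t. of_real (q (cis (2 * pi * t))) * g t)"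
    "\<And>k::int. integral {0..1} (\<lambda>t. cis (2 * pi * k * t) * (of_real (q (cis (2 * pi * t))) * g t)) = 0"
    using mult.IH(2)[OF mult.prems] by auto
  show ?case using mult.IH(1)[OF q] by (simp add: mult.assoc)
qed

text \<open>Transfers a periodic function to the circle, the compact set on which polynomial
  approximation takes place.\<close>

lemma continuous_periodic_circle:
  fixes f :: "real \<Rightarrow> 'a::real_normed_vector"
  assumes "continuous_on UNIV f" "\<And>t. f (t + 1) = f t"
  obtains F where "continuous_on (sphere 0 1) F" "\<And>t. t \<in> {0..1} \<Longrightarrow> F (cis (2 * pi * t)) = f t"
proof -
  let ?F = "f \<circ> (\<lambda>z. Arg2pi z / (2 * pi))"
  \<comment> \<open>The constant homotopy of the loop yields continuity of the circle map, including
    the point 1 where \<open>Arg2pi\<close> jumps.\<close>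
  have "homotopic_loops UNIV f f"
    using assms(2)[of 0]
    by (auto simp: homotopic_loops_refl path_def pathstart_def pathfinish_def
        intro: continuous_on_subset[OF assms(1)])
  from homotopic_with_imp_continuous[OF homotopic_loops_imp_homotopic_circlemaps[OF this]]
  have cont: "continuous_on (sphere 0 1) ?F" by simp
  have "?F (cis (2 * pi * t)) = f t" if "t \<in> {0..1}" for t
  proof (cases "t = 1")
    case True
    have "Arg2pi 1 = 0" by (rule Arg2pi_unique[of 1]) auto
    then show ?thesis using True assms(2)[of 0] by simp
  next
    case False
    with that have "Arg2pi (cis (2 * pi * t)) = 2 * pi * t"
      by (intro Arg2pi_unique[of 1]) (auto simp: cis_conv_exp)
    then show ?thesis by simp
  qed
  with cont show thesis by (rule that)
qed

text \<open>Approximating by trigonometric polynomials shows that u(f) f has integral 0 for every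
  continuous real u. Choosing Re and Im for u makes the squares of both parts of f integrate to
  0.\<close>

lemma fourier_zero_imp_zero:
  fixes f :: "real \<Rightarrow> complex"
  assumes cont: "continuous_on UNIV f" and per: "\<And>t. f (t + 1) = f t"
    and zero: "\<And>k::int. integral {0..1} (\<lambda>t. cis (2 * pi * k * t) * f t) = 0"
  shows "f t = 0"
proof -
  obtain F where F: "continuous_on (sphere 0 1) F" "\<And>t. t \<in> {0..1} \<Longrightarrow> F (cis (2 * pi * t)) = f t"
    using continuous_periodic_circle[OF cont per] by blast
  have cf: "continuous_on {0..1} f" by (rule continuous_on_subset[OF cont]) simp
  \<comment> \<open>The composition of \<open>u\<close> and \<open>F\<close> is approximated on the
    circle, not \<open>f\<close> itself: polynomial approximation is for real functions, and the
    integral against \<open>f\<close> then changes by at most \<open>e * M\<close>.\<close>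
  have orth: "integral {0..1} (\<lambda>t. of_real (u (F (cis (2 * pi * t)))) * f t) = 0"
    if u: "continuous_on UNIV u" for u :: "complex \<Rightarrow> real"
  proof -
    let ?I = "integral {0..1} (\<lambda>t. of_real (u (F (cis (2 * pi * t)))) * f t)"
    obtain M where M: "M > 0" "\<And>t. t \<in> {0..1} \<Longrightarrow> norm (f t) \<le> M"
      using compact_imp_bounded[OF compact_continuous_image[OF cf compact_Icc]]
      by (auto simp: bounded_pos)
    have cu: "continuous_on (sphere 0 1) (\<lambda>z. u (F z))"
      by (rule continuous_on_compose2[OF u F(1)]) simp
    have le: "norm ?I \<le> e * M" if e: "e > 0" for e
    proof -
      obtain p where p: "real_polynomial_function p" "\<And>z. z \<in> sphere 0 1 \<Longrightarrow> \<bar>u (F z) - p z\<bar> < e"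
        using Stone_Weierstrass_real_polynomial_function[OF compact_sphere cu e] by blast
      note pz = real_polynomial_function_fourier_zero[OF p(1) cf zero]
      have ci: "continuous_on {0..1} (\<lambda>t. of_real (u (F (cis (2 * pi * t)))) * f t)"
        by (intro continuous_intros cf continuous_on_compose2[OF cu] continuous_on_cis) auto
      have "?I = ?I - integral {0..1} (\<lambda>t. of_real (p (cis (2 * pi * t))) * f t)"
        using conjunct2[OF pz, rule_format, of 0] by simp
      also have "\<dots> = integral {0..1} (\<lambda>t. of_real (u (F (cis (2 * pi * t)))) * f t - of_real (p (cis (2 * pi * t))) * f t)"
        by (rule integral_diff[symmetric]) (use ci pz in \<open>auto intro!: integrable_continuous_interval\<close>)
      finally have eq: "?I = \<dots>" .
      have "norm \<dots> \<le> e * M * (1 - 0)"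
      proof (rule integral_bound)
        show "continuous_on {0..1} (\<lambda>t. of_real (u (F (cis (2 * pi * t)))) * f t - of_real (p (cis (2 * pi * t))) * f t)"
          using ci pz by (auto intro!: continuous_intros)
        fix t :: real assume t: "t \<in> {0..1}"
        have "norm (of_real (u (F (cis (2 * pi * t)))) * f t - of_real (p (cis (2 * pi * t))) * f t)
          = \<bar>u (F (cis (2 * pi * t))) - p (cis (2 * pi * t))\<bar> * norm (f t)"
          by (simp flip: left_diff_distrib of_real_diff add: norm_mult)
        also have "\<dots> \<le> e * M"
          using p(2)[of "cis (2 * pi * t)"] M(2)[OF t] e by (intro mult_mono) auto
        finally show "norm (of_real (u (F (cis (2 * pi * t)))) * f t - of_real (p (cis (2 * pi * t))) * f t) \<le> e * M" .
      qed simp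
      then show ?thesis using eq by simp
    qed
    have "norm ?I \<le> 0 + e" if "e > 0" for e
      using le[of "e / M"] that M(1) by simp
    then have "norm ?I \<le> 0" by (rule field_le_epsilon)
    then show ?thesis by simp
  qed
  have orth': "integral {0..1} (\<lambda>t. of_real (u (f t)) * f t) = 0" if "continuous_on UNIV u" for u :: "complex \<Rightarrow> real"
    using orth[OF that] F(2) by (subst (asm) integral_cong[where g = "\<lambda>t. of_real (u (f t)) * f t"]) auto
  have ci: "(\<lambda>t. of_real (u (f t)) * f t) integrable_on {0..1}" if "continuous_on UNIV u" for u :: "complex \<Rightarrow> real"
    by (intro integrable_continuous_interval continuous_intros cf continuous_on_compose2[OF that cf]) auto
  have "integral {0..1} (\<lambda>t. Re (f t) * Re (f t)) = Re (integral {0..1} (\<lambda>t. of_real (Re (f t)) * f t))"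
    using integral_linear[OF ci bounded_linear_Re, of Re] by (simp add: o_def continuous_on_Re continuous_on_id)
  then have re: "integral {0..1} (\<lambda>t. Re (f t) * Re (f t)) = 0"
    by (simp add: orth' continuous_on_Re continuous_on_id)
  have "integral {0..1} (\<lambda>t. Im (f t) * Im (f t)) = Im (integral {0..1} (\<lambda>t. of_real (Im (f t)) * f t))"
    using integral_linear[OF ci bounded_linear_Im, of Im] by (simp add: o_def continuous_on_Im continuous_on_id)
  then have im: "integral {0..1} (\<lambda>t. Im (f t) * Im (f t)) = 0"
    by (simp add: orth' continuous_on_Im continuous_on_id)
  have z: "f t = 0" if "t \<in> {0..1}" for t
  proof -
    have "Re (f t) * Re (f t) = 0"
      using that re by (subst (asm) integral_eq_0_iff) (auto intro!: continuous_intros cf)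
    moreover have "Im (f t) * Im (f t) = 0"
      using that im by (subst (asm) integral_eq_0_iff) (auto intro!: continuous_intros cf)
    ultimately show ?thesis by (simp add: complex_eq_iff)
  qed
  have "f t = f (frac t)"
    using periodic_int[where f = f and t = "frac t" and k = "\<lfloor>t\<rfloor>", OF per] by (simp add: frac_def)
  also have "\<dots> = 0" using frac_lt_1[of t] by (intro z) (auto intro: less_imp_le)
  finally show ?thesis .
qed

section \<open>Fourier coefficients in the variable y\<close>

definition point :: "real \<Rightarrow> real \<Rightarrow> real^2" where
  "point t y = t *\<^sub>R axis 1 1 + y *\<^sub>R axis 2 1"

lemma point_nth [simp]: "point t y $ 1 = t" "point t y $ 2 = y"
  by (simp_all add: point_def axis_def)

lemma point_eta [simp]: "point (x $ 1) (x $ 2) = x"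
  by (simp add: vec_eq_iff forall_2)

lemma point_add_1: "point (t + 1) y = point t y + axis 1 1" "point t (y + 1) = point t y + axis 2 1"
  by (simp_all add: point_def algebra_simps)

lemma has_vector_derivative_point:
  assumes "torus_smooth f"
  shows "((\<lambda>t. f (point t y)) has_vector_derivative pd 1 f (point t y)) (at t)"
    "((\<lambda>y. f (point t y)) has_vector_derivative pd 2 f (point t y)) (at y)"
proof -
  have d: "(f has_derivative frechet_derivative f (at x)) (at x)" for x
    using torus_smooth_differentiable[OF assms] by (simp add: frechet_derivative_works)
  have s: "frechet_derivative f (at x) (c *\<^sub>R v) = c *\<^sub>R frechet_derivative f (at x) v" for x v c
    using linear_scale[OF has_derivative_linear[OF d]] .
  have "((\<lambda>t. point t y) has_derivative (\<lambda>c. c *\<^sub>R axis 1 1)) (at t)"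
    unfolding point_def by (auto intro!: derivative_eq_intros)
  from has_derivative_compose[where g = f, OF this d]
  show "((\<lambda>t. f (point t y)) has_vector_derivative pd 1 f (point t y)) (at t)"
    unfolding has_vector_derivative_def pd_def s .
  have "((\<lambda>y. point t y) has_derivative (\<lambda>c. c *\<^sub>R axis 2 1)) (at y)"
    unfolding point_def by (auto intro!: derivative_eq_intros)
  from has_derivative_compose[where g = f, OF this d]
  show "((\<lambda>y. f (point t y)) has_vector_derivative pd 2 f (point t y)) (at y)"
    unfolding has_vector_derivative_def pd_def s .
qed

lemma continuous_on_point:
  assumes "torus_smooth f" "continuous_on S a" "continuous_on S b"
  shows "continuous_on S (\<lambda>z. f (point (a z) (b z)))"
proof -
  have "continuous_on UNIV f" using assms(1) smooth_on_continuous_on by (auto simp: torus_smooth_def)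
  moreover have "continuous_on S (\<lambda>z. point (a z) (b z))"
    unfolding point_def by (intro continuous_intros assms)
  ultimately show ?thesis by (rule continuous_on_compose2) simp
qed

text \<open>In the usual convention this is the coefficient of index \<open>-k\<close>, hence the
  minus sign produced by the derivative in y.\<close>

definition fourier_y :: "int \<Rightarrow> (real^2 \<Rightarrow> complex) \<Rightarrow> real \<Rightarrow> complex" where
  "fourier_y k f t = integral {0..1} (\<lambda>y. cis (2 * pi * k * y) * f (point t y))"

lemma has_vector_derivative_fourier_y:
  assumes "torus_smooth f"
  shows "(fourier_y k f has_vector_derivative fourier_y k (pd 1 f) t) (at t)"
proof -
  have "((\<lambda>t. integral (cbox 0 1) (\<lambda>y. cis (2 * pi * k * y) * f (point t y))) has_vector_derivative
      integral (cbox 0 1) (\<lambda>y. cis (2 * pi * k * y) * pd 1 f (point t y))) (at t within UNIV)"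
  proof (rule leibniz_rule_vector_derivative)
    show "((\<lambda>t. cis (2 * pi * k * y) * f (point t y)) has_vector_derivative
        cis (2 * pi * k * y) * pd 1 f (point t y)) (at t within UNIV)" for t y
      using has_vector_derivative_mult_right[OF has_vector_derivative_point(1)[OF assms]] .
    show "(\<lambda>y. cis (2 * pi * k * y) * f (point t y)) integrable_on cbox 0 1" for t
      unfolding box_real by (intro integrable_continuous_interval continuous_intros continuous_on_cis continuous_on_point assms)
    show "continuous_on (UNIV \<times> cbox 0 1) (\<lambda>(t, y). cis (2 * pi * k * y) * pd 1 f (point t y))"
      unfolding split_beta
      by (intro continuous_intros continuous_on_cis continuous_on_point torus_smooth_pd assms)
  qed auto
  then show ?thesis by (simp add: fourier_y_def[abs_def])
qed

lemma fourier_y_pd_2: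
  assumes "torus_smooth f"
  shows "fourier_y k (pd 2 f) t = - (2 * pi * k * \<i>) * fourier_y k f t"
proof -
  let ?e = "\<lambda>y. cis (2 * pi * k * y)"
  have c: "(\<lambda>y. ?e y * g (point t y)) integrable_on {0..1}" if "torus_smooth g" for g
    by (intro integrable_continuous_interval continuous_intros continuous_on_cis continuous_on_point that)
  have "(?e has_vector_derivative (2 * pi * k * \<i>) * ?e y) (at y)" for y
    unfolding cis_conv_exp by (auto intro!: derivative_eq_intros has_vector_derivative_real_field)
  from has_vector_derivative_mult[OF this has_vector_derivative_point(2)[OF assms]]
  have "((\<lambda>y. ?e y * f (point t y)) has_vector_derivative
      ?e y * pd 2 f (point t y) + (2 * pi * k * \<i>) * ?e y * f (point t y)) (at y)" for y .
  then have "((\<lambda>y. ?e y * pd 2 f (point t y) + (2 * pi * k * \<i>) * (?e y * f (point t y))) has_integral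
      ?e 1 * f (point t 1) - ?e 0 * f (point t 0)) {0..1}"
    by (intro fundamental_theorem_of_calculus) (auto simp: mult.assoc intro: has_vector_derivative_at_within)
  moreover have "?e 1 = 1" by (simp add: cis_multiple_2pi)
  moreover have "f (point t 1) = f (point t 0)"
    using assms point_add_1(2)[of t 0] by (simp add: torus_smooth_def)
  ultimately have "integral {0..1} (\<lambda>y. ?e y * pd 2 f (point t y) + (2 * pi * k * \<i>) * (?e y * f (point t y))) = 0"
    by (simp add: integral_unique)
  then show ?thesis
    using c[OF torus_smooth_pd[OF assms]] c[OF assms]
    by (subst (asm) integral_add) (auto simp: fourier_y_def eq_neg_iff_add_eq_0 intro: integrable_on_mult_right)
qed

text \<open>The factor \<open>a\<close> depends on t only and leaves the integral over y. This is
  what decouples the Fourier modes of the eigenspinor system.\<close>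

lemma fourier_y_linear:
  assumes "torus_smooth f" "torus_smooth g"
  shows "fourier_y k (\<lambda>x. a (x $ 1) * f x + b * g x) t = a t * fourier_y k f t + b * fourier_y k g t"
proof -
  let ?e = "\<lambda>y. cis (2 * pi * k * y)"
  have c: "(\<lambda>y. ?e y * g (point t y)) integrable_on {0..1}" if "torus_smooth g" for g
    by (intro integrable_continuous_interval continuous_intros continuous_on_cis continuous_on_point that)
  have "fourier_y k (\<lambda>x. a (x $ 1) * f x + b * g x) t
      = integral {0..1} (\<lambda>y. a t * (?e y * f (point t y)) + b * (?e y * g (point t y)))"
    by (simp add: fourier_y_def algebra_simps)
  then show ?thesis
    using c[OF assms(1)] c[OF assms(2)]
    by (subst (asm) integral_add) (auto simp: fourier_y_def intro: integrable_on_mult_right)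
qed

lemma fourier_y_periodic:
  assumes "torus_smooth f"
  shows "fourier_y k f (t + 1) = fourier_y k f t"
  using assms by (simp add: fourier_y_def point_add_1 torus_smooth_def)

lemma fourier_y_nonzero:
  assumes "torus_smooth f" "f x \<noteq> 0"
  obtains k where "fourier_y k f (x $ 1) \<noteq> 0"
proof (rule ccontr)
  assume "\<not> thesis"
  then have z: "fourier_y k f (x $ 1) = 0" for k using that by blast
  have "f (point (x $ 1) (x $ 2)) = 0"
  proof (rule fourier_zero_imp_zero[of "\<lambda>y. f (point (x $ 1) y)"])
    show "continuous_on UNIV (\<lambda>y. f (point (x $ 1) y))"
      by (intro continuous_on_point assms continuous_intros)
    show "f (point (x $ 1) (y + 1)) = f (point (x $ 1) y)" for y
      using assms by (simp add: point_add_1 torus_smooth_def)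
    show "integral {0..1} (\<lambda>y. cis (2 * pi * of_int k * y) * f (point (x $ 1) y)) = 0" for k
      using z[of k] by (simp add: fourier_y_def)
  qed
  with assms(2) show False by simp
qed

section \<open>Eigenvalues of the Dirac operator\<close>

lemma cos_ge_one_minus_square: "1 - x\<^sup>2 / 2 \<le> cos (x::real)"
proof -
  have "(sin (x / 2))\<^sup>2 \<le> (x / 2)\<^sup>2"
    using abs_sin_x_le_abs_x[of "x / 2"] by (simp only: abs_le_square_iff)
  moreover have "cos x = 1 - 2 * (sin (x / 2))\<^sup>2"
    using cos_double_sin[of "x / 2"] by simp
  ultimately show ?thesis by (simp add: power2_eq_square)
qed

text \<open>The gauge \<open>e\<^bsup>-2i\<lambda>S\<^esup>\<close> replaces the weight \<open>\<rho>\<close> by its mean \<open>r\<close> in the derivative of the periodic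
  function \<open>Re (e\<^bsup>-2i\<lambda>S\<^esup> cnj u v)\<close>. If \<open>\<bar>\<lambda>\<bar>r\<close> were too small, this function would be monotone.\<close>

lemma dirac_mode_bound:
  fixes u v :: "real \<Rightarrow> complex" and \<kappa> lam r s :: real
  assumes S: "\<And>t. (S has_real_derivative \<rho> t - r) (at t)" "\<And>t. S (t + 1) = S t" "\<And>t. \<bar>S t\<bar> \<le> s"
    and u: "\<And>t. (u has_vector_derivative - \<i> * of_real (lam * \<rho> t) * u t - of_real \<kappa> * v t) (at t)"
      "\<And>t. u (t + 1) = u t"
    and v: "\<And>t. (v has_vector_derivative \<i> * of_real (lam * \<rho> t) * v t - of_real \<kappa> * u t) (at t)"
      "\<And>t. v (t + 1) = v t"
    and nz: "u t0 \<noteq> 0 \<or> v t0 \<noteq> 0" and "\<kappa> \<noteq> 0" "r > 0"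
  shows "\<bar>lam\<bar> * r \<ge> \<bar>\<kappa>\<bar> * (1 - 2 * lam\<^sup>2 * s\<^sup>2)"
proof (rule ccontr)
  assume "\<not> ?thesis"
  then have less: "\<bar>lam\<bar> * r < \<bar>\<kappa>\<bar> * (1 - 2 * lam\<^sup>2 * s\<^sup>2)" by simp
  define c where "c = (\<lambda>t. cis (- (2 * lam * S t)))"
  define w where "w = (\<lambda>t. c t * (cnj (u t) * v t))"
  define n where "n = (\<lambda>t. (norm (u t))\<^sup>2 + (norm (v t))\<^sup>2)"
  \<comment> \<open>The factor \<open>\<kappa>\<close> gives the second term of \<open>b\<close> the
    coefficient \<open>-\<kappa>^2\<close>, so its sign does not depend on that of
    \<open>\<kappa>\<close>.\<close>
  define B where "B = (\<lambda>t. \<kappa> * Re (w t))"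
  define b where "b = (\<lambda>t. - 2 * \<kappa> * lam * r * Im (w t) - \<kappa>\<^sup>2 * n t * Re (c t))"
  have cu: "((\<lambda>t. cnj (u t)) has_vector_derivative \<i> * of_real (lam * \<rho> t) * cnj (u t) - of_real \<kappa> * cnj (v t)) (at t)" for t
    using bounded_linear.has_vector_derivative[OF bounded_linear_cnj u(1)[of t]] by simp
  have c': "(c has_vector_derivative - \<i> * of_real (2 * lam * (\<rho> t - r)) * c t) (at t)" for t
  proof -
    have "((\<lambda>t. \<i> * of_real (- (2 * lam * S t))) has_vector_derivative \<i> * of_real (- (2 * lam * (\<rho> t - r)))) (at t)"
      by (intro has_vector_derivative_mult_right has_vector_derivative_of_real
          DERIV_minus DERIV_cmult S(1)[unfolded has_real_derivative_iff_has_vector_derivative[symmetric]])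
    from field_vector_diff_chain_at[OF this DERIV_exp]
    show ?thesis unfolding c_def cis_conv_exp by (simp add: o_def mult_ac)
  qed
  have nn: "of_real (n t) = u t * cnj (u t) + v t * cnj (v t)" for t
    by (simp only: n_def of_real_add complex_norm_square)
  have w': "(w has_vector_derivative 2 * \<i> * of_real (lam * r) * w t - of_real (\<kappa> * n t) * c t) (at t)" for t
    unfolding w_def
    by (rule has_vector_derivative_eq_rhs[OF has_vector_derivative_mult[OF c' has_vector_derivative_mult[OF cu v(1)]]])
      (simp add: nn algebra_simps)
  have B': "(B has_real_derivative b t) (at t)" for t
  proof -
    have "((\<lambda>t. Re (w t)) has_vector_derivative Re (2 * \<i> * of_real (lam * r) * w t - of_real (\<kappa> * n t) * c t)) (at t)"
      by (rule bounded_linear.has_vector_derivative[OF bounded_linear_Re w'])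
    then have "((\<lambda>t. Re (w t)) has_real_derivative - 2 * lam * r * Im (w t) - \<kappa> * n t * Re (c t)) (at t)"
      by (simp add: has_real_derivative_iff_has_vector_derivative mult.assoc)
    from DERIV_cmult[OF this, of \<kappa>] show ?thesis
      by (simp add: B_def b_def algebra_simps power2_eq_square)
  qed
  have bn: "b t \<le> \<bar>\<kappa>\<bar> * n t * (\<bar>lam\<bar> * r - \<bar>\<kappa>\<bar> * (1 - 2 * lam\<^sup>2 * s\<^sup>2))" for t
  proof -
    have "norm (w t) = norm (u t) * norm (v t)" by (simp add: w_def c_def norm_mult)
    then have "2 * norm (w t) \<le> n t"
      using sum_squares_bound[of "norm (u t)" "norm (v t)"] by (simp add: n_def)
    then have wn: "2 * \<bar>Im (w t)\<bar> \<le> n t" using abs_Im_le_cmod[of "w t"] by simp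
    have "- 2 * \<kappa> * lam * r * Im (w t) \<le> \<bar>- 2 * \<kappa> * lam * r * Im (w t)\<bar>" by simp
    also have "\<dots> = (\<bar>\<kappa>\<bar> * \<bar>lam\<bar> * r) * (2 * \<bar>Im (w t)\<bar>)" using \<open>r > 0\<close> by (simp add: abs_mult)
    also have "\<dots> \<le> (\<bar>\<kappa>\<bar> * \<bar>lam\<bar> * r) * n t" using wn \<open>r > 0\<close> by (intro mult_left_mono) auto
    finally have 1: "- 2 * \<kappa> * lam * r * Im (w t) \<le> \<bar>\<kappa>\<bar> * \<bar>lam\<bar> * r * n t" .
    have "(S t)\<^sup>2 \<le> s\<^sup>2" using S(3)[of t] by (metis abs_ge_zero abs_le_square_iff abs_of_nonneg order_trans)
    then have "lam\<^sup>2 * (S t)\<^sup>2 \<le> lam\<^sup>2 * s\<^sup>2" by (intro mult_left_mono) auto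
    moreover have "Re (c t) \<ge> 1 - 2 * (lam\<^sup>2 * (S t)\<^sup>2)"
      using cos_ge_one_minus_square[of "2 * lam * S t"] by (simp add: c_def power_mult_distrib)
    ultimately have "Re (c t) \<ge> 1 - 2 * lam\<^sup>2 * s\<^sup>2" by linarith
    then have "\<kappa>\<^sup>2 * n t * (1 - 2 * lam\<^sup>2 * s\<^sup>2) \<le> \<kappa>\<^sup>2 * n t * Re (c t)"
      by (intro mult_left_mono) (auto simp: n_def)
    moreover have "\<kappa>\<^sup>2 = \<bar>\<kappa>\<bar> * \<bar>\<kappa>\<bar>" by (simp add: power2_eq_square)
    ultimately show ?thesis using 1 by (simp add: b_def algebra_simps)
  qed
  have n0: "n t \<ge> 0" for t by (simp add: n_def)
  have b0: "b t \<le> 0" for t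
  proof -
    have "\<bar>\<kappa>\<bar> * n t * (\<bar>lam\<bar> * r - \<bar>\<kappa>\<bar> * (1 - 2 * lam\<^sup>2 * s\<^sup>2)) \<le> 0"
      using less n0[of t] by (intro mult_nonneg_nonpos) auto
    with bn[of t] show ?thesis by linarith
  qed
  have mono: "B y \<le> B x" if "x \<le> y" for x y
    using DERIV_nonpos_imp_nonincreasing[OF that] B' b0 by blast
  have per: "B (t + 1) = B t" for t
    by (simp add: B_def w_def c_def S(2) u(2) v(2))
  \<comment> \<open>A nonincreasing periodic function is constant, so its derivative vanishes at
    \<open>t0\<close>; the strict form of \<open>bn\<close> contradicts this because
    \<open>n t0\<close> is positive.\<close>
  have "b t0 = 0"
  proof (rule DERIV_local_const[OF B'])
    show "\<forall>y. \<bar>t0 - y\<bar> < 1 \<longrightarrow> B t0 = B y"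
    proof (intro allI impI)
      fix y assume "\<bar>t0 - y\<bar> < 1"
      then have "B y \<le> B (t0 - 1)" "B (t0 + 1) \<le> B y" by (auto intro!: mono)
      with per[of t0] per[of "t0 - 1"] show "B t0 = B y" by simp
    qed
  qed simp
  moreover have "n t0 > 0" using nz by (auto simp: n_def sum_power2_gt_zero_iff)
  then have "\<bar>\<kappa>\<bar> * n t0 * (\<bar>lam\<bar> * r - \<bar>\<kappa>\<bar> * (1 - 2 * lam\<^sup>2 * s\<^sup>2)) < 0"
    using less \<open>\<kappa> \<noteq> 0\<close> by (intro mult_pos_neg) auto
  ultimately show False using bn[of t0] by linarith
qed

lemma has_vector_derivative_cis:
  assumes "(R has_real_derivative R') (at t)"
  shows "((\<lambda>t. cis (R t)) has_vector_derivative \<i> * of_real R' * cis (R t)) (at t)"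
proof -
  have "((\<lambda>t. \<i> * of_real (R t)) has_vector_derivative \<i> * of_real R') (at t)"
    by (intro has_vector_derivative_mult_right has_vector_derivative_of_real assms)
  from field_vector_diff_chain_at[OF this DERIV_exp]
  show ?thesis unfolding cis_conv_exp by (simp add: o_def mult_ac)
qed

text \<open>The solution is a constant multiple of e^(i lam R). Periodicity forces lam r to be an
  integer multiple of 2 pi, and lam is not 0, so the multiple is at least 1 in absolute
  value.\<close>

lemma phase_equation_bound:
  fixes u :: "real \<Rightarrow> complex"
  assumes R: "\<And>t. (R has_real_derivative \<rho> t) (at t)" "\<And>t. R (t + 1) = R t + r"
    and u: "\<And>t. (u has_vector_derivative \<i> * of_real (lam * \<rho> t) * u t) (at t)" "\<And>t. u (t + 1) = u t"
    and "u t \<noteq> 0" "lam \<noteq> 0" "r > 0"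
  shows "\<bar>lam\<bar> * r \<ge> 2 * pi"
proof -
  define w where "w = (\<lambda>t. cis (- lam * R t) * u t)"
  have "(w has_vector_derivative 0) (at t)" for t
    unfolding w_def
    by (rule has_vector_derivative_eq_rhs[OF has_vector_derivative_mult[OF
          has_vector_derivative_cis[OF DERIV_cmult[OF R(1), of "- lam"]] u(1)]])
      (simp add: algebra_simps)
  then obtain k where "w x = k" for x
    using has_vector_derivative_zero_constant[of UNIV w] by auto
  then have "w (t + 1) = w t" by simp
  then have "cis (- lam * R (t + 1)) = cis (- lam * R t)"
    using assms(5) by (simp add: w_def u(2))
  then have "cis (- lam * R t) * cis (- lam * r) = cis (- lam * R t)"
    by (simp only: R(2) cis_mult distrib_left)
  then have "cis (- lam * r) = 1" by (metis cis_neq_zero mult_cancel_left2)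
  then have "cos (lam * r) = 1" by (metis cis.simps(1) cos_minus minus_mult_left one_complex.simps(1))
  then obtain k :: int where k: "lam * r = of_int k * 2 * pi" by (auto simp: cos_one_2pi_int)
  with assms(6,7) have "k \<noteq> 0" by auto
  then have "1 \<le> real_of_int \<bar>k\<bar>" by linarith
  then have "2 * pi * 1 \<le> 2 * pi * real_of_int \<bar>k\<bar>" by (intro mult_left_mono) auto
  also have "\<dots> = \<bar>lam * r\<bar>" unfolding k by (simp add: abs_mult)
  finally show ?thesis using assms(7) by (simp add: abs_mult)
qed

text \<open>The estimate is implicit, with \<open>\<nu>\<close> on both sides; it becomes explicit
  once \<open>\<nu>\<close> is assumed to lie below a fixed bound. Frequency 0 is separate because
  the monotone quantity degenerates at \<open>\<kappa> = 0\<close>. All other frequencies have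
  \<open>\<bar>\<kappa>\<bar>\<close> at least 2 pi.\<close>

theorem dirac_square_eigenvalue_bound:
  assumes h: "smooth_on UNIV h" "\<And>t. h t > 0" "\<And>t. h (t + 1) = h t"
    and S: "\<And>t. (S has_real_derivative (h t)\<^sup>2 - r) (at t)" "\<And>t. S (t + 1) = S t" "\<And>t. \<bar>S t\<bar> \<le> s"
    and "r > 0"
    and ev: "is_eigenvalue (\<lambda>\<psi>. dirac (conformal_metric h) (dirac (conformal_metric h) \<psi>)) \<nu>" "\<nu> > 0"
  shows "sqrt \<nu> * r \<ge> 2 * pi * (1 - 2 * \<nu> * s\<^sup>2)"
proof -
  from dirac_square_eigenvalueE[OF h ev] obtain \<phi> lam where
    \<phi>: "torus_smooth \<phi>" "\<phi> \<noteq> (\<lambda>x. 0)" "\<And>x. dirac (conformal_metric h) \<phi> x = lam *\<^sub>R \<phi> x"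
    and lam: "lam\<^sup>2 = \<nu>" by blast
  define p where "p = (\<lambda>x. h (x $ 1) *\<^sub>R (\<phi> x $ 1 + \<phi> x $ 2))"
  define m where "m = (\<lambda>x. h (x $ 1) *\<^sub>R (\<phi> x $ 1 - \<phi> x $ 2))"
  have sys: "torus_smooth p" "torus_smooth m"
    "pd 1 p x = - \<i> * of_real (lam * (h (x $ 1))\<^sup>2) * p x + \<i> * pd 2 m x"
    "pd 1 m x = \<i> * of_real (lam * (h (x $ 1))\<^sup>2) * m x + \<i> * pd 2 p x" for x
    unfolding p_def m_def by (rule dirac_eigenspinor_system[OF h \<phi>(1,3)])+
  from \<phi>(2) obtain x where "\<phi> x \<noteq> 0" by auto
  then have "\<phi> x $ 1 \<noteq> 0 \<or> \<phi> x $ 2 \<noteq> 0" by (simp add: vec_eq_iff forall_2)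
  moreover have "\<phi> x $ 1 = 0 \<and> \<phi> x $ 2 = 0" if "\<phi> x $ 1 + \<phi> x $ 2 = 0" "\<phi> x $ 1 - \<phi> x $ 2 = 0"
    using that by (simp add: mult_2[symmetric])
  ultimately have "\<phi> x $ 1 + \<phi> x $ 2 \<noteq> 0 \<or> \<phi> x $ 1 - \<phi> x $ 2 \<noteq> 0" by blast
  then have "p x \<noteq> 0 \<or> m x \<noteq> 0"
    using h(2)[of "x $ 1"] by (auto simp: p_def m_def)
  \<comment> \<open>One frequency with a nonzero coefficient of either \<open>p\<close> or
    \<open>m\<close> is enough: the mode estimates need only one nonvanishing component at one
    point.\<close>
  then obtain k where k: "fourier_y k p (x $ 1) \<noteq> 0 \<or> fourier_y k m (x $ 1) \<noteq> 0"
    by (metis fourier_y_nonzero[OF sys(1)] fourier_y_nonzero[OF sys(2)])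
  define \<kappa> where "\<kappa> = - (2 * pi * k)"
  define u v where "u = fourier_y k p" "v = fourier_y k m"
  note uv = this
  have per: "u (t + 1) = u t" "v (t + 1) = v t" for t
    using fourier_y_periodic sys(1,2) by (auto simp: uv)
  have u': "(u has_vector_derivative - \<i> * of_real (lam * (h t)\<^sup>2) * u t - of_real \<kappa> * v t) (at t)" for t
  proof -
    have "fourier_y k (pd 1 p) t = - \<i> * of_real (lam * (h t)\<^sup>2) * u t + \<i> * fourier_y k (pd 2 m) t"
      unfolding uv ext[of "pd 1 p", OF sys(3)]
      by (rule fourier_y_linear[where a = "\<lambda>t. - \<i> * of_real (lam * (h t)\<^sup>2)", OF sys(1) torus_smooth_pd[OF sys(2)]])
    then have "fourier_y k (pd 1 p) t = - \<i> * of_real (lam * (h t)\<^sup>2) * u t - of_real \<kappa> * v t"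
      by (simp add: fourier_y_pd_2[OF sys(2)] uv \<kappa>_def algebra_simps)
    then show ?thesis
      using has_vector_derivative_fourier_y[OF sys(1), of k t] by (simp only: uv)
  qed
  have v': "(v has_vector_derivative \<i> * of_real (lam * (h t)\<^sup>2) * v t - of_real \<kappa> * u t) (at t)" for t
  proof -
    have "fourier_y k (pd 1 m) t = \<i> * of_real (lam * (h t)\<^sup>2) * v t + \<i> * fourier_y k (pd 2 p) t"
      unfolding uv ext[of "pd 1 m", OF sys(4)]
      by (rule fourier_y_linear[where a = "\<lambda>t. \<i> * of_real (lam * (h t)\<^sup>2)", OF sys(2) torus_smooth_pd[OF sys(1)]])
    then have "fourier_y k (pd 1 m) t = \<i> * of_real (lam * (h t)\<^sup>2) * v t - of_real \<kappa> * u t"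
      by (simp add: fourier_y_pd_2[OF sys(1)] uv \<kappa>_def algebra_simps)
    then show ?thesis
      using has_vector_derivative_fourier_y[OF sys(2), of k t] by (simp only: uv)
  qed
  have abs_lam: "\<bar>lam\<bar> = sqrt \<nu>" and lam0: "lam \<noteq> 0" using lam ev(2) by auto
  show ?thesis
  proof (cases "k = 0")
    case True
    define R where "R = (\<lambda>t. S t + r * t)"
    have R: "(R has_real_derivative (h t)\<^sup>2) (at t)" "R (t + 1) = R t + r" for t
      unfolding R_def using S(1)[of t] by (auto intro!: derivative_eq_intros simp: S(2)) (simp add: algebra_simps)
    have "\<bar>lam\<bar> * r \<ge> 2 * pi"
    proof (cases "u (x $ 1) = 0")
      case False
      \<comment> \<open>For frequency 0 the functions \<open>u\<close> and \<open>v\<close> rotate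
        in opposite directions, so \<open>u\<close> obeys the phase equation for
        \<open>- lam\<close>.\<close>
      have "\<bar>- lam\<bar> * r \<ge> 2 * pi"
        by (rule phase_equation_bound[OF R, where u = u and t = "x $ 1"])
          (use u' per False lam0 \<open>r > 0\<close> in \<open>simp_all add: \<kappa>_def True\<close>)
      then show ?thesis by simp
    next
      case u0: True
      show ?thesis
        by (rule phase_equation_bound[OF R, where u = v and t = "x $ 1"])
          (use v' per u0 k lam0 \<open>r > 0\<close> in \<open>simp_all add: \<kappa>_def True uv\<close>)
    qed
    moreover have "2 * pi * (1 - 2 * \<nu> * s\<^sup>2) \<le> 2 * pi * 1"
      using ev(2) by (intro mult_left_mono) auto
    ultimately show ?thesis unfolding abs_lam by linarith
  next
    case False
    then have \<kappa>: "\<kappa> \<noteq> 0" by (simp add: \<kappa>_def)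
    have k1: "2 * pi * 1 \<le> \<bar>\<kappa>\<bar>"
    proof -
      have "1 \<le> real_of_int \<bar>k\<bar>" using False by linarith
      then have "2 * pi * 1 \<le> 2 * pi * real_of_int \<bar>k\<bar>" by (intro mult_left_mono) auto
      then show ?thesis by (simp add: \<kappa>_def abs_mult)
    qed
    have "\<bar>\<kappa>\<bar> * (1 - 2 * lam\<^sup>2 * s\<^sup>2) \<le> \<bar>lam\<bar> * r"
      by (rule dirac_mode_bound[OF S u' per(1) v' per(2) _ \<kappa> \<open>r > 0\<close>]) (use k uv in auto)
    then have le: "\<bar>\<kappa>\<bar> * (1 - 2 * \<nu> * s\<^sup>2) \<le> sqrt \<nu> * r" by (simp add: lam abs_lam)
    show ?thesis
    proof (cases "1 - 2 * \<nu> * s\<^sup>2 \<ge> 0")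
      case True
      then have "2 * pi * (1 - 2 * \<nu> * s\<^sup>2) \<le> \<bar>\<kappa>\<bar> * (1 - 2 * \<nu> * s\<^sup>2)"
        using k1 by (intro mult_right_mono) auto
      with le show ?thesis by linarith
    next
      case False
      \<comment> \<open>For a negative factor, passing from \<open>\<bar>\<kappa>\<bar>\<close> to 2
        pi would reverse the inequality, but then the claim is trivial.\<close>
      then have "2 * pi * (1 - 2 * \<nu> * s\<^sup>2) \<le> 0" by (intro mult_nonneg_nonpos) auto
      also have "0 \<le> sqrt \<nu> * r" using ev(2) \<open>r > 0\<close> by simp
      finally show ?thesis .
    qed
  qed
qed

text \<open>Guarantees that the set of positive eigenvalues is nonempty; without this a lower bound
  for its elements says nothing about the value of \<open>Inf\<close>.\<close>

lemma dirac_square_has_positive_eigenvalue: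
  assumes h: "smooth_on UNIV h" "\<And>t. h t > 0" "\<And>t. h (t + 1) = h t"
    and R: "\<And>t. (R has_real_derivative (h t)\<^sup>2) (at t)" "\<And>t. R (t + 1) = R t + r" and "r > 0"
  shows "is_eigenvalue (\<lambda>\<psi>. dirac (conformal_metric h) (dirac (conformal_metric h) \<psi>)) ((2 * pi / r)\<^sup>2)"
proof -
  define lam where "lam = 2 * pi / r"
  obtain h' where h': "\<And>t. (h has_vector_derivative h' t) (at t)" "smooth_on UNIV h'"
    using smooth_on_vector_derivative[OF h(1)] by blast
  have h0: "h t \<noteq> 0" for t using h(2)[of t] by simp
  \<comment> \<open>For a spinor with equal components the combination m vanishes and p = 2 h f must
    solve p' = -i lam h^2 p. This dictates the phase, and lam = 2 pi / r closes it up after one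
    period.\<close>
  define f where "f = (\<lambda>t. of_real (1 / h t) * cis (- lam * R t))"
  define c where "c = (\<lambda>t. of_real (- h' t * (1 / h t)) + - \<i> * of_real (lam * (h t)\<^sup>2))"
  have hr: "(h has_real_derivative h' t) (at t)" for t
    using h'(1) by (simp add: has_real_derivative_iff_has_vector_derivative)
  have inv: "((\<lambda>t. 1 / h t) has_real_derivative - h' t * (1 / h t) * (1 / h t)) (at t)" for t
    using hr[of t] h0[of t] by (auto intro!: derivative_eq_intros simp: field_simps)
  have f': "(f has_vector_derivative c t * f t) (at t)" for t
    unfolding f_def
    by (rule has_vector_derivative_eq_rhs[OF has_vector_derivative_mult[OF
          has_vector_derivative_of_real[OF inv]
          has_vector_derivative_cis[OF DERIV_cmult[OF R(1), of "- lam"]]]])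
      (simp add: c_def algebra_simps)
  have "smooth_on UNIV (\<lambda>t. - h' t * (1 / h t))"
    by (rule smooth_on_mult[OF smooth_on_bounded_linear[OF bounded_linear_minus[OF bounded_linear_ident] h'(2)]
          smooth_on_inverse[OF h(1) h0]])
  then have "smooth_on UNIV (\<lambda>t. complex_of_real (- h' t * (1 / h t)))"
    by (rule smooth_on_bounded_linear[OF bounded_linear_of_real])
  moreover have "smooth_on UNIV (\<lambda>t. - \<i> * complex_of_real (lam * (h t)\<^sup>2))"
    by (rule smooth_on_bounded_linear[OF bounded_linear_mult_right
          smooth_on_bounded_linear[OF bounded_linear_of_real smooth_on_mult[OF smooth_on_const smooth_on_power[OF h(1)]]]])
  ultimately have "smooth_on UNIV c" unfolding c_def by (rule smooth_on_add)
  then have sf: "smooth_on UNIV f" by (rule smooth_on_linear_ode[OF f'])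
  have pf: "f (t + 1) = f t" for t
  proof -
    have "- lam * R (t + 1) = - lam * R t + - (2 * pi)"
      using \<open>r > 0\<close> by (simp only: R(2)) (simp add: lam_def field_simps)
    then have "cis (- lam * R (t + 1)) = cis (- lam * R t) * cis (- (2 * pi))"
      by (simp only: cis_mult)
    moreover have "cis (- (2 * pi)) = 1" by (simp add: complex_eq_iff)
    ultimately show ?thesis by (simp add: f_def h(3))
  qed
  let ?L = "\<lambda>z::complex. (\<chi> i. z) :: complex^2"
  have L: "bounded_linear ?L"
  proof -
    have "linear ?L" by (intro linearI) (simp_all add: vec_eq_iff)
    then show ?thesis by (simp add: linear_conv_bounded_linear)
  qed
  define \<psi> where "\<psi> = (\<lambda>x::real^2. ?L (f (x $ 1)))"
  have ts: "torus_smooth \<psi>"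
    unfolding \<psi>_def
    by (rule torus_smooth_bounded_linear[OF L torus_smooth_fst_coord[OF sf pf]])
  have pd\<psi>: "pd i \<psi> x = ?L (if i = 1 then c (x $ 1) * f (x $ 1) else 0)" for i x
    unfolding \<psi>_def
    using pd_bounded_linear[OF L torus_smooth_differentiable[OF torus_smooth_fst_coord[OF sf pf]]]
      pd_fst_coord[OF f'] by simp
  let ?D = "dirac (conformal_metric h)"
  have D: "?D \<psi> x = lam *\<^sub>R \<psi> x" for x
  proof -
    define H where "H = complex_of_real (h (x $ 1))"
    have H: "H \<noteq> 0" using h0 by (simp add: H_def)
    show ?thesis
      unfolding dirac_conformal_metric[OF h(2) hr torus_smooth_differentiable[OF ts]] pd\<psi>
      using H by (simp add: vec_eq_iff forall_2 \<psi>_def c_def scaleR_conv_of_real[where 'a = complex] field_simps power2_eq_square flip: H_def)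
  qed
  have "?D (?D \<psi>) x = (lam\<^sup>2) *\<^sub>R \<psi> x" for x
  proof -
    \<comment> \<open>A scalar multiple in the shape covered by
      \<open>dirac_add_scaleR\<close>.\<close>
    have "?D \<psi> = (\<lambda>z. \<psi> z + (lam - 1) *\<^sub>R \<psi> z)"
      by (rule ext) (simp add: D algebra_simps)
    then have "?D (?D \<psi>) x = ?D \<psi> x + (lam - 1) *\<^sub>R ?D \<psi> x"
      using dirac_add_scaleR[OF h(1,2) torus_smooth_differentiable[OF ts] torus_smooth_differentiable[OF ts]]
      by metis
    then show ?thesis by (simp add: D algebra_simps power2_eq_square)
  qed
  moreover have "\<psi> \<noteq> (\<lambda>x. 0)"
  proof
    assume "\<psi> = (\<lambda>x. 0)"
    then have "\<psi> 0 $ 1 = 0" by simp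
    with h0[of 0] show False by (simp add: \<psi>_def f_def)
  qed
  ultimately show ?thesis using ts unfolding is_eigenvalue_def lam_def by blast
qed

section \<open>The equation \<open>y'' = - \<mu> W y\<close>\<close>

text \<open>An integral over \<open>{0..t}\<close> would vanish for negative \<open>t\<close>. The
  solutions are needed on the whole line because they are compared with their translates.\<close>

definition primitive :: "(real \<Rightarrow> real) \<Rightarrow> real \<Rightarrow> real" where
  "primitive f = (SOME F. F 0 = 0 \<and> (\<forall>t. (F has_real_derivative f t) (at t)))"

lemma primitive:
  assumes "continuous_on UNIV f"
  shows "primitive f 0 = 0" "(primitive f has_real_derivative f t) (at t)"
proof -
  have "isCont f x" for x using assms by (simp add: continuous_on_eq_continuous_at)
  then obtain F where F: "\<And>t. (F has_vector_derivative f t) (at t)"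
    using einterval_antiderivative[of "-\<infinity>" "\<infinity>" f] by auto
  have "\<exists>F. F 0 = 0 \<and> (\<forall>t. (F has_real_derivative f t) (at t))"
  proof (intro exI conjI allI)
    show "((\<lambda>t. F t - F 0) has_real_derivative f t) (at t)" for t
      using F[of t] by (auto simp: has_real_derivative_iff_has_vector_derivative[symmetric] intro!: derivative_eq_intros)
  qed simp
  from someI_ex[OF this]
  show "primitive f 0 = 0" "(primitive f has_real_derivative f t) (at t)"
    unfolding primitive_def by blast+
qed

lemma DERIV_continuous_on_UNIV:
  fixes f :: "real \<Rightarrow> real"
  assumes "\<And>t. (f has_real_derivative f' t) (at t)"
  shows "continuous_on UNIV f"
  using DERIV_isCont[OF assms] by (simp add: continuous_at_imp_continuous_on)

text \<open>In the norm weighted by e^(-L|t|) each integration gains a factor 1 / L. This makes the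
  iterated integrals as small as desired at the cost of a larger weight.\<close>

lemma derivative_exp_bound:
  fixes F :: "real \<Rightarrow> real"
  assumes F: "F 0 = 0" "\<And>t. (F has_real_derivative f t) (at t)"
    and f: "\<And>t. \<bar>f t\<bar> \<le> K * exp (L * \<bar>t\<bar>)" and "L > 0"
  shows "\<bar>F t\<bar> \<le> K / L * exp (L * \<bar>t\<bar>)"
proof -
  have K: "K \<ge> 0" using f[of 0] by simp
  have half: "G t \<le> K / L * exp (L * t)"
    if G: "G 0 = 0" "\<And>t. (G has_real_derivative g t) (at t)" "\<And>t. \<bar>g t\<bar> \<le> K * exp (L * \<bar>t\<bar>)" and "t \<ge> 0"
    for G g :: "real \<Rightarrow> real" and t :: real
  proof -
    have "K / L * exp (L * 0) - G 0 \<le> K / L * exp (L * t) - G t"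
    proof (rule DERIV_nonneg_imp_nondecreasing[OF \<open>t \<ge> 0\<close>])
      fix x :: real assume "0 \<le> x"
      have "((\<lambda>t. K / L * exp (L * t) - G t) has_real_derivative K * exp (L * x) - g x) (at x)"
        using \<open>L > 0\<close> by (auto intro!: derivative_eq_intros G(2))
      moreover have "0 \<le> K * exp (L * x) - g x" using G(3)[of x] \<open>0 \<le> x\<close> by simp
      ultimately show "\<exists>y. ((\<lambda>t. K / L * exp (L * t) - G t) has_real_derivative y) (at x) \<and> 0 \<le> y" by blast
    qed
    moreover have "0 \<le> K / L" using K \<open>L > 0\<close> by simp
    ultimately show ?thesis using G(1) by simp
  qed
  \<comment> \<open>The one-sided estimate is applied to F, to -F and to the reflections of
    both.\<close>
  have m: "((\<lambda>t. - F t) has_real_derivative - f t) (at t)" for t by (intro DERIV_minus F(2))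
  have r: "((\<lambda>t. F (- t)) has_real_derivative - f (- t)) (at t)" for t
    using DERIV_mirror F(2)[of "- t"] by blast
  have rm: "((\<lambda>t. - F (- t)) has_real_derivative f (- t)) (at t)" for t
    using DERIV_minus[OF r[of t]] by simp
  show ?thesis
  proof (cases "t \<ge> 0")
    case True
    then show ?thesis
      using half[OF F f True] half[OF _ m _ True] F(1) f by (auto simp: abs_le_iff)
  next
    case False
    then have "- t \<ge> 0" by simp
    have 1: "F (- (- t)) \<le> K / L * exp (L * (- t))"
      by (rule half[OF _ r _ \<open>- t \<ge> 0\<close>]) (use F(1) f[of "- s" for s] in auto)
    have 2: "- F (- (- t)) \<le> K / L * exp (L * (- t))"
      by (rule half[OF _ rm _ \<open>- t \<ge> 0\<close>]) (use F(1) f[of "- s" for s] in auto)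
    show ?thesis using 1 2 False by (simp add: abs_le_iff)
  qed
qed

text \<open>The pair \<open>(a\<^sub>n, a\<^sub>n')\<close> of the coefficients of the solution \<open>y = \<Sum>\<^sub>n (-\<mu>)\<^sup>n a\<^sub>n\<close>
  with \<open>y(0) = \<alpha>\<close> and \<open>y'(0) = \<beta>\<close>.\<close>

primrec hill_coeff ::
  "(real \<Rightarrow> real) \<Rightarrow> real \<Rightarrow> real \<Rightarrow> nat \<Rightarrow> (real \<Rightarrow> real) \<times> (real \<Rightarrow> real)" where
  "hill_coeff W \<alpha> \<beta> 0 = ((\<lambda>t. \<alpha> + \<beta> * t), (\<lambda>t. \<beta>))"
| "hill_coeff W \<alpha> \<beta> (Suc n) =
    (let b = primitive (\<lambda>t. W t * fst (hill_coeff W \<alpha> \<beta> n) t) in (primitive b, b))"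

lemma hill_coeff_derivatives:
  assumes "continuous_on UNIV W"
  shows "(fst (hill_coeff W \<alpha> \<beta> n) has_real_derivative snd (hill_coeff W \<alpha> \<beta> n) t) (at t)"
    and "(snd (hill_coeff W \<alpha> \<beta> (Suc n)) has_real_derivative W t * fst (hill_coeff W \<alpha> \<beta> n) t) (at t)"
proof -
  have D: "\<forall>t. (fst (hill_coeff W \<alpha> \<beta> n) has_real_derivative snd (hill_coeff W \<alpha> \<beta> n) t) (at t)" for n
  proof (induction n)
    case 0
    show ?case by (auto intro!: derivative_eq_intros)
  next
    case (Suc n)
    have "continuous_on UNIV (\<lambda>t. W t * fst (hill_coeff W \<alpha> \<beta> n) t)"
      using Suc by (intro continuous_on_mult assms DERIV_continuous_on_UNIV) auto
    note P = primitive(2)[OF this]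
    show ?case using primitive(2)[OF DERIV_continuous_on_UNIV[OF P]] by (simp add: Let_def)
  qed
  then show "(fst (hill_coeff W \<alpha> \<beta> n) has_real_derivative snd (hill_coeff W \<alpha> \<beta> n) t) (at t)" by blast
  have "continuous_on UNIV (\<lambda>t. W t * fst (hill_coeff W \<alpha> \<beta> n) t)"
    using D by (intro continuous_on_mult assms DERIV_continuous_on_UNIV) auto
  from primitive(2)[OF this]
  show "(snd (hill_coeff W \<alpha> \<beta> (Suc n)) has_real_derivative W t * fst (hill_coeff W \<alpha> \<beta> n) t) (at t)"
    by (simp add: Let_def)
qed

lemma hill_coeff_Suc_at_0:
  assumes "continuous_on UNIV W"
  shows "fst (hill_coeff W \<alpha> \<beta> (Suc n)) 0 = 0" "snd (hill_coeff W \<alpha> \<beta> (Suc n)) 0 = 0"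
proof -
  have "continuous_on UNIV (\<lambda>t. W t * fst (hill_coeff W \<alpha> \<beta> n) t)"
    using hill_coeff_derivatives(1)[OF assms] by (intro continuous_on_mult assms DERIV_continuous_on_UNIV)
  note P = primitive[OF this]
  show "snd (hill_coeff W \<alpha> \<beta> (Suc n)) 0 = 0" using P(1) by (simp add: Let_def)
  show "fst (hill_coeff W \<alpha> \<beta> (Suc n)) 0 = 0"
    using primitive(1)[OF DERIV_continuous_on_UNIV[OF P(2)]] by (simp add: Let_def)
qed

text \<open>One step from \<open>n\<close> to \<open>n + 1\<close> integrates twice: the first
  integration costs M / L \<le> e, the second at most 1. The ratio \<open>e\<close> is free, so the
  series in \<open>\<mu>\<close> converges for all \<open>\<mu>\<close>.\<close>

lemma hill_coeff_bound:
  assumes W: "continuous_on UNIV W" "\<And>t. \<bar>W t\<bar> \<le> M" and e: "0 < e" "e \<le> 1" and L: "L \<ge> 1 / e" "L \<ge> M / e"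
  shows "\<bar>fst (hill_coeff W \<alpha> \<beta> n) t\<bar> \<le> (\<bar>\<alpha>\<bar> + \<bar>\<beta>\<bar>) * e ^ n * exp (L * \<bar>t\<bar>)
    \<and> \<bar>snd (hill_coeff W \<alpha> \<beta> n) t\<bar> \<le> (\<bar>\<alpha>\<bar> + \<bar>\<beta>\<bar>) * e ^ n * exp (L * \<bar>t\<bar>)"
proof (induction n arbitrary: t)
  case 0
  have "1 \<le> 1 / e" using e by simp
  then have L1: "1 \<le> L" using L by linarith
  then have "1 + 1 * \<bar>t\<bar> \<le> 1 + L * \<bar>t\<bar>" by (intro add_left_mono mult_right_mono) auto
  also have "\<dots> \<le> exp (L * \<bar>t\<bar>)" by (rule exp_ge_add_one_self)
  finally have x: "1 \<le> exp (L * \<bar>t\<bar>)" "\<bar>t\<bar> \<le> exp (L * \<bar>t\<bar>)" using abs_ge_zero[of t] by linarith+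
  have "\<bar>\<alpha> + \<beta> * t\<bar> \<le> \<bar>\<alpha>\<bar> * 1 + \<bar>\<beta>\<bar> * \<bar>t\<bar>" by (simp add: abs_mult[symmetric] abs_triangle_ineq)
  also have "\<dots> \<le> \<bar>\<alpha>\<bar> * exp (L * \<bar>t\<bar>) + \<bar>\<beta>\<bar> * exp (L * \<bar>t\<bar>)" by (intro add_mono mult_left_mono x) auto
  finally have 1: "\<bar>\<alpha> + \<beta> * t\<bar> \<le> (\<bar>\<alpha>\<bar> + \<bar>\<beta>\<bar>) * exp (L * \<bar>t\<bar>)" by (simp add: algebra_simps)
  have "\<bar>\<beta>\<bar> * 1 \<le> (\<bar>\<alpha>\<bar> + \<bar>\<beta>\<bar>) * exp (L * \<bar>t\<bar>)" by (intro mult_mono x) auto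
  with 1 show ?case by simp
next
  case (Suc n)
  let ?c = "\<bar>\<alpha>\<bar> + \<bar>\<beta>\<bar>"
  have M: "M \<ge> 0" using W(2)[of 0] by linarith
  have Lpos: "L > 0" using L(1) e by (smt (verit) zero_less_divide_1_iff)
  have d: "1 / L \<le> e" "M / L \<le> e" using L e Lpos by (simp_all add: field_simps)
  have n0: "0 \<le> ?c * e ^ n" using e by simp
  have "\<bar>W t * fst (hill_coeff W \<alpha> \<beta> n) t\<bar> \<le> (M * (?c * e ^ n)) * exp (L * \<bar>t\<bar>)" for t
  proof -
    have "\<bar>W t * fst (hill_coeff W \<alpha> \<beta> n) t\<bar> \<le> M * (?c * e ^ n * exp (L * \<bar>t\<bar>))"
      unfolding abs_mult using W(2) Suc.IH M by (intro mult_mono) auto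
    then show ?thesis by (simp add: mult.assoc)
  qed
  from derivative_exp_bound[OF hill_coeff_Suc_at_0(2)[OF W(1)] hill_coeff_derivatives(2)[OF W(1)] this Lpos]
  have b: "\<bar>snd (hill_coeff W \<alpha> \<beta> (Suc n)) t\<bar> \<le> (M / L) * (?c * e ^ n) * exp (L * \<bar>t\<bar>)" for t by simp
  have b': "\<bar>snd (hill_coeff W \<alpha> \<beta> (Suc n)) t\<bar> \<le> (?c * e ^ Suc n) * exp (L * \<bar>t\<bar>)" for t
  proof -
    have "(M / L) * (?c * e ^ n) * exp (L * \<bar>t\<bar>) \<le> e * (?c * e ^ n) * exp (L * \<bar>t\<bar>)"
      using d(2) n0 by (intro mult_right_mono) auto
    with b[of t] show ?thesis by (simp add: mult_ac)
  qed
  have "\<bar>fst (hill_coeff W \<alpha> \<beta> (Suc n)) t\<bar> \<le> (?c * e ^ Suc n) / L * exp (L * \<bar>t\<bar>)" for t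
    by (rule derivative_exp_bound[OF hill_coeff_Suc_at_0(1)[OF W(1)] hill_coeff_derivatives(1)[OF W(1)] b' Lpos])
  moreover have "(?c * e ^ Suc n) / L \<le> (?c * e ^ Suc n) * 1"
  proof -
    have "1 / L \<le> 1" using d(1) e by linarith
    moreover have "0 \<le> ?c * e ^ Suc n" using e by simp
    ultimately show ?thesis using mult_left_mono[of "1 / L" 1 "?c * e ^ Suc n"] by simp
  qed
  then have "(?c * e ^ Suc n) / L * exp (L * \<bar>t\<bar>) \<le> ?c * e ^ Suc n * exp (L * \<bar>t\<bar>)" by (intro mult_right_mono) auto
  ultimately show ?case using b' by (meson order_trans)
qed

text \<open>A solution built as an entire power series in \<open>\<mu>\<close> is continuous in
  \<open>\<mu>\<close> at fixed \<open>t\<close>. This continuity is what the intermediate value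
  argument for the monodromy matrix uses.\<close>

lemma hill_solution:
  fixes W :: "real \<Rightarrow> real"
  assumes W: "continuous_on UNIV W" "\<And>t. \<bar>W t\<bar> \<le> M"
  obtains y z :: "real \<Rightarrow> real \<Rightarrow> real" where
    "\<And>\<mu> t. (y \<mu> has_real_derivative z \<mu> t) (at t)"
    "\<And>\<mu> t. (z \<mu> has_real_derivative - \<mu> * W t * y \<mu> t) (at t)"
    "\<And>\<mu>. y \<mu> 0 = \<alpha>" "\<And>\<mu>. z \<mu> 0 = \<beta>"
    "\<And>t. continuous_on UNIV (\<lambda>\<mu>. y \<mu> t)" "\<And>t. continuous_on UNIV (\<lambda>\<mu>. z \<mu> t)"
proof -
  define a where "a = (\<lambda>n. fst (hill_coeff W \<alpha> \<beta> n))"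
  define b where "b = (\<lambda>n. snd (hill_coeff W \<alpha> \<beta> n))"
  \<comment> \<open>The derivative of \<open>b n\<close>: the value 0 at index 0 reflects that
    \<open>b 0\<close> is constant, and the shift by one index produces the factor
    \<open>- \<mu>\<close> in the equation for \<open>z\<close>.\<close>
  define d where "d = (\<lambda>n t. case n of 0 \<Rightarrow> 0 | Suc k \<Rightarrow> W t * a k t)"
  have a': "(a n has_real_derivative b n t) (at t)" for n t
    unfolding a_def b_def by (rule hill_coeff_derivatives(1)[OF W(1)])
  have b': "(b n has_real_derivative d n t) (at t)" for n t
    using hill_coeff_derivatives(2)[OF W(1)]
    by (cases n) (auto simp: a_def b_def d_def)
  have M: "M \<ge> 0" using W(2)[of 0] by linarith
  have bound: "\<exists>C. \<forall>n. \<forall>t\<in>{-T..T}. norm (a n t * x ^ n) \<le> C * (1/2) ^ n \<and> norm (b n t * x ^ n) \<le> C * (1/2) ^ n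
      \<and> norm (d n t * x ^ n) \<le> C * (1/2) ^ n" for T x :: real
  proof -
    \<comment> \<open>Chosen so that \<open>e\<close> times \<open>\<bar>x\<bar>\<close> is at most
      1/2, which gives geometric series of ratio 1/2 for every \<open>x\<close>.\<close>
    define e where "e = 1 / (2 * (\<bar>x\<bar> + 1))"
    define L where "L = 1 / e + M / e"
    have e: "0 < e" "e \<le> 1" "\<bar>x\<bar> * e \<le> 1 / 2" by (auto simp: e_def field_simps)
    then have L: "L \<ge> 1 / e" "L \<ge> M / e" "L \<ge> 0" using M by (auto simp: L_def)
    define c where "c = (\<bar>\<alpha>\<bar> + \<bar>\<beta>\<bar>) * exp (L * T)"
    define C where "C = c + 2 * \<bar>x\<bar> * M * c"
    have c0: "c \<ge> 0" by (simp add: c_def)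
    have pw: "e ^ n * \<bar>x\<bar> ^ n \<le> (1/2) ^ n" for n
      using power_mono[OF e(3), of n] e by (simp add: power_mult_distrib mult.commute)
    have ab: "norm (a n t * x ^ n) \<le> c * (1/2) ^ n" "norm (b n t * x ^ n) \<le> c * (1/2) ^ n"
      if t: "t \<in> {-T..T}" for n t
    proof -
      have "exp (L * \<bar>t\<bar>) \<le> exp (L * T)" using t L by (auto intro!: mult_left_mono)
      then have E: "(\<bar>\<alpha>\<bar> + \<bar>\<beta>\<bar>) * e ^ n * exp (L * \<bar>t\<bar>) \<le> c * e ^ n"
        unfolding c_def using e mult_left_mono[of "exp (L * \<bar>t\<bar>)" "exp (L * T)" "(\<bar>\<alpha>\<bar> + \<bar>\<beta>\<bar>) * e ^ n"]
        by (simp add: mult_ac)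
      have P: "c * e ^ n * \<bar>x\<bar> ^ n \<le> c * (1/2) ^ n"
        using mult_left_mono[OF pw[of n] c0] by (simp add: mult.assoc)
      note B = hill_coeff_bound[OF W e(1,2) L(1,2), of \<alpha> \<beta> n t, folded a_def b_def]
      have "norm (f * x ^ n) \<le> c * (1/2) ^ n" if "\<bar>f\<bar> \<le> (\<bar>\<alpha>\<bar> + \<bar>\<beta>\<bar>) * e ^ n * exp (L * \<bar>t\<bar>)" for f
      proof -
        have "norm (f * x ^ n) = \<bar>f\<bar> * \<bar>x\<bar> ^ n" by (simp add: abs_mult power_abs)
        also have "\<dots> \<le> c * e ^ n * \<bar>x\<bar> ^ n" using that E by (intro mult_right_mono) auto
        finally show ?thesis using P by linarith
      qed
      then show "norm (a n t * x ^ n) \<le> c * (1/2) ^ n" "norm (b n t * x ^ n) \<le> c * (1/2) ^ n"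
        using B by (auto simp: a_def b_def)
    qed
    have dd: "norm (d n t * x ^ n) \<le> (2 * \<bar>x\<bar> * M * c) * (1/2) ^ n" if t: "t \<in> {-T..T}" for n t
    proof (cases n)
      case 0
      then show ?thesis using M c0 by (simp add: d_def)
    next
      case (Suc k)
      have "norm (d n t * x ^ n) = \<bar>W t\<bar> * \<bar>x\<bar> * norm (a k t * x ^ k)"
        by (simp add: Suc d_def abs_mult)
      also have "\<dots> \<le> M * \<bar>x\<bar> * (c * (1/2) ^ k)"
        using M by (intro mult_mono ab t W mult_nonneg_nonneg) auto
      also have "\<dots> = (2 * \<bar>x\<bar> * M * c) * (1/2) ^ n" by (simp add: Suc)
      finally show ?thesis .
    qed
    have le: "c * (1/2) ^ n \<le> C * (1/2) ^ n" "(2 * \<bar>x\<bar> * M * c) * (1/2) ^ n \<le> C * (1/2) ^ n" for n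
      unfolding C_def using c0 M by (intro mult_right_mono; simp)+
    show ?thesis
      using ab dd le by (intro exI[of _ C]) (meson order_trans)
  qed
  have geo: "summable (\<lambda>n. C * (1/2 :: real) ^ n)" for C
    by (intro summable_mult summable_geometric) simp
  have sm: "summable (\<lambda>n. a n t * x ^ n)" "summable (\<lambda>n. b n t * x ^ n)" for t x
  proof -
    have "t \<in> {- \<bar>t\<bar>..\<bar>t\<bar>}" by auto
    then obtain C where C: "\<And>n. norm (a n t * x ^ n) \<le> C * (1/2) ^ n" "\<And>n. norm (b n t * x ^ n) \<le> C * (1/2) ^ n"
      using bound[of "\<bar>t\<bar>" x] by blast
    show "summable (\<lambda>n. a n t * x ^ n)" "summable (\<lambda>n. b n t * x ^ n)"
      by (rule summable_comparison_test'[OF geo, where N = 0], rule C)+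
  qed
  have diff: "((\<lambda>t. \<Sum>n. f n t * x ^ n) has_real_derivative (\<Sum>n. f' n t * x ^ n)) (at t)"
    if f: "\<And>n t. (f n has_real_derivative f' n t) (at t)" and s: "summable (\<lambda>n. f n t * x ^ n)"
      and bd: "\<And>T. \<exists>C. \<forall>n. \<forall>t\<in>{-T..T}. norm (f' n t * x ^ n) \<le> C * (1/2) ^ n" for f f' :: "nat \<Rightarrow> real \<Rightarrow> real" and x t
  proof -
    obtain C where C: "\<And>n s. s \<in> {-(\<bar>t\<bar> + 1)..\<bar>t\<bar> + 1} \<Longrightarrow> norm (f' n s * x ^ n) \<le> C * (1/2) ^ n"
      using bd[of "\<bar>t\<bar> + 1"] by blast
    show ?thesis
    proof (rule has_field_derivative_series'(2))
      show "uniformly_convergent_on {-(\<bar>t\<bar> + 1)..\<bar>t\<bar> + 1} (\<lambda>n s. \<Sum>i<n. f' i s * x ^ i)"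
        by (rule Weierstrass_m_test'[OF C geo])
      show "((\<lambda>s. f n s * x ^ n) has_real_derivative f' n s * x ^ n) (at s within {-(\<bar>t\<bar> + 1)..\<bar>t\<bar> + 1})" for n s
        by (intro DERIV_cmult_right has_field_derivative_at_within[OF f])
      show "summable (\<lambda>n. f n t * x ^ n)" by (rule s)
    qed auto
  qed
  define y where "y = (\<lambda>\<mu> t. \<Sum>n. a n t * (- \<mu>) ^ n)"
  define z where "z = (\<lambda>\<mu> t. \<Sum>n. b n t * (- \<mu>) ^ n)"
  show thesis
  proof (rule that[of y z])
    show "(y \<mu> has_real_derivative z \<mu> t) (at t)" for \<mu> t
      unfolding y_def z_def by (rule diff[OF a' sm(1)]) (use bound in meson)
    show "(z \<mu> has_real_derivative - \<mu> * W t * y \<mu> t) (at t)" for \<mu> t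
    proof -
      have "(z \<mu> has_real_derivative (\<Sum>n. d n t * (- \<mu>) ^ n)) (at t)"
        unfolding z_def by (rule diff[OF b' sm(2)]) (use bound in meson)
      moreover have "(\<lambda>n. d n t * (- \<mu>) ^ n) sums (- \<mu> * W t * y \<mu> t)"
      proof -
        have "(\<lambda>n. (- \<mu> * W t) * (a n t * (- \<mu>) ^ n)) sums (- \<mu> * W t * y \<mu> t)"
          unfolding y_def by (intro sums_mult summable_sums sm)
        then have "(\<lambda>n. d (Suc n) t * (- \<mu>) ^ Suc n) sums (- \<mu> * W t * y \<mu> t)"
          by (simp add: d_def mult_ac)
        from sums_Suc[OF this] show ?thesis by (simp add: d_def)
      qed
      ultimately show ?thesis by (simp add: sums_iff)
    qed
    have s0: "(\<lambda>n. f n * x ^ n) sums f 0" if "\<And>n. f (Suc n) = 0" for f :: "nat \<Rightarrow> real" and x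
      using sums_Suc[of "\<lambda>n. f n * x ^ n" 0] that by simp
    show "y \<mu> 0 = \<alpha>" for \<mu>
      using s0[of "\<lambda>n. a n 0" "- \<mu>"] hill_coeff_Suc_at_0(1)[OF W(1), of \<alpha> \<beta>]
      by (simp add: y_def sums_iff a_def del: hill_coeff.simps(2))
    show "z \<mu> 0 = \<beta>" for \<mu>
      using s0[of "\<lambda>n. b n 0" "- \<mu>"] hill_coeff_Suc_at_0(2)[OF W(1), of \<alpha> \<beta>]
      by (simp add: z_def sums_iff b_def del: hill_coeff.simps(2))
    have cont: "continuous_on UNIV (\<lambda>\<mu>. \<Sum>n. c n * (- \<mu>) ^ n)" if "\<And>x. summable (\<lambda>n. c n * x ^ n)" for c :: "nat \<Rightarrow> real"
    proof -
      have "continuous_on UNIV (\<lambda>x. \<Sum>n. c n * x ^ n)"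
        using isCont_powser_converges_everywhere[OF that] by (simp add: continuous_at_imp_continuous_on)
      from continuous_on_compose2[OF this continuous_on_minus[OF continuous_on_id]] show ?thesis by simp
    qed
    show "continuous_on UNIV (\<lambda>\<mu>. y \<mu> t)" "continuous_on UNIV (\<lambda>\<mu>. z \<mu> t)" for t
      unfolding y_def z_def by (intro cont sm)+
  qed
qed

text \<open>A Gronwall argument: the derivative of f^2 + g^2 is at most 1 + M times f^2 + g^2 in
  absolute value. Two exponential factors treat the two directions of time.\<close>

lemma hill_unique:
  fixes f g :: "real \<Rightarrow> real"
  assumes f: "\<And>t. (f has_real_derivative g t) (at t)" and g: "\<And>t. (g has_real_derivative - q t * f t) (at t)"
    and q: "\<And>t. \<bar>q t\<bar> \<le> M" and zero: "f 0 = 0" "g 0 = 0"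
  shows "f t = 0"
proof -
  define C where "C = 1 + M"
  define e where "e = (\<lambda>t. (f t)\<^sup>2 + (g t)\<^sup>2)"
  define e' where "e' = (\<lambda>t. 2 * f t * g t * (1 - q t))"
  have e: "(e has_real_derivative e' t) (at t)" for t
    unfolding e_def e'_def using f[of t] g[of t]
    by (auto intro!: derivative_eq_intros simp: algebra_simps)
  have b: "\<bar>e' t\<bar> \<le> C * e t" for t
  proof -
    have "\<bar>e' t\<bar> = \<bar>1 - q t\<bar> * (2 * \<bar>f t\<bar> * \<bar>g t\<bar>)" by (simp add: e'_def abs_mult)
    also have "\<dots> \<le> C * ((\<bar>f t\<bar>)\<^sup>2 + (\<bar>g t\<bar>)\<^sup>2)"
      using q[of t] sum_squares_bound[of "\<bar>f t\<bar>" "\<bar>g t\<bar>"] by (intro mult_mono) (auto simp: C_def)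
    finally show ?thesis by (simp add: e_def)
  qed
  have "e t \<le> 0"
  proof (cases "t \<ge> 0")
    case True
    have "e t * exp (- C * t) \<le> e 0 * exp (- C * 0)"
    proof (rule DERIV_nonpos_imp_nonincreasing[OF True])
      fix x
      have "((\<lambda>t. e t * exp (- C * t)) has_real_derivative (e' x - C * e x) * exp (- C * x)) (at x)"
        by (auto intro!: derivative_eq_intros e simp: algebra_simps)
      moreover have "(e' x - C * e x) * exp (- C * x) \<le> 0"
        using b[of x] by (intro mult_nonpos_nonneg) auto
      ultimately show "\<exists>y. ((\<lambda>t. e t * exp (- C * t)) has_real_derivative y) (at x) \<and> y \<le> 0" by blast
    qed
    then show ?thesis by (simp add: zero e_def mult_le_0_iff)
  next
    case False
    then have "t \<le> 0" by simp
    have "e t * exp (C * t) \<le> e 0 * exp (C * 0)"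
    proof (rule DERIV_nonneg_imp_nondecreasing[OF \<open>t \<le> 0\<close>])
      fix x
      have "((\<lambda>t. e t * exp (C * t)) has_real_derivative (e' x + C * e x) * exp (C * x)) (at x)"
        by (auto intro!: derivative_eq_intros e simp: algebra_simps)
      moreover have "0 \<le> (e' x + C * e x) * exp (C * x)"
        using b[of x] by (intro mult_nonneg_nonneg) auto
      ultimately show "\<exists>y. ((\<lambda>t. e t * exp (C * t)) has_real_derivative y) (at x) \<and> 0 \<le> y" by blast
    qed
    then show ?thesis by (simp add: zero e_def mult_le_0_iff)
  qed
  then show ?thesis by (simp add: e_def sum_power2_le_zero_iff)
qed

section \<open>Periodic solutions from the monodromy matrix\<close>

lemma singular_2x2_kernel:
  fixes p q r s :: real
  assumes "p * s = q * r"
  obtains \<alpha> \<beta> where "\<alpha> \<noteq> 0 \<or> \<beta> \<noteq> 0" "\<alpha> * p + \<beta> * q = 0" "\<alpha> * r + \<beta> * s = 0"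
proof (cases "p = 0 \<and> q = 0")
  case False
  show thesis by (rule that[of q "- p"]) (use False assms in \<open>auto simp: algebra_simps\<close>)
next
  case pq: True
  show thesis
  proof (cases "r = 0 \<and> s = 0")
    case True
    show thesis by (rule that[of 1 0]) (use pq True in auto)
  next
    case False
    show thesis by (rule that[of s "- r"]) (use False pq in auto)
  qed
qed

text \<open>A kernel vector of the monodromy matrix minus 1 gives initial data that recur after one
  period. By uniqueness the difference of the solution and its translate then vanishes
  everywhere.\<close>

lemma hill_periodic_solution:
  assumes W: "\<And>t. \<bar>W t\<bar> \<le> M" "\<And>t. W (t + 1) = W t"
    and y1: "\<And>t. (y1 has_real_derivative z1 t) (at t)" "\<And>t. (z1 has_real_derivative - \<mu> * W t * y1 t) (at t)"
      "y1 0 = 1" "z1 0 = 0"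
    and y2: "\<And>t. (y2 has_real_derivative z2 t) (at t)" "\<And>t. (z2 has_real_derivative - \<mu> * W t * y2 t) (at t)"
      "y2 0 = 0" "z2 0 = 1"
    and sing: "(y1 1 - 1) * (z2 1 - 1) = y2 1 * z1 1"
  obtains f g where "\<And>t. (f has_real_derivative g t) (at t)" "\<And>t. (g has_real_derivative - \<mu> * W t * f t) (at t)"
    "\<And>t. f (t + 1) = f t" "f \<noteq> (\<lambda>t. 0)"
proof -
  obtain \<alpha> \<beta> where ab: "\<alpha> \<noteq> 0 \<or> \<beta> \<noteq> 0" "\<alpha> * (y1 1 - 1) + \<beta> * y2 1 = 0" "\<alpha> * z1 1 + \<beta> * (z2 1 - 1) = 0"
    by (rule singular_2x2_kernel[OF sing])
  define f where "f = (\<lambda>t. \<alpha> * y1 t + \<beta> * y2 t)"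
  define g where "g = (\<lambda>t. \<alpha> * z1 t + \<beta> * z2 t)"
  have f: "(f has_real_derivative g t) (at t)" for t
    unfolding f_def g_def by (intro DERIV_add DERIV_cmult y1 y2)
  have g: "(g has_real_derivative - \<mu> * W t * f t) (at t)" for t
  proof -
    have "(g has_real_derivative \<alpha> * (- \<mu> * W t * y1 t) + \<beta> * (- \<mu> * W t * y2 t)) (at t)"
      unfolding g_def by (intro DERIV_add DERIV_cmult y1 y2)
    then show ?thesis by (simp add: f_def algebra_simps)
  qed
  have shift: "((\<lambda>t. u (t + 1)) has_real_derivative v (t + 1)) (at t)"
    if "\<And>t. (u has_real_derivative v t) (at t)" for u v :: "real \<Rightarrow> real" and t
    using that[of "t + 1"] by (simp add: DERIV_shift)
  have "f (t + 1) - f t = 0" for t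
  proof (rule hill_unique[where f = "\<lambda>t. f (t + 1) - f t" and g = "\<lambda>t. g (t + 1) - g t" and q = "\<lambda>t. \<mu> * W t" and M = "\<bar>\<mu>\<bar> * M"])
    show "((\<lambda>t. f (t + 1) - f t) has_real_derivative g (t + 1) - g t) (at t)" for t
      by (intro DERIV_diff shift f)
    show "((\<lambda>t. g (t + 1) - g t) has_real_derivative - (\<mu> * W t) * (f (t + 1) - f t)) (at t)" for t
      by (rule DERIV_cong[OF DERIV_diff[OF shift[OF g] g]]) (simp only: W(2), simp add: algebra_simps)
    show "\<bar>\<mu> * W t\<bar> \<le> \<bar>\<mu>\<bar> * M" for t
      unfolding abs_mult by (intro mult_left_mono W) auto
    show "f (0 + 1) - f 0 = 0" "g (0 + 1) - g 0 = 0"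
      using ab by (simp_all add: f_def g_def y1 y2 algebra_simps)
  qed
  moreover have "f \<noteq> (\<lambda>t. 0)"
  proof
    assume z: "f = (\<lambda>t. 0)"
    then have "g 0 = 0" using DERIV_unique[OF f[of 0]] by simp
    moreover have "f 0 = 0" using z by simp
    ultimately show False using ab(1) by (simp add: f_def g_def y1 y2)
  qed
  ultimately show thesis using that[OF f g] by simp
qed

text \<open>Variation of constants: \<open>A\<close> and \<open>B\<close> are the coefficients of the solution with respect to
  \<open>cos (\<omega>t)\<close> and \<open>sin (\<omega>t)\<close>.\<close>

lemma hill_perturbation:
  fixes f g \<eta> :: "real \<Rightarrow> real"
  assumes f: "\<And>t. (f has_real_derivative g t) (at t)" and g: "\<And>t. (g has_real_derivative - (\<omega>\<^sup>2 + \<eta> t) * f t) (at t)"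
    and \<eta>: "continuous_on UNIV \<eta>" "\<And>t. \<bar>\<eta> t\<bar> \<le> \<epsilon>" and "\<omega> > 0" "\<epsilon> / \<omega> \<le> 1 / 2"
    and init: "f 0 = A0" "g 0 = \<omega> * B0" "A0\<^sup>2 + B0\<^sup>2 = 1"
  defines "A \<equiv> \<lambda>t. f t * cos (\<omega> * t) - g t / \<omega> * sin (\<omega> * t)"
    and "B \<equiv> \<lambda>t. f t * sin (\<omega> * t) + g t / \<omega> * cos (\<omega> * t)"
  shows "\<bar>A 1 - A0\<bar> \<le> 2 * (\<epsilon> / \<omega>)" "\<bar>B 1 - B0\<bar> \<le> 2 * (\<epsilon> / \<omega>)"
    "\<bar>A 1 - A0 - integral {0..1} (\<lambda>t. \<eta> t * (A0 * cos (\<omega> * t) + B0 * sin (\<omega> * t)) * sin (\<omega> * t)) / \<omega>\<bar> \<le> 4 * (\<epsilon> / \<omega>)\<^sup>2"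
    "\<bar>B 1 - B0 + integral {0..1} (\<lambda>t. \<eta> t * (A0 * cos (\<omega> * t) + B0 * sin (\<omega> * t)) * cos (\<omega> * t)) / \<omega>\<bar> \<le> 4 * (\<epsilon> / \<omega>)\<^sup>2"
proof -
  let ?c = "\<lambda>t. cos (\<omega> * t)" and ?s = "\<lambda>t. sin (\<omega> * t)"
  let ?f0 = "\<lambda>t. A0 * ?c t + B0 * ?s t"
  have e0: "\<epsilon> \<ge> 0" using \<eta>(2)[of 0] by linarith
  have A0: "A 0 = A0" and B0: "B 0 = B0" using init \<open>\<omega> > 0\<close> by (simp_all add: A_def B_def)
  have A': "(A has_real_derivative \<eta> t / \<omega> * (f t * ?s t)) (at t)" for t
    unfolding A_def using \<open>\<omega> > 0\<close>
    by (auto intro!: derivative_eq_intros f g simp: field_simps power2_eq_square)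
  have B': "(B has_real_derivative - (\<eta> t / \<omega> * (f t * ?c t))) (at t)" for t
    unfolding B_def using \<open>\<omega> > 0\<close>
    by (auto intro!: derivative_eq_intros f g simp: field_simps power2_eq_square)
  have fAB: "f t = A t * ?c t + B t * ?s t" for t
  proof -
    have "(a * c - b * s) * c + (a * s + b * c) * s = a * (c\<^sup>2 + s\<^sup>2)" for a b c s :: real
      by (simp add: algebra_simps power2_eq_square)
    from this[of "f t" "?c t" "g t / \<omega>" "?s t"] show ?thesis by (simp add: A_def B_def)
  qed
  \<comment> \<open>The squared amplitude is constant when \<open>\<eta>\<close> vanishes. Its
    growth rate is at most 2 \<epsilon> / \<omega>, hence at most 1.\<close>
  define q where "q = (\<lambda>t. (A t)\<^sup>2 + (B t)\<^sup>2)"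
  have rot: "(a * cos x + b * sin x)\<^sup>2 \<le> a\<^sup>2 + b\<^sup>2" for a b x :: real
  proof -
    have "(a * c + b * s)\<^sup>2 + (a * s - b * c)\<^sup>2 = (a\<^sup>2 + b\<^sup>2) * (c\<^sup>2 + s\<^sup>2)" for c s
      by (simp add: algebra_simps power2_eq_square)
    from this[of "cos x" "sin x"] show ?thesis
      using zero_le_power2[of "a * sin x - b * cos x"] unfolding sin_cos_squared_add2 mult_1_right by linarith
  qed
  have fq: "(f t)\<^sup>2 \<le> q t" for t using rot[of "A t" "\<omega> * t" "B t"] by (simp only: q_def fAB[of t])
  have gq: "(A t * ?s t - B t * ?c t)\<^sup>2 \<le> q t" for t
    using rot[of "- B t" "\<omega> * t" "A t"] by (simp add: q_def algebra_simps)
  define q' where "q' = (\<lambda>t. \<eta> t / \<omega> * (2 * f t * (A t * ?s t - B t * ?c t)))"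
  have q': "(q has_real_derivative q' t) (at t)" for t
    unfolding q_def q'_def
    by (auto intro!: derivative_eq_intros A' B' simp: algebra_simps)
  have q'_le: "q' t \<le> q t" for t
  proof -
    have "\<bar>2 * f t * (A t * ?s t - B t * ?c t)\<bar> \<le> 2 * q t"
      using sum_squares_bound[of "\<bar>f t\<bar>" "\<bar>A t * ?s t - B t * ?c t\<bar>"] fq[of t] gq[of t] by (simp add: abs_mult)
    then have "\<bar>q' t\<bar> \<le> (\<epsilon> / \<omega>) * (2 * q t)"
      unfolding q'_def abs_mult[of "\<eta> t / \<omega>"] using \<eta>(2)[of t] \<open>\<omega> > 0\<close> e0
      by (intro mult_mono) (auto simp: divide_right_mono)
    also have "\<dots> \<le> 1 / 2 * (2 * q t)"
      using assms(6) by (intro mult_right_mono) (auto simp: q_def)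
    finally show ?thesis by linarith
  qed
  \<comment> \<open>The amplitude starts at 1 and grows at most like e^t, so f^2 \<le> e \<le> 3 < 4
    on the period.\<close>
  have f2: "\<bar>f t\<bar> \<le> 2" if t: "t \<in> {0..1}" for t
  proof -
    have "q t * exp (- t) \<le> q 0 * exp (- 0)"
    proof (rule DERIV_nonpos_imp_nonincreasing[where f = "\<lambda>t. q t * exp (- t)"])
      fix x
      have "((\<lambda>t. q t * exp (- t)) has_real_derivative (q' x - q x) * exp (- x)) (at x)"
        by (auto intro!: derivative_eq_intros q' simp: algebra_simps)
      moreover have "(q' x - q x) * exp (- x) \<le> 0"
        using q'_le[of x] by (intro mult_nonpos_nonneg) auto
      ultimately show "\<exists>y. ((\<lambda>t. q t * exp (- t)) has_real_derivative y) (at x) \<and> y \<le> 0" by blast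
    qed (use t in simp)
    then have "q t * exp (- t) \<le> 1" by (simp add: q_def A0 B0 init)
    then have "q t \<le> exp t" by (simp add: exp_minus field_simps)
    also have "\<dots> \<le> exp 1" using t by simp
    also have "\<dots> \<le> 3" by (rule exp_le)
    finally have "(f t)\<^sup>2 \<le> 2\<^sup>2" using fq[of t] by simp
    then show ?thesis by (metis abs_le_square_iff abs_numeral)
  qed
  have bd: "\<bar>\<eta> t / \<omega> * (f t * c)\<bar> \<le> 2 * (\<epsilon> / \<omega>)" if "t \<in> {0..1}" "\<bar>c\<bar> \<le> 1" for t c
  proof -
    have "\<bar>f t * c\<bar> \<le> 2 * 1" unfolding abs_mult using f2[OF that(1)] that(2) by (intro mult_mono) auto
    then have "\<bar>\<eta> t / \<omega> * (f t * c)\<bar> \<le> \<epsilon> / \<omega> * 2"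
      unfolding abs_mult[of "\<eta> t / \<omega>"] using \<eta>(2)[of t] \<open>\<omega> > 0\<close> e0
      by (intro mult_mono) (auto simp: divide_right_mono)
    then show ?thesis by (subst mult.commute[of 2])
  qed
  have Ad: "\<bar>A t - A0\<bar> \<le> 2 * (\<epsilon> / \<omega>)" if t: "t \<in> {0..1}" for t
  proof -
    have "norm (A t - A 0) \<le> 2 * (\<epsilon> / \<omega>) * norm (t - 0)"
      by (rule field_differentiable_bound[of "{0..1}", OF _ has_field_derivative_at_within[OF A']])
        (use t bd in auto)
    also have "\<dots> \<le> 2 * (\<epsilon> / \<omega>) * 1" using t e0 \<open>\<omega> > 0\<close> by (intro mult_left_mono) auto
    finally show ?thesis by (simp add: A0)
  qed
  have Bd: "\<bar>B t - B0\<bar> \<le> 2 * (\<epsilon> / \<omega>)" if t: "t \<in> {0..1}" for t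
  proof -
    have "norm (B t - B 0) \<le> 2 * (\<epsilon> / \<omega>) * norm (t - 0)"
      by (rule field_differentiable_bound[of "{0..1}", OF _ has_field_derivative_at_within[OF B']])
        (use t bd in auto)
    also have "\<dots> \<le> 2 * (\<epsilon> / \<omega>) * 1" using t e0 \<open>\<omega> > 0\<close> by (intro mult_left_mono) auto
    finally show ?thesis by (simp add: B0)
  qed
  show "\<bar>A 1 - A0\<bar> \<le> 2 * (\<epsilon> / \<omega>)" "\<bar>B 1 - B0\<bar> \<le> 2 * (\<epsilon> / \<omega>)" using Ad[of 1] Bd[of 1] by auto
  have ff0: "\<bar>f t - ?f0 t\<bar> \<le> 4 * (\<epsilon> / \<omega>)" if t: "t \<in> {0..1}" for t
  proof -
    have "f t - ?f0 t = (A t - A0) * ?c t + (B t - B0) * ?s t"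
      unfolding fAB[of t] by (simp add: algebra_simps)
    also have "\<bar>\<dots>\<bar> \<le> \<bar>A t - A0\<bar> * \<bar>?c t\<bar> + \<bar>B t - B0\<bar> * \<bar>?s t\<bar>"
      using abs_triangle_ineq by (metis abs_mult)
    also have "\<dots> \<le> 2 * (\<epsilon> / \<omega>) * 1 + 2 * (\<epsilon> / \<omega>) * 1"
      using Ad[OF t] Bd[OF t] e0 \<open>\<omega> > 0\<close> by (intro add_mono mult_mono) auto
    finally show ?thesis by simp
  qed
  have cf: "continuous_on UNIV f" by (rule DERIV_continuous_on_UNIV[OF f])
  \<comment> \<open>Replacing \<open>f\<close> by the unperturbed solution inside the integral costs
    one factor \<epsilon> / \<omega> from \<open>\<eta>\<close> and 4 \<epsilon> / \<omega> from
    \<open>ff0\<close>, an error of second order.\<close>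
  have second: "\<bar>integral {0..1} (\<lambda>t. \<eta> t / \<omega> * (f t * k t)) - integral {0..1} (\<lambda>t. \<eta> t * ?f0 t * k t) / \<omega>\<bar> \<le> 4 * (\<epsilon> / \<omega>)\<^sup>2"
    if k: "continuous_on UNIV k" "\<And>t. \<bar>k t\<bar> \<le> 1" for k
  proof -
    have c01: "continuous_on {0..1} u" if "continuous_on UNIV u" for u :: "real \<Rightarrow> real"
      using that by (rule continuous_on_subset) simp
    have i1: "(\<lambda>t. \<eta> t / \<omega> * (f t * k t)) integrable_on {0..1}"
      and i2: "(\<lambda>t. \<eta> t / \<omega> * (?f0 t * k t)) integrable_on {0..1}"
      using \<open>\<omega> > 0\<close> by (intro integrable_continuous_interval continuous_intros c01 \<eta> cf k; simp)+
    have eq: "integral {0..1} (\<lambda>t. \<eta> t * ?f0 t * k t) / \<omega> = integral {0..1} (\<lambda>t. \<eta> t / \<omega> * (?f0 t * k t))"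
      unfolding integral_divide[symmetric] by (rule arg_cong[where f = "integral {0..1}"]) (auto simp: mult_ac)
    have "integral {0..1} (\<lambda>t. \<eta> t / \<omega> * (f t * k t)) - integral {0..1} (\<lambda>t. \<eta> t * ?f0 t * k t) / \<omega>
      = integral {0..1} (\<lambda>t. \<eta> t / \<omega> * (f t * k t) - \<eta> t / \<omega> * (?f0 t * k t))"
      unfolding eq by (rule integral_diff[OF i1 i2, symmetric])
    moreover have "norm (integral {0..1} (\<lambda>t. \<eta> t / \<omega> * (f t * k t) - \<eta> t / \<omega> * (?f0 t * k t))) \<le> 4 * (\<epsilon> / \<omega>)\<^sup>2 * (1 - 0)"
    proof (rule integral_bound)
      show "continuous_on {0..1} (\<lambda>t. \<eta> t / \<omega> * (f t * k t) - \<eta> t / \<omega> * (?f0 t * k t))"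
        using \<open>\<omega> > 0\<close> by (intro continuous_intros c01 \<eta> cf k) simp_all
      fix t :: real assume t: "t \<in> {0..1}"
      have "norm (\<eta> t / \<omega> * (f t * k t) - \<eta> t / \<omega> * (?f0 t * k t)) = \<bar>\<eta> t / \<omega>\<bar> * (\<bar>f t - ?f0 t\<bar> * \<bar>k t\<bar>)"
        by (simp only: right_diff_distrib[symmetric] left_diff_distrib[symmetric] real_norm_def abs_mult)
      also have "\<dots> \<le> (\<epsilon> / \<omega>) * (4 * (\<epsilon> / \<omega>) * 1)" (is "_ \<le> ?r")
        using \<eta>(2)[of t] ff0[OF t] k(2)[of t] e0 \<open>\<omega> > 0\<close>
        by (intro mult_mono) (auto simp: divide_right_mono)
      also have "?r = 4 * (\<epsilon> / \<omega>)\<^sup>2" by (simp add: power2_eq_square)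
      finally show "norm (\<eta> t / \<omega> * (f t * k t) - \<eta> t / \<omega> * (?f0 t * k t)) \<le> 4 * (\<epsilon> / \<omega>)\<^sup>2" .
    qed simp
    ultimately show ?thesis by simp
  qed
  have "((\<lambda>t. \<eta> t / \<omega> * (f t * ?s t)) has_integral A 1 - A 0) {0..1}"
    by (rule fundamental_theorem_of_calculus)
      (use A' in \<open>auto simp: has_real_derivative_iff_has_vector_derivative intro: has_vector_derivative_at_within\<close>)
  from integral_unique[OF this] have IA: "integral {0..1} (\<lambda>t. \<eta> t / \<omega> * (f t * ?s t)) = A 1 - A0"
    unfolding A0 .
  have "((\<lambda>t. - (\<eta> t / \<omega> * (f t * ?c t))) has_integral B 1 - B 0) {0..1}"
    by (rule fundamental_theorem_of_calculus)
      (use B' in \<open>auto simp: has_real_derivative_iff_has_vector_derivative intro: has_vector_derivative_at_within\<close>)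
  from integral_unique[OF this] have IB: "integral {0..1} (\<lambda>t. \<eta> t / \<omega> * (f t * ?c t)) = - (B 1 - B0)"
    unfolding B0 integral_neg by linarith
  have cont: "continuous_on UNIV ?s" "continuous_on UNIV ?c" by (intro continuous_intros)+
  show "\<bar>A 1 - A0 - integral {0..1} (\<lambda>t. \<eta> t * ?f0 t * ?s t) / \<omega>\<bar> \<le> 4 * (\<epsilon> / \<omega>)\<^sup>2"
    using second[OF cont(1)] unfolding IA by simp
  have "\<bar>- (B 1 - B0) - integral {0..1} (\<lambda>t. \<eta> t * ?f0 t * ?c t) / \<omega>\<bar> \<le> 4 * (\<epsilon> / \<omega>)\<^sup>2"
    using second[OF cont(2)] unfolding IB by simp
  moreover have "\<bar>- x - y\<bar> = \<bar>x + y\<bar>" for x y :: real by simp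
  ultimately show "\<bar>B 1 - B0 + integral {0..1} (\<lambda>t. \<eta> t * ?f0 t * ?c t) / \<omega>\<bar> \<le> 4 * (\<epsilon> / \<omega>)\<^sup>2"
    by simp
qed

text \<open>The bootstrap runs for the pair of function and derivative, since each is the source of
  regularity for the other.\<close>

lemma smooth_on_hill:
  fixes f g q :: "real \<Rightarrow> real"
  assumes "\<And>t. (f has_real_derivative g t) (at t)" "\<And>t. (g has_real_derivative q t * f t) (at t)"
    and "smooth_on UNIV q"
  shows "smooth_on UNIV f"
proof -
  have "Ck_on k UNIV f \<and> Ck_on k UNIV g" for k
  proof (induction k)
    case 0
    show ?case using DERIV_continuous_on_UNIV[OF assms(1)] DERIV_continuous_on_UNIV[OF assms(2)] by simp
  next
    case (Suc k)
    have "Ck_on k UNIV (\<lambda>t. q t * f t)"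
      by (rule Ck_on_bounded_bilinear[OF bounded_bilinear_mult])
        (use Suc assms(3) in \<open>auto simp: smooth_on_def\<close>)
    then show ?case
      using Suc Ck_on_vector_derivativeI[of f g] Ck_on_vector_derivativeI[of g "\<lambda>t. q t * f t"]
        assms(1,2)[unfolded has_real_derivative_iff_has_vector_derivative] by blast
  qed
  then show ?thesis by (simp add: smooth_on_def)
qed

section \<open>Bounds for the two first positive eigenvalues at a fixed metric\<close>

lemma abs_integral_le:
  fixes f :: "real \<Rightarrow> real"
  assumes "continuous_on {0..1} f" "\<And>t. t \<in> {0..1} \<Longrightarrow> \<bar>f t\<bar> \<le> B"
  shows "\<bar>integral {0..1} f\<bar> \<le> B"
  using integral_bound[of 0 1 f B] assms by simp

text \<open>The first order matrix has diagonal entries u, -u and off-diagonal entries q, -n, so its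
  determinant is q n - u^2. The square only helps and is dropped. Each entry is known up to
  \<open>\<delta>\<close>, of second order, so the error in the determinant is of third
  order.\<close>

lemma determinant_estimate:
  fixes \<alpha> \<beta> a b u q n x \<delta> :: real
  assumes "\<bar>\<alpha> - u\<bar> \<le> \<delta>" "\<bar>\<beta> + u\<bar> \<le> \<delta>" "\<bar>a - q\<bar> \<le> \<delta>" "\<bar>b + n\<bar> \<le> \<delta>"
    and "\<bar>u\<bar> \<le> x" "\<bar>q\<bar> \<le> x" "\<bar>n\<bar> \<le> x"
  shows "\<alpha> * \<beta> - a * b \<le> q * n + 4 * (x * \<delta>) + 2 * (\<delta> * \<delta>)"
proof -
  define r1 r2 r3 r4 where "r1 = \<alpha> - u" "r2 = \<beta> + u" "r3 = a - q" "r4 = b + n"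
  note r = this
  have d: "\<delta> \<ge> 0" "x \<ge> 0" using assms(1,5) by linarith+
  have p: "p * s \<le> y * z" if "\<bar>p\<bar> \<le> y" "\<bar>s\<bar> \<le> z" for p s y z :: real
  proof -
    have "\<bar>p * s\<bar> \<le> y * z" unfolding abs_mult using that by (intro mult_mono) auto
    then show ?thesis by linarith
  qed
  have "\<alpha> * \<beta> - a * b = q * n - u\<^sup>2 + (u * r2 + (- u) * r1 + r1 * r2 + (- q) * r4 + n * r3 + (- r3) * r4)"
    unfolding r by (simp add: algebra_simps power2_eq_square)
  also have "\<dots> \<le> q * n + (x * \<delta> + x * \<delta> + \<delta> * \<delta> + x * \<delta> + x * \<delta> + \<delta> * \<delta>)"
    using zero_le_power2[of u] by (intro add_mono p) (use assms in \<open>auto simp: r\<close>)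
  finally show ?thesis by (simp add: algebra_simps)
qed

text \<open>The intermediate value theorem is started at pi^2 and not at 0, because 0 is the
  eigenvalue of the constants. At pi^2 the flat value of \<open>F\<close> is 4, which survives the
  perturbation.\<close>

lemma mu1_conformal_metric_less:
  assumes h: "smooth_on UNIV h" "\<And>t. h t > 0" "\<And>t. h (t + 1) = h t"
    and w: "\<And>t. \<bar>h t ^ 4 - 1\<bar> \<le> 1 / 13" and "m > pi\<^sup>2"
    and \<eta>: "\<And>t. \<eta> t = m * h t ^ 4 - (2 * pi)\<^sup>2" "\<And>t. \<bar>\<eta> t\<bar> \<le> \<epsilon>" and \<epsilon>: "\<epsilon> / (2 * pi) \<le> 1 / 2"
    and neg: "integral {0..1} (\<lambda>t. \<eta> t * (sin (2 * pi * t))\<^sup>2) * integral {0..1} (\<lambda>t. \<eta> t * (cos (2 * pi * t))\<^sup>2)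
      + 8 * \<epsilon> ^ 3 < 0"
  shows "mu1 (conformal_metric h) < m"
proof -
  define W where "W = (\<lambda>t. h t ^ 4)"
  have sW: "smooth_on UNIV W" unfolding W_def by (rule smooth_on_power[OF h(1)])
  note cW = smooth_on_continuous_on[OF sW]
  have bW: "\<bar>W t\<bar> \<le> 2" for t using w[of t] h(2)[of t] zero_less_power[of "h t" 4] unfolding W_def by linarith
  obtain y1 z1 where y1: "\<And>\<mu> t. (y1 \<mu> has_real_derivative z1 \<mu> t) (at t)"
    "\<And>\<mu> t. (z1 \<mu> has_real_derivative - \<mu> * W t * y1 \<mu> t) (at t)"
    "\<And>\<mu>. y1 \<mu> 0 = 1" "\<And>\<mu>. z1 \<mu> 0 = 0"
    "\<And>t. continuous_on UNIV (\<lambda>\<mu>. y1 \<mu> t)" "\<And>t. continuous_on UNIV (\<lambda>\<mu>. z1 \<mu> t)"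
    using hill_solution[OF cW bW, of 1 0] by metis
  obtain y2 z2 where y2: "\<And>\<mu> t. (y2 \<mu> has_real_derivative z2 \<mu> t) (at t)"
    "\<And>\<mu> t. (z2 \<mu> has_real_derivative - \<mu> * W t * y2 \<mu> t) (at t)"
    "\<And>\<mu>. y2 \<mu> 0 = 0" "\<And>\<mu>. z2 \<mu> 0 = 1"
    "\<And>t. continuous_on UNIV (\<lambda>\<mu>. y2 \<mu> t)" "\<And>t. continuous_on UNIV (\<lambda>\<mu>. z2 \<mu> t)"
    using hill_solution[OF cW bW, of 0 1] by metis
  define F where "F = (\<lambda>\<mu>. (y1 \<mu> 1 - 1) * (z2 \<mu> 1 - 1) - y2 \<mu> 1 * z1 \<mu> 1)"
  have cF: "continuous_on UNIV F" unfolding F_def by (intro continuous_intros y1 y2)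
  have ode1: "(z1 \<mu> has_real_derivative - (\<omega>\<^sup>2 + (\<mu> * W t - \<omega>\<^sup>2)) * y1 \<mu> t) (at t)" for \<mu> \<omega> t
    using y1(2)[of \<mu> t] by simp
  \<comment> \<open>The factor \<open>\<omega>\<close> normalizes the second solution to the data A0
    = 0, B0 = 1. The determinant is unchanged, since y2 z1 = (\<omega> y2) (z1 / \<omega>).\<close>
  have scaled: "((\<lambda>t. \<omega> * y2 \<mu> t) has_real_derivative \<omega> * z2 \<mu> t) (at t)"
    "((\<lambda>t. \<omega> * z2 \<mu> t) has_real_derivative - (\<omega>\<^sup>2 + (\<mu> * W t - \<omega>\<^sup>2)) * (\<omega> * y2 \<mu> t)) (at t)" for \<mu> \<omega> t
    using DERIV_cmult[OF y2(1), of \<omega>] DERIV_cmult[OF y2(2), of \<omega>] by (simp_all add: mult_ac)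
  have cont\<eta>: "continuous_on UNIV (\<lambda>t. \<mu> * W t - \<omega>)" for \<mu> \<omega> :: real
    by (intro continuous_intros cW)
  have Fpi: "F (pi\<^sup>2) > 0"
  proof -
    \<comment> \<open>The bound 1/13 is matched to pi \<le> 13/4, so that the relative perturbation
      at frequency pi is 1/4.\<close>
    have bd: "\<bar>pi\<^sup>2 * W t - pi\<^sup>2\<bar> \<le> pi / 4" for t
    proof -
      have "\<bar>pi\<^sup>2 * W t - pi\<^sup>2\<bar> = pi * (pi * \<bar>W t - 1\<bar>)"
      proof -
        have "pi\<^sup>2 * W t - pi\<^sup>2 = pi * (pi * (W t - 1))" by (simp add: power2_eq_square algebra_simps)
        then show ?thesis by (simp add: abs_mult)
      qed
      also have "\<dots> \<le> pi * (13 / 4 * (1 / 13))"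
        using w[of t] pi_less_4 pi_approx by (intro mult_left_mono mult_mono) (auto simp: W_def)
      finally show ?thesis by simp
    qed
    have q: "pi / 4 / pi \<le> 1 / 2" "pi > 0" by simp_all
    note P1 = hill_perturbation[where ?A0.0 = 1 and ?B0.0 = 0, OF y1(1) ode1 cont\<eta> bd q(2,1)]
    note P2 = hill_perturbation[where ?A0.0 = 0 and ?B0.0 = 1, OF scaled cont\<eta> bd q(2,1)]
    have 1: "\<bar>- y1 (pi\<^sup>2) 1 - 1\<bar> \<le> 1 / 2" "\<bar>- z1 (pi\<^sup>2) 1 / pi\<bar> \<le> 1 / 2"
      using P1(1,2) y1(3,4) by simp_all
    have 2: "\<bar>pi * y2 (pi\<^sup>2) 1\<bar> \<le> 1 / 2" "\<bar>- z2 (pi\<^sup>2) 1 - 1\<bar> \<le> 1 / 2"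
      using P2(1,2) y2(3,4) by simp_all
    \<comment> \<open>In the flat case both diagonal entries of the monodromy matrix are -1 and the
      others vanish. The perturbed determinant is still at least 9/4 - 1/4.\<close>
    have "3 / 2 * (3 / 2) \<le> (1 - y1 (pi\<^sup>2) 1) * (1 - z2 (pi\<^sup>2) 1)"
      using 1 2 by (intro mult_mono) linarith+
    moreover have "y2 (pi\<^sup>2) 1 * z1 (pi\<^sup>2) 1 = (pi * y2 (pi\<^sup>2) 1) * (z1 (pi\<^sup>2) 1 / pi)" by simp
    moreover have "\<bar>(pi * y2 (pi\<^sup>2) 1) * (z1 (pi\<^sup>2) 1 / pi)\<bar> \<le> 1 / 2 * (1 / 2)"
      unfolding abs_mult[of "pi * y2 (pi\<^sup>2) 1"] using 1 2 by (intro mult_mono) auto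
    ultimately show ?thesis unfolding F_def by (simp add: algebra_simps)
  qed
  have Fm: "F m < 0"
  proof -
    define x where "x = \<epsilon> / (2 * pi)"
    define P Q N where "P = integral {0..1} (\<lambda>t. \<eta> t * (cos (2 * pi * t) * sin (2 * pi * t))) / (2 * pi)"
      "Q = integral {0..1} (\<lambda>t. \<eta> t * (sin (2 * pi * t))\<^sup>2) / (2 * pi)"
      "N = integral {0..1} (\<lambda>t. \<eta> t * (cos (2 * pi * t))\<^sup>2) / (2 * pi)"
    note PQN = this
    have e0: "\<epsilon> \<ge> 0" using \<eta>(2)[of 0] by linarith
    have x0: "x \<ge> 0" using e0 by (simp add: x_def)
    have \<eta>': "(\<lambda>t. m * W t - (2 * pi)\<^sup>2) = \<eta>" using \<eta>(1) by (auto simp: W_def)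
    have \<eta>W: "\<eta> t = m * W t - (2 * pi)\<^sup>2" for t using \<eta>(1) by (simp add: W_def)
    have c\<eta>: "continuous_on UNIV \<eta>" using cont\<eta>[of m "(2 * pi)\<^sup>2"] by (simp only: \<eta>')
    have q: "2 * pi > 0" by simp
    have bd: "\<bar>m * W t - (2 * pi)\<^sup>2\<bar> \<le> \<epsilon>" for t using \<eta> by (simp add: W_def)
    note P1 = hill_perturbation[where ?A0.0 = 1 and ?B0.0 = 0, OF y1(1) ode1 cont\<eta> bd q \<epsilon>]
    note P2 = hill_perturbation[where ?A0.0 = 0 and ?B0.0 = 1, OF scaled cont\<eta> bd q \<epsilon>]
    have 1: "\<bar>(y1 m 1 - 1) - P\<bar> \<le> 4 * x\<^sup>2" "\<bar>z1 m 1 / (2 * pi) + N\<bar> \<le> 4 * x\<^sup>2"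
      using P1(3,4) y1(3,4) by (simp_all add: PQN \<eta>W x_def power2_eq_square mult.assoc)
    have 2: "\<bar>2 * pi * y2 m 1 - Q\<bar> \<le> 4 * x\<^sup>2" "\<bar>(z2 m 1 - 1) + P\<bar> \<le> 4 * x\<^sup>2"
      using P2(3,4) y2(3,4) by (simp_all add: PQN \<eta>W x_def power2_eq_square mult_ac)
    have le: "\<bar>integral {0..1} (\<lambda>t. \<eta> t * k t) / (2 * pi)\<bar> \<le> x"
      if k: "continuous_on UNIV k" "\<And>t. \<bar>k t\<bar> \<le> 1" for k
    proof -
      have "\<bar>integral {0..1} (\<lambda>t. \<eta> t * k t)\<bar> \<le> \<epsilon>"
      proof (rule abs_integral_le)
        show "continuous_on {0..1} (\<lambda>t. \<eta> t * k t)"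
          by (rule continuous_on_subset[of UNIV]) (auto intro: continuous_intros c\<eta> k)
        show "\<bar>\<eta> t * k t\<bar> \<le> \<epsilon>" for t
          using mult_mono[OF \<eta>(2)[of t] k(2)[of t]] e0 by (simp add: abs_mult)
      qed
      then show ?thesis by (simp add: x_def divide_right_mono)
    qed
    have b: "\<bar>P\<bar> \<le> x" "\<bar>Q\<bar> \<le> x" "\<bar>N\<bar> \<le> x"
      unfolding PQN
      by (intro le continuous_intros; simp add: abs_mult mult_le_one abs_square_le_1)+
    have "F m = (y1 m 1 - 1) * (z2 m 1 - 1) - (2 * pi * y2 m 1) * (z1 m 1 / (2 * pi))"
      by (simp add: F_def)
    also have "\<dots> \<le> Q * N + 4 * (x * (4 * x\<^sup>2)) + 2 * (4 * x\<^sup>2 * (4 * x\<^sup>2))"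
      by (rule determinant_estimate[OF 1(1) 2(2) 2(1) 1(2) b])
    also have "\<dots> = Q * N + 16 * x ^ 3 + 32 * (x ^ 3 * x)"
      by (simp add: eval_nat_numeral)
    also have "\<dots> \<le> Q * N + 16 * x ^ 3 + 32 * (x ^ 3 * (1 / 2))"
      using \<epsilon> x0 unfolding x_def[symmetric] by (intro add_left_mono mult_left_mono) auto
    also have "\<dots> = Q * N + 32 * x ^ 3" by simp
    also have "\<dots> < 0"
    proof -
      \<comment> \<open>Scaling back to \<open>\<epsilon>\<close>: 32 (2 pi)^2 / (2 pi)^3 = 16 / pi
        \<le> 8, the constant in hypothesis \<open>neg\<close>.\<close>
      have "(2 * pi)\<^sup>2 * (Q * N + 32 * x ^ 3) =
        integral {0..1} (\<lambda>t. \<eta> t * (sin (2 * pi * t))\<^sup>2) * integral {0..1} (\<lambda>t. \<eta> t * (cos (2 * pi * t))\<^sup>2)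
        + 16 / pi * \<epsilon> ^ 3"
        by (simp add: PQN x_def field_simps eval_nat_numeral)
      also have "16 / pi * \<epsilon> ^ 3 \<le> 8 * \<epsilon> ^ 3"
        using pi_ge_two e0 by (intro mult_right_mono) (auto simp: field_simps)
      finally have "(2 * pi)\<^sup>2 * (Q * N + 32 * x ^ 3) < 0" using neg by linarith
      then show ?thesis by (simp add: mult_less_0_iff)
    qed
    finally show ?thesis .
  qed
  obtain \<mu> where \<mu>: "pi\<^sup>2 \<le> \<mu>" "\<mu> \<le> m" "F \<mu> = 0"
    using IVT2'[of F m 0 "pi\<^sup>2"] Fpi Fm \<open>m > pi\<^sup>2\<close> continuous_on_subset[OF cF] by (auto simp: less_imp_le)
  have "\<mu> < m" using \<mu> Fm by (metis less_irrefl order_less_le)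
  have "\<mu> > 0" using \<mu>(1) pi_gt_zero by (meson less_le_trans zero_less_power)
  have sing: "(y1 \<mu> 1 - 1) * (z2 \<mu> 1 - 1) = y2 \<mu> 1 * z1 \<mu> 1" using \<mu>(3) by (simp add: F_def)
  obtain f g where f: "\<And>t. (f has_real_derivative g t) (at t)" "\<And>t. (g has_real_derivative - \<mu> * W t * f t) (at t)"
    "\<And>t. f (t + 1) = f t" "f \<noteq> (\<lambda>t. 0)"
    by (rule hill_periodic_solution[OF bW _ y1(1,2,3,4) y2(1,2,3,4) sing]) (auto simp: W_def h(3))
  have "smooth_on UNIV (\<lambda>t. - \<mu> * W t)" by (intro smooth_on_mult smooth_on_const sW)
  then have sf: "smooth_on UNIV f" by (rule smooth_on_hill[OF f(1,2)])
  have "is_eigenvalue (laplace (conformal_metric h)) \<mu>"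
    unfolding is_eigenvalue_def
  proof (intro exI[of _ "\<lambda>x. f (x $ 1)"] conjI allI)
    show "torus_smooth (\<lambda>x. f (x $ 1))" by (rule torus_smooth_fst_coord[OF sf f(3)])
    obtain t where "f t \<noteq> 0" using f(4) by auto
    then have "f ((\<chi> i. t) $ 1) \<noteq> 0" by simp
    then show "(\<lambda>x::real^2. f (x $ 1)) \<noteq> (\<lambda>x. 0)" by metis
    show "laplace (conformal_metric h) (\<lambda>x. f (x $ 1)) x = \<mu> *\<^sub>R f (x $ 1)" for x
      using laplace_conformal_metric_fst_coord[where x = x, OF h(2)
          f(1,2)[unfolded has_real_derivative_iff_has_vector_derivative]] h(2)[of "x $ 1"]
      by (simp add: W_def)
  qed
  then have "Inf {\<mu>. \<mu> > 0 \<and> is_eigenvalue (laplace (conformal_metric h)) \<mu>} \<le> \<mu>"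
    using \<open>\<mu> > 0\<close> by (intro cInf_lower bdd_belowI[of _ 0]) auto
  with \<open>\<mu> < m\<close> show ?thesis by (simp add: mu1_def first_positive_eigenvalue_def)
qed

text \<open>Only \<open>h^4\<close> is controlled, so every quantity in \<open>h^2\<close> is
  derived from it: |h^2 - 1| \<le> |h^4 - 1|, and the mean of h^2 is bounded by the
  arithmetic-geometric mean inequality, which is exact to first order at h = 1.\<close>

lemma lambda1_sq_conformal_metric_ge:
  assumes h: "smooth_on UNIV h" "\<And>t. h t > 0" "\<And>t. h (t + 1) = h t"
    and w: "\<And>t. \<bar>h t ^ 4 - 1\<bar> \<le> w" "64 * pi\<^sup>2 * w\<^sup>2 \<le> 1" and m: "m \<le> 8 * pi\<^sup>2" "0 \<le> m"
    and le: "m * ((1 + integral {0..1} (\<lambda>t. h t ^ 4)) / 2)\<^sup>2 \<le> 4 * pi\<^sup>2 * (1 - 64 * pi\<^sup>2 * w\<^sup>2)\<^sup>2"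
  shows "m \<le> lambda1_sq (conformal_metric h)"
proof -
  define R where "R = primitive (\<lambda>t. (h t)\<^sup>2)"
  define r where "r = R 1"
  have ch: "continuous_on UNIV h" by (rule smooth_on_continuous_on[OF h(1)])
  have "continuous_on UNIV (\<lambda>t. (h t)\<^sup>2)" by (intro continuous_intros ch)
  note R = primitive[OF this, folded R_def]
  have "((\<lambda>t. R (t + 1) - R t) has_real_derivative 0) (at t)" for t
  proof -
    have "((\<lambda>t. R (t + 1)) has_real_derivative (h (t + 1))\<^sup>2) (at t)"
      using R(2)[of "t + 1"] by (simp add: DERIV_shift)
    from DERIV_diff[OF this R(2)[of t]] show ?thesis by (simp add: h(3))
  qed
  from DERIV_isconst_all[of "\<lambda>t. R (t + 1) - R t", OF _] this
  have R1: "R (t + 1) = R t + r" for t using R(1) unfolding r_def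
    by (metis add_0 add.commute diff_add_cancel diff_zero)
  have Rint: "((\<lambda>t. (h t)\<^sup>2) has_integral r) {0..1}"
    using fundamental_theorem_of_calculus[of 0 1 R "\<lambda>t. (h t)\<^sup>2"] R
    by (simp add: r_def has_real_derivative_iff_has_vector_derivative has_vector_derivative_at_within)
  have "R 0 < R 1" 
  proof (rule DERIV_pos_imp_increasing[where f = R])
    show "\<exists>y. (R has_real_derivative y) (at x) \<and> 0 < y" for x
      using R(2)[of x] h(2)[of x] by (intro exI[of _ "(h x)\<^sup>2"]) simp
  qed simp
  then have r0: "r > 0" by (simp add: r_def R(1))
  have ch4: "continuous_on {0..1} (\<lambda>t. h t ^ 4)"
    by (rule continuous_on_subset[of UNIV]) (auto intro!: continuous_intros ch)
  have r_le: "r \<le> (1 + integral {0..1} (\<lambda>t. h t ^ 4)) / 2"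
  proof (rule has_integral_le[OF Rint])
    have "((\<lambda>t. (1 + h t ^ 4) / 2) has_integral (1 * (1 - 0) + integral {0..1} (\<lambda>t. h t ^ 4)) / 2) {0..1}"
      by (intro has_integral_divide has_integral_add integrable_integral integrable_continuous_interval ch4)
        (use has_integral_const_real[of "1::real" 0 1] in simp)
    then show "((\<lambda>t. (1 + h t ^ 4) / 2) has_integral (1 + integral {0..1} (\<lambda>t. h t ^ 4)) / 2) {0..1}" by simp
    show "(h t)\<^sup>2 \<le> (1 + h t ^ 4) / 2" for t
      using sum_squares_bound[of 1 "(h t)\<^sup>2"] by (simp flip: power_mult)
  qed
  have h2: "\<bar>(h t)\<^sup>2 - 1\<bar> \<le> w" for t
  proof -
    have "\<bar>(h t)\<^sup>2 - 1\<bar> * 1 \<le> \<bar>(h t)\<^sup>2 - 1\<bar> * ((h t)\<^sup>2 + 1)" by (intro mult_left_mono) auto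
    also have "\<dots> = \<bar>h t ^ 4 - 1\<bar>"
    proof -
      have "h t ^ 4 - 1 = ((h t)\<^sup>2 - 1) * ((h t)\<^sup>2 + 1)" by (simp add: algebra_simps eval_nat_numeral)
      moreover have "\<bar>(h t)\<^sup>2 + 1\<bar> = (h t)\<^sup>2 + 1" by simp
      ultimately show ?thesis by (simp only: abs_mult)
    qed
    finally show ?thesis using w(1)[of t] by simp
  qed
  have r1: "\<bar>r - 1\<bar> \<le> w"
  proof -
    have "((\<lambda>t. (h t)\<^sup>2 - 1) has_integral r - 1) {0..1}"
      using has_integral_diff[OF Rint has_integral_const_real[of "1::real" 0 1]] by simp
    from has_integral_bound_real[OF _ _ this, of w "{}"] show ?thesis
      using h2 order_trans[OF abs_ge_zero h2[of 0]] by simp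
  qed
  \<comment> \<open>The derivative of \<open>S\<close> is at most 2 w and S(0) = 0, so |S| \<le> 2 w
    on one period and, by periodicity, everywhere.\<close>
  define S where "S = (\<lambda>t. R t - r * t)"
  have S': "(S has_real_derivative (h t)\<^sup>2 - r) (at t)" for t
    unfolding S_def by (auto intro!: derivative_eq_intros R(2))
  have Sper: "S (t + 1) = S t" for t by (simp add: S_def R1 algebra_simps del: add.commute)
  have "\<bar>S t\<bar> \<le> 2 * w" for t
  proof -
    have t: "frac t \<in> {0..1}" using frac_lt_1[of t] by (simp add: less_imp_le)
    have "norm (S (frac t) - S 0) \<le> 2 * w * norm (frac t - 0)"
    proof (rule field_differentiable_bound[of "{0..1}", OF _ has_field_derivative_at_within[OF S']])
      show "norm ((h u)\<^sup>2 - r) \<le> 2 * w" for u using h2[of u] r1 by (simp add: abs_le_iff)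
    qed (use t in auto)
    also have "\<dots> \<le> 2 * w * 1" using t h2[of 0] by (intro mult_left_mono) auto
    finally have "\<bar>S (frac t)\<bar> \<le> 2 * w" by (simp add: S_def R(1))
    moreover have "S t = S (frac t)"
      using periodic_int[where f = S and t = "frac t" and k = "\<lfloor>t\<rfloor>", OF Sper] by (simp add: frac_def)
    ultimately show ?thesis by simp
  qed
  note bound = dirac_square_eigenvalue_bound[OF h S' Sper this r0]
  let ?X = "{\<nu>. \<nu> > 0 \<and> is_eigenvalue (\<lambda>\<psi>. dirac (conformal_metric h) (dirac (conformal_metric h) \<psi>)) \<nu>}"
  have "m \<le> Inf ?X"
  proof (rule cInf_greatest)
    have "(2 * pi / r)\<^sup>2 \<in> ?X"
      using dirac_square_has_positive_eigenvalue[OF h R(2) R1 r0] r0 by simp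
    then show "?X \<noteq> {}" by blast
    fix \<nu> assume \<nu>: "\<nu> \<in> ?X"
    show "m \<le> \<nu>"
    proof (rule ccontr)
      assume less: "\<not> m \<le> \<nu>"
      let ?k = "1 - 64 * pi\<^sup>2 * w\<^sup>2"
      \<comment> \<open>Here the implicit bound is closed: under the assumption \<nu> < m \<le> 8
        pi^2 the loss 2 \<nu> (2 w)^2 is at most 64 pi^2 w^2.\<close>
      have "\<nu> * w\<^sup>2 \<le> 8 * pi\<^sup>2 * w\<^sup>2" using less m by (intro mult_right_mono) auto
      then have "?k \<le> 1 - 2 * \<nu> * (2 * w)\<^sup>2" by (simp add: power2_eq_square)
      then have "2 * pi * ?k \<le> 2 * pi * (1 - 2 * \<nu> * (2 * w)\<^sup>2)" by (intro mult_left_mono) auto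
      also have "\<dots> \<le> sqrt \<nu> * r" using bound \<nu> by blast
      finally have "(2 * pi * ?k)\<^sup>2 \<le> (sqrt \<nu> * r)\<^sup>2" using w(2) by (intro power_mono) auto
      then have "4 * pi\<^sup>2 * ?k\<^sup>2 \<le> \<nu> * r\<^sup>2" using \<nu> by (simp add: power_mult_distrib)
      moreover have "m * r\<^sup>2 \<le> m * ((1 + integral {0..1} (\<lambda>t. h t ^ 4)) / 2)\<^sup>2"
        using r_le r0 m by (intro mult_left_mono power_mono) auto
      ultimately have "m * r\<^sup>2 \<le> \<nu> * r\<^sup>2" using le by linarith
      with r0 less show False by (simp add: mult_le_cancel_right)
    qed
  qed
  then show ?thesis by (simp add: lambda1_sq_def first_positive_eigenvalue_def)
qed

section \<open>Comparison of the first eigenvalues\<close>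

lemma integral_cos_sin_square:
  "integral {0..1} (\<lambda>t. (cos (2 * pi * t))\<^sup>2) = 1 / 2" "integral {0..1} (\<lambda>t. (sin (2 * pi * t))\<^sup>2) = 1 / 2"
proof -
  let ?F = "\<lambda>t. t / 2 + sin (2 * pi * t) * cos (2 * pi * t) / (4 * pi)"
  have "((\<lambda>t. (cos (2 * pi * t))\<^sup>2) has_integral ?F 1 - ?F 0) {0..1}"
  proof (rule fundamental_theorem_of_calculus)
    fix t
    have "(?F has_real_derivative 1 / 2 + ((cos (2 * pi * t))\<^sup>2 - (sin (2 * pi * t))\<^sup>2) / 2) (at t within {0..1})"
      by (auto intro!: derivative_eq_intros simp: field_simps power2_eq_square)
    moreover have "1 / 2 + ((cos (2 * pi * t))\<^sup>2 - (sin (2 * pi * t))\<^sup>2) / 2 = (cos (2 * pi * t))\<^sup>2"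
      by (simp add: sin_squared_eq diff_divide_distrib)
    ultimately show "(?F has_vector_derivative (cos (2 * pi * t))\<^sup>2) (at t within {0..1})"
      by (simp add: has_real_derivative_iff_has_vector_derivative)
  qed simp
  then have c: "((\<lambda>t. (cos (2 * pi * t))\<^sup>2) has_integral 1 / 2) {0..1}" by simp
  then show "integral {0..1} (\<lambda>t. (cos (2 * pi * t))\<^sup>2) = 1 / 2" by (rule integral_unique)
  have "((\<lambda>t. 1 - (cos (2 * pi * t))\<^sup>2) has_integral 1 - 1 / 2) {0..1}"
    using has_integral_diff[OF has_integral_const_real[of "1::real" 0 1] c] by simp
  then show "integral {0..1} (\<lambda>t. (sin (2 * pi * t))\<^sup>2) = 1 / 2"
    by (simp add: sin_squared_eq integral_unique)
qed

text \<open>The two factors are the weighted integrals of \<open>\<eta>\<close> at the trial value,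
  up to 4 pi^2. Their main parts multiply to a^2 / 4 - \<tau>^2 = -(3/4) a^2, which is negative
  because the trial value lies inside the gap.\<close>

lemma product_estimate:
  fixes \<tau> a s1 s2 \<epsilon> :: real
  assumes "\<bar>\<tau>\<bar> = a" "a \<le> \<epsilon>" "\<bar>s1\<bar> \<le> 7 * \<epsilon>\<^sup>2" "\<bar>s2\<bar> \<le> 7 * \<epsilon>\<^sup>2" "\<epsilon> \<le> 1 / 100"
  shows "(\<tau> - a / 2 + s1) * (- \<tau> - a / 2 + s2) \<le> - (3 / 4) * a\<^sup>2 + 22 * \<epsilon> ^ 3"
proof -
  have a0: "a \<ge> 0" "\<epsilon> \<ge> 0" using assms(1,2) by auto
  have p: "p * s \<le> y * z" if "\<bar>p\<bar> \<le> y" "\<bar>s\<bar> \<le> z" for p s y z :: real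
  proof -
    have "\<bar>p * s\<bar> \<le> y * z" unfolding abs_mult using that by (intro mult_mono) auto
    then show ?thesis by linarith
  qed
  have b: "\<bar>- \<tau> - a / 2\<bar> \<le> 3 / 2 * \<epsilon>" "\<bar>\<tau> - a / 2\<bar> \<le> 3 / 2 * \<epsilon>" using assms(1,2) by linarith+
  have \<tau>: "\<tau>\<^sup>2 = a\<^sup>2" using assms(1) by (metis power2_abs)
  have "(\<tau> - a / 2 + s1) * (- \<tau> - a / 2 + s2)
      = - \<tau>\<^sup>2 + a\<^sup>2 / 4 + (s1 * (- \<tau> - a / 2) + s2 * (\<tau> - a / 2) + s1 * s2)"
    by (simp add: algebra_simps power2_eq_square)
  also have "\<dots> \<le> - \<tau>\<^sup>2 + a\<^sup>2 / 4 + (7 * \<epsilon>\<^sup>2 * (3 / 2 * \<epsilon>) + 7 * \<epsilon>\<^sup>2 * (3 / 2 * \<epsilon>) + 7 * \<epsilon>\<^sup>2 * (7 * \<epsilon>\<^sup>2))"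
    by (intro add_left_mono add_mono p assms b)
  also have "\<dots> = - (3 / 4) * a\<^sup>2 + 21 * \<epsilon> ^ 3 + 49 * (\<epsilon> ^ 3 * \<epsilon>)"
    unfolding \<tau> by (simp add: eval_nat_numeral)
  also have "\<dots> \<le> - (3 / 4) * a\<^sup>2 + 21 * \<epsilon> ^ 3 + 49 * (\<epsilon> ^ 3 * (1 / 100))"
    using assms(5) a0 by (intro add_left_mono mult_left_mono) auto
  also have "\<dots> \<le> - (3 / 4) * a\<^sup>2 + 22 * \<epsilon> ^ 3" using a0 by simp
  finally show ?thesis .
qed

text \<open>Here \<open>J\<close> stands for the upper bound of the mean of h^2. Its square is 1 + x
  up to second order, and the factor 1 - x - a cancels the linear term in x, leaving the gain
  -a.\<close>

lemma square_estimate: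
  fixes x a J \<epsilon> :: real
  assumes "\<bar>x\<bar> \<le> 2 * \<epsilon>" "0 \<le> a" "a \<le> \<epsilon>" "0 \<le> J" "J \<le> 1 + x / 2 + \<epsilon>\<^sup>2 / 2" "\<epsilon> \<le> 1 / 100"
  shows "(1 - x - a) * J\<^sup>2 \<le> 1 - a + 8 * \<epsilon>\<^sup>2"
proof -
  have e0: "0 \<le> \<epsilon>" using assms by linarith
  have p: "p * s \<le> y * z" if "\<bar>p\<bar> \<le> y" "\<bar>s\<bar> \<le> z" for p s y z :: real
  proof -
    have "\<bar>p * s\<bar> \<le> y * z" unfolding abs_mult using that by (intro mult_mono) auto
    then show ?thesis by linarith
  qed
  have e2: "\<epsilon>\<^sup>2 \<le> \<epsilon> * (1 / 100)" unfolding power2_eq_square using e0 assms(6) by (intro mult_left_mono)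
  have "J\<^sup>2 \<le> (1 + x / 2 + \<epsilon>\<^sup>2 / 2)\<^sup>2" using assms by (intro power_mono)
  also have "\<dots> = 1 + x + \<epsilon>\<^sup>2 + ((x / 2) * (x / 2) + x * (\<epsilon>\<^sup>2 / 2) + (\<epsilon>\<^sup>2 / 2) * (\<epsilon>\<^sup>2 / 2))"
    by (simp add: algebra_simps power2_eq_square)
  also have "\<dots> \<le> 1 + x + \<epsilon>\<^sup>2 + (\<epsilon> * \<epsilon> + (2 * \<epsilon>) * (\<epsilon> / 4) + (\<epsilon> / 4) * (\<epsilon> / 4))"
    using assms e0 e2 by (intro add_left_mono add_mono p) (auto simp: abs_le_iff)
  also have "\<dots> \<le> 1 + x + 3 * \<epsilon>\<^sup>2" by (simp add: power2_eq_square)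
  finally have J: "J\<^sup>2 \<le> 1 + x + 3 * \<epsilon>\<^sup>2" .
  have "(1 - x - a) * J\<^sup>2 \<le> (1 - x - a) * (1 + x + 3 * \<epsilon>\<^sup>2)"
    using J assms by (intro mult_left_mono) auto
  also have "\<dots> = 1 - a - x\<^sup>2 + (a * (- x) + 3 * \<epsilon>\<^sup>2 * (1 - x - a))"
    by (simp add: algebra_simps power2_eq_square)
  also have "\<dots> \<le> 1 - a - 0 + (\<epsilon> * (2 * \<epsilon>) + 3 * \<epsilon>\<^sup>2 * 2)"
    using assms e0 by (intro add_mono diff_left_mono p) auto
  finally show ?thesis by (simp add: power2_eq_square)
qed

lemma pi_square_less_10: "pi\<^sup>2 < 10"
proof -
  have "pi\<^sup>2 \<le> (63 / 20)\<^sup>2" using pi_approx(2) by (intro power_mono) auto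
  then show ?thesis by (simp add: power2_eq_square)
qed

text \<open>Both eigenvalues are compared with \<open>m = 4\<pi>\<^sup>2(1 - E(A + B) - \<bar>E\<bar>\<bar>A - B\<bar>/2)\<close>. To first order in \<open>E\<close>,
  \<open>\<mu>\<^sub>1\<close> is at most \<open>4\<pi>\<^sup>2(1 - E(A + B) - \<bar>E\<bar>\<bar>A - B\<bar>)\<close> and \<open>\<lambda>\<^sub>1\<^sup>2\<close> is at least \<open>4\<pi>\<^sup>2(1 - E(A + B))\<close>.\<close>

lemma mu1_less_lambda1_sq:
  fixes h H :: "real \<Rightarrow> real" and E M :: real
  assumes h: "smooth_on UNIV h" "\<And>t. h t > 0" "\<And>t. h (t + 1) = h t"
    and H: "continuous_on UNIV H" "\<And>t. \<bar>H t\<bar> \<le> M"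
    and approx: "\<And>t. \<bar>h t ^ 4 - (1 + E * H t)\<bar> \<le> M * E\<^sup>2" and "M \<ge> 1" "E \<noteq> 0"
  defines "A \<equiv> integral {0..1} (\<lambda>t. H t * (cos (2 * pi * t))\<^sup>2)"
    and "B \<equiv> integral {0..1} (\<lambda>t. H t * (sin (2 * pi * t))\<^sup>2)"
  assumes small: "M * \<bar>E\<bar> \<le> 1 / 100" "60000 * M ^ 3 * \<bar>E\<bar> < ((A - B) / 2)\<^sup>2" "6000 * M\<^sup>2 * \<bar>E\<bar> \<le> \<bar>(A - B) / 2\<bar>"
  shows "mu1 (conformal_metric h) < lambda1_sq (conformal_metric h)"
proof -
  define e \<epsilon> d x a where "e = \<bar>E\<bar>" "\<epsilon> = M * e" "d = \<bar>(A - B) / 2\<bar>" "x = E * (A + B)" "a = d * e"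
  note defs = this
  define m where "m = 4 * pi\<^sup>2 * (1 - x - a)"
  define \<rho> where "\<rho> = (\<lambda>t. h t ^ 4 - (1 + E * H t))"
  \<comment> \<open>Collects everything of second order in m h^4 / (4 pi^2) - 1. The bound 7
    \<epsilon>^2 is \<epsilon>^2 from \<open>\<rho>\<close> plus 3 \<epsilon> times 2 \<epsilon>
    from the product.\<close>
  define \<sigma> where "\<sigma> = (\<lambda>t. \<rho> t - (x + a) * (E * H t + \<rho> t))"
  define \<eta> where "\<eta> = (\<lambda>t. m * h t ^ 4 - (2 * pi)\<^sup>2)"
  have e: "e > 0" "0 \<le> \<epsilon>" "\<epsilon> \<le> 1 / 100" using \<open>E \<noteq> 0\<close> \<open>M \<ge> 1\<close> small(1) by (auto simp: defs)
  have c01: "continuous_on {0..1} f" if "continuous_on UNIV f" for f :: "real \<Rightarrow> real"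
    using that by (rule continuous_on_subset) simp
  have ch: "continuous_on UNIV h" by (rule smooth_on_continuous_on[OF h(1)])
  have c\<rho>: "continuous_on UNIV \<rho>" unfolding \<rho>_def by (intro continuous_intros ch H)
  have c\<sigma>: "continuous_on UNIV \<sigma>" unfolding \<sigma>_def by (intro continuous_intros c\<rho> H)
  have cc: "continuous_on UNIV (\<lambda>t. (cos (2 * pi * t))\<^sup>2)" "continuous_on UNIV (\<lambda>t. (sin (2 * pi * t))\<^sup>2)"
    by (intro continuous_intros)+
  have kc: "\<bar>(cos (2 * pi * t))\<^sup>2\<bar> \<le> 1" "\<bar>(sin (2 * pi * t))\<^sup>2\<bar> \<le> 1" for t
    by (simp_all add: abs_square_le_1)
  have le: "\<bar>integral {0..1} (\<lambda>t. f t * k t)\<bar> \<le> b"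
    if "continuous_on UNIV f" "continuous_on UNIV k" "\<And>t. \<bar>k t\<bar> \<le> 1" "\<And>t. \<bar>f t\<bar> \<le> b" for f k :: "real \<Rightarrow> real" and b
  proof (rule abs_integral_le)
    show "continuous_on {0..1} (\<lambda>t. f t * k t)" by (intro c01 continuous_on_mult that)
    show "\<bar>f t * k t\<bar> \<le> b" for t
      using mult_mono[OF that(4)[of t] that(3)[of t]] order_trans[OF abs_ge_zero that(4)[of t]] by (simp add: abs_mult)
  qed
  have AB: "\<bar>A\<bar> \<le> M" "\<bar>B\<bar> \<le> M" unfolding A_def B_def by (intro le H cc kc)+
  have "\<bar>x\<bar> = e * \<bar>A + B\<bar>" by (simp add: defs abs_mult)
  also have "\<dots> \<le> e * (2 * M)" using AB e by (intro mult_left_mono) auto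
  finally have x: "\<bar>x\<bar> \<le> 2 * \<epsilon>" by (simp add: defs mult_ac)
  have "d \<le> M" using AB by (simp add: defs abs_le_iff)
  then have a: "0 \<le> a" "a \<le> \<epsilon>" using e by (auto simp: defs mult_right_mono)
  \<comment> \<open>With M at least 1 the remainder is absorbed into \<epsilon>^2, so that a single
    small parameter governs all errors.\<close>
  have "M * e\<^sup>2 \<le> M\<^sup>2 * e\<^sup>2"
    using \<open>M \<ge> 1\<close> by (intro mult_right_mono) (auto simp: power2_eq_square)
  then have \<rho>: "\<bar>\<rho> t\<bar> \<le> \<epsilon>\<^sup>2" for t
    using approx[of t] by (simp add: \<rho>_def defs power_mult_distrib)
  have e2: "\<epsilon>\<^sup>2 \<le> \<epsilon> * (1 / 100)" unfolding power2_eq_square using e by (intro mult_left_mono)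
  have EH: "\<bar>E * H t\<bar> \<le> \<epsilon>" for t
    using mult_left_mono[OF H(2)[of t], of e] e by (simp add: abs_mult defs mult.commute)
  have W: "\<bar>h t ^ 4 - 1\<bar> \<le> 2 * \<epsilon>" for t
  proof -
    have "h t ^ 4 - 1 = E * H t + \<rho> t" by (simp add: \<rho>_def)
    then show ?thesis using EH[of t] \<rho>[of t] e2 e by linarith
  qed
  have \<sigma>: "\<bar>\<sigma> t\<bar> \<le> 7 * \<epsilon>\<^sup>2" for t
  proof -
    have "\<bar>(x + a) * (E * H t + \<rho> t)\<bar> \<le> (3 * \<epsilon>) * (2 * \<epsilon>)"
      unfolding abs_mult[of "x + a"] using x a EH[of t] \<rho>[of t] e2 e by (intro mult_mono) linarith+
    then show ?thesis using \<rho>[of t] unfolding \<sigma>_def by (simp add: power2_eq_square)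
  qed
  have \<eta>: "\<eta> t = 4 * pi\<^sup>2 * (E * H t - (x + a) + \<sigma> t)" for t
    by (simp add: \<eta>_def m_def \<sigma>_def \<rho>_def algebra_simps power2_eq_square)
  have \<eta>b: "\<bar>\<eta> t\<bar> \<le> 20 * pi\<^sup>2 * \<epsilon>" for t
  proof -
    have "\<bar>E * H t - (x + a) + \<sigma> t\<bar> \<le> 5 * \<epsilon>" using EH[of t] x a \<sigma>[of t] e2 e by linarith
    then have "4 * pi\<^sup>2 * \<bar>E * H t - (x + a) + \<sigma> t\<bar> \<le> 4 * pi\<^sup>2 * (5 * \<epsilon>)" by (intro mult_left_mono) auto
    then show ?thesis unfolding \<eta> by (simp add: abs_mult)
  qed
  have split: "integral {0..1} (\<lambda>t. \<eta> t * k t) = 4 * pi\<^sup>2 *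
      (E * integral {0..1} (\<lambda>t. H t * k t) - (x + a) * integral {0..1} k + integral {0..1} (\<lambda>t. \<sigma> t * k t))"
    if k: "continuous_on UNIV k" for k
  proof -
    have i: "(\<lambda>t. H t * k t) integrable_on {0..1}" "k integrable_on {0..1}" "(\<lambda>t. \<sigma> t * k t) integrable_on {0..1}"
      by (intro integrable_continuous_interval c01 continuous_on_mult H k c\<sigma>)+
    have "((\<lambda>t. 4 * pi\<^sup>2 * (E * (H t * k t) - (x + a) * k t + \<sigma> t * k t)) has_integral 4 * pi\<^sup>2 *
      (E * integral {0..1} (\<lambda>t. H t * k t) - (x + a) * integral {0..1} k + integral {0..1} (\<lambda>t. \<sigma> t * k t))) {0..1}"
      by (intro has_integral_mult_right has_integral_add has_integral_diff integrable_integral i)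
    moreover have "(\<lambda>t. 4 * pi\<^sup>2 * (E * (H t * k t) - (x + a) * k t + \<sigma> t * k t)) = (\<lambda>t. \<eta> t * k t)"
      by (rule ext) (simp add: \<eta> algebra_simps)
    ultimately show ?thesis by (simp only: integral_unique)
  qed
  define \<tau> where "\<tau> = E * (A - B) / 2"
  have \<tau>: "\<bar>\<tau>\<bar> = a" by (simp add: \<tau>_def defs abs_mult)
  define s1 where "s1 = integral {0..1} (\<lambda>t. \<sigma> t * (cos (2 * pi * t))\<^sup>2)"
  define s2 where "s2 = integral {0..1} (\<lambda>t. \<sigma> t * (sin (2 * pi * t))\<^sup>2)"
  have s: "\<bar>s1\<bar> \<le> 7 * \<epsilon>\<^sup>2" "\<bar>s2\<bar> \<le> 7 * \<epsilon>\<^sup>2" unfolding s1_def s2_def by (intro le c\<sigma> cc kc \<sigma>)+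
  have N: "integral {0..1} (\<lambda>t. \<eta> t * (cos (2 * pi * t))\<^sup>2) = 4 * pi\<^sup>2 * (\<tau> - a / 2 + s1)"
    unfolding split[OF cc(1)] integral_cos_sin_square A_def[symmetric] s1_def[symmetric]
    by (simp add: \<tau>_def defs(4) algebra_simps diff_divide_distrib add_divide_distrib)
  have Q: "integral {0..1} (\<lambda>t. \<eta> t * (sin (2 * pi * t))\<^sup>2) = 4 * pi\<^sup>2 * (- \<tau> - a / 2 + s2)"
    unfolding split[OF cc(2)] integral_cos_sin_square B_def[symmetric] s2_def[symmetric]
    by (simp add: \<tau>_def defs(4) algebra_simps diff_divide_distrib add_divide_distrib)
  have e3: "60000 * \<epsilon> ^ 3 < a\<^sup>2"
  proof -
    have "60000 * M ^ 3 * e < d\<^sup>2" using small(2) by (simp only: defs power2_abs)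
    then have "60000 * M ^ 3 * e * e\<^sup>2 < d\<^sup>2 * e\<^sup>2" using e by (intro mult_strict_right_mono) auto
    moreover have "60000 * \<epsilon> ^ 3 = 60000 * M ^ 3 * e * e\<^sup>2" unfolding defs(2) by (simp add: eval_nat_numeral)
    moreover have "a\<^sup>2 = d\<^sup>2 * e\<^sup>2" unfolding defs(5) by (simp add: power_mult_distrib)
    ultimately show ?thesis by simp
  qed
  have neg: "integral {0..1} (\<lambda>t. \<eta> t * (sin (2 * pi * t))\<^sup>2) * integral {0..1} (\<lambda>t. \<eta> t * (cos (2 * pi * t))\<^sup>2)
      + 8 * (20 * pi\<^sup>2 * \<epsilon>) ^ 3 < 0"
  proof -
    have "pi\<^sup>2 * \<epsilon> ^ 3 \<le> 10 * \<epsilon> ^ 3" using pi_square_less_10 e by (intro mult_right_mono) auto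
    \<comment> \<open>After division by 16 pi^4 the error 8 (20 pi^2 \<epsilon>)^3 becomes 4000 pi^2
      \<epsilon>^3 \<le> 40000 \<epsilon>^3. Together with 22 \<epsilon>^3 it stays below (3/4) a^2,
      which exceeds 45000 \<epsilon>^3 by \<open>e3\<close>.\<close>
    then have "(\<tau> - a / 2 + s1) * (- \<tau> - a / 2 + s2) + 4000 * (pi\<^sup>2 * \<epsilon> ^ 3) < 0"
      using product_estimate[OF \<tau> a(2) s e(3)] e3 zero_le_power[OF e(2), of 3] by linarith
    then have "16 * (pi\<^sup>2)\<^sup>2 * ((\<tau> - a / 2 + s1) * (- \<tau> - a / 2 + s2) + 4000 * (pi\<^sup>2 * \<epsilon> ^ 3)) < 0"
      by (intro mult_pos_neg) auto
    moreover have "4 * p * q * (4 * p * n) + 8 * (20 * p * \<epsilon>) ^ 3 = 16 * p\<^sup>2 * (n * q + 4000 * (p * \<epsilon> ^ 3))" for p q n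
      by (simp add: algebra_simps eval_nat_numeral)
    ultimately show ?thesis unfolding N Q by metis
  qed
  have "mu1 (conformal_metric h) < m"
  proof (rule mu1_conformal_metric_less[OF h _ _ _ \<eta>b _ neg])
    show "\<bar>h t ^ 4 - 1\<bar> \<le> 1 / 13" for t using W[of t] e by linarith
    have "pi\<^sup>2 * 1 < pi\<^sup>2 * (4 * (1 - x - a))"
      using x a e by (intro mult_strict_left_mono) auto
    then show "pi\<^sup>2 < m" by (simp add: m_def)
    show "\<eta> t = m * h t ^ 4 - (2 * pi)\<^sup>2" for t by (simp add: \<eta>_def)
    have "pi * \<epsilon> \<le> 4 * (1 / 100)" using pi_less_4 e by (intro mult_mono) auto
    then show "20 * pi\<^sup>2 * \<epsilon> / (2 * pi) \<le> 1 / 2" by (simp add: power2_eq_square)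
  qed
  also have "m \<le> lambda1_sq (conformal_metric h)"
  proof (rule lambda1_sq_conformal_metric_ge[OF h W])
    have "pi\<^sup>2 * \<epsilon>\<^sup>2 \<le> 10 * \<epsilon>\<^sup>2" using pi_square_less_10 by (intro mult_right_mono) auto
    then have k: "64 * pi\<^sup>2 * (2 * \<epsilon>)\<^sup>2 \<le> 2560 * \<epsilon>\<^sup>2" by (simp add: power_mult_distrib)
    then show k1: "64 * pi\<^sup>2 * (2 * \<epsilon>)\<^sup>2 \<le> 1" using e2 e by linarith
    have "4 * pi\<^sup>2 * (1 - x - a) \<le> 4 * pi\<^sup>2 * 2" using x a e by (intro mult_left_mono) auto
    then show "m \<le> 8 * pi\<^sup>2" by (simp add: m_def)
    show "0 \<le> m" unfolding m_def using x a e by (intro mult_nonneg_nonneg) auto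
    define J where "J = (1 + integral {0..1} (\<lambda>t. h t ^ 4)) / 2"
    have ch4: "(\<lambda>t. h t ^ 4) integrable_on {0..1}"
      by (intro integrable_continuous_interval c01 continuous_intros ch)
    have J0: "J \<ge> 0"
      unfolding J_def using integral_nonneg[OF ch4] by simp
    have "J \<le> 1 + x / 2 + \<epsilon>\<^sup>2 / 2"
    proof -
      \<comment> \<open>Since cos^2 + sin^2 = 1, the quantity \<open>x\<close> is E times the
        integral of \<open>H\<close>, the common first order shift of both sides.\<close>
      have iH: "(H has_integral A + B) {0..1}"
      proof -
        have "((\<lambda>t. H t * (cos (2 * pi * t))\<^sup>2 + H t * (sin (2 * pi * t))\<^sup>2) has_integral A + B) {0..1}"
          unfolding A_def B_def
          by (intro has_integral_add integrable_integral integrable_continuous_interval c01 continuous_on_mult H cc)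
        then show ?thesis by (simp flip: distrib_left)
      qed
      have "((\<lambda>t. 1 + E * H t + \<epsilon>\<^sup>2) has_integral 1 + x + \<epsilon>\<^sup>2) {0..1}"
        using has_integral_add[OF has_integral_add[OF has_integral_const_real[of "1::real" 0 1]
              has_integral_mult_right[OF iH, of E]] has_integral_const_real[of "\<epsilon>\<^sup>2" 0 1]]
        by (simp add: defs(4))
      from has_integral_le[OF integrable_integral[OF ch4] this]
      have "integral {0..1} (\<lambda>t. h t ^ 4) \<le> 1 + x + \<epsilon>\<^sup>2"
        using \<rho> by (auto simp: \<rho>_def abs_le_iff algebra_simps)
      then show ?thesis by (simp add: J_def)
    qed
    from square_estimate[OF x a J0 this e(3)] have "(1 - x - a) * J\<^sup>2 \<le> 1 - a + 8 * \<epsilon>\<^sup>2" .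
    also have "\<dots> \<le> 1 - 2 * (64 * pi\<^sup>2 * (2 * \<epsilon>)\<^sup>2)"
    proof -
      \<comment> \<open>The gain \<open>a\<close> has to cover 8 \<epsilon>^2 from
        \<open>square_estimate\<close> and 2 * 2560 \<epsilon>^2 from the gauge phase, in total 5128
        \<epsilon>^2.\<close>
      have "6000 * M\<^sup>2 * e \<le> d" using small(3) by (simp only: defs)
      then have "6000 * M\<^sup>2 * e * e \<le> d * e" using e by (intro mult_right_mono) auto
      moreover have "6000 * \<epsilon>\<^sup>2 = 6000 * M\<^sup>2 * e * e" unfolding defs(2) by (simp add: power2_eq_square)
      ultimately have "6000 * \<epsilon>\<^sup>2 \<le> a" unfolding defs(5) by simp
      with k zero_le_power2[of \<epsilon>] show ?thesis by linarith
    qed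
    also have "\<dots> \<le> (1 - 64 * pi\<^sup>2 * (2 * \<epsilon>)\<^sup>2)\<^sup>2"
    proof -
      have "1 - 2 * y \<le> (1 - y)\<^sup>2" for y :: real
        using zero_le_power2[of y] by (simp add: power2_diff)
      then show ?thesis .
    qed
    finally have "4 * pi\<^sup>2 * ((1 - x - a) * J\<^sup>2) \<le> 4 * pi\<^sup>2 * (1 - 64 * pi\<^sup>2 * (2 * \<epsilon>)\<^sup>2)\<^sup>2"
      by (intro mult_left_mono) auto
    then show "m * ((1 + integral {0..1} (\<lambda>t. h t ^ 4)) / 2)\<^sup>2 \<le> 4 * pi\<^sup>2 * (1 - 64 * pi\<^sup>2 * (2 * \<epsilon>)\<^sup>2)\<^sup>2"
      unfolding J_def[symmetric] m_def by (simp only: mult.assoc)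
  qed
  finally show ?thesis .
qed

text \<open>\<open>H\<close> and \<open>G\<close> enter only through the expansion, so the bounds on
  both and the continuity of \<open>H\<close> are recovered from it, uniformly in t; by periodicity
  the compactness of one period suffices. The fixed-metric comparison then applies for all small
  E.\<close>

theorem mainTheorem2:
  fixes h :: "real \<Rightarrow> real \<Rightarrow> real" and H G :: "real \<Rightarrow> real" and a b :: real
  assumes interval: "a < 0" "0 < b"
    and h_smooth: "smooth_on ({a<..<b} \<times> UNIV) (\<lambda>(E, t). h E t)"
    and h_pos: "\<And>E t. E \<in> {a<..<b} \<Longrightarrow> h E t > 0"
    and h_periodic: "\<And>E t. E \<in> {a<..<b} \<Longrightarrow> h E (t + 1) = h E t"
    and h_zero: "\<And>t. h 0 t = 1"
    and expansion: "\<exists>C \<delta>. \<delta> > 0 \<and> (\<forall>E\<in>{a<..<b}. \<bar>E\<bar> < \<delta> \<longrightarrow>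
        (\<forall>t. \<bar>h E t ^ 4 - (1 + E * H t + E\<^sup>2 * G t)\<bar> \<le> C * \<bar>E\<bar> ^ 3))"
    and H_symmetric: "\<And>t. H t = H (1 - t)"
    and H_integrals: "integral {0..1} (\<lambda>t. H t * (sin (2 * pi * t))\<^sup>2)
        \<noteq> integral {0..1} (\<lambda>t. H t * (cos (2 * pi * t))\<^sup>2)"
  shows "eventually (\<lambda>E. mu1 (conformal_metric (h E)) < lambda1_sq (conformal_metric (h E))) (at 0)"
proof -
  obtain C \<delta> where \<delta>: "\<delta> > 0"
    and exp: "\<And>E t. E \<in> {a<..<b} \<Longrightarrow> \<bar>E\<bar> < \<delta> \<Longrightarrow> \<bar>h E t ^ 4 - (1 + E * H t + E\<^sup>2 * G t)\<bar> \<le> C * \<bar>E\<bar> ^ 3"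
    using expansion by blast
  have smooth: "smooth_on UNIV (h E)" if "E \<in> {a<..<b}" for E
  proof -
    have "bounded_linear (\<lambda>t. (0 :: real, t :: real))"
      by (intro bounded_linear_Pair bounded_linear_zero bounded_linear_ident)
    from smooth_on_comp_affine[OF this, of "(E, 0)", OF _ h_smooth] that show ?thesis by simp
  qed
  have bounded: "\<exists>K. \<forall>t. \<bar>h E t ^ 4\<bar> \<le> K" if E: "E \<in> {a<..<b}" for E
  proof -
    have "continuous_on UNIV (\<lambda>t. h E t ^ 4)"
      by (intro continuous_intros smooth_on_continuous_on smooth E)
    then have "continuous_on {0..1} (\<lambda>t. h E t ^ 4)" by (rule continuous_on_subset) simp
    from compact_imp_bounded[OF compact_continuous_image[OF this compact_Icc]]
    obtain K where "\<forall>x\<in>(\<lambda>t. h E t ^ 4) ` {0..1}. norm x \<le> K" unfolding bounded_iff by blast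
    then have K: "\<bar>h E t ^ 4\<bar> \<le> K" if "t \<in> {0..1}" for t using that by simp
    have "\<bar>h E t ^ 4\<bar> \<le> K" for t
    proof -
      have "h E t = h E (frac t)"
        using periodic_int[where f = "h E" and t = "frac t" and k = "\<lfloor>t\<rfloor>", OF h_periodic[OF E]] by (simp add: frac_def)
      then show ?thesis using K[of "frac t"] frac_lt_1[of t] by (simp add: less_imp_le)
    qed
    then show ?thesis by blast
  qed
  \<comment> \<open>Both signs of the fixed parameter must lie in the interval and within the range
    of the expansion; E1 < 1 lets cubes be bounded by squares.\<close>
  define E1 where "E1 = min 1 (min (- a) (min b \<delta>)) / 2"
  have E1: "E1 > 0" "E1 \<in> {a<..<b}" "- E1 \<in> {a<..<b}" "E1 < \<delta>" "E1 < 1"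
    using interval \<delta> by (auto simp: E1_def min_def)
  obtain K1 where K1: "\<And>t. \<bar>h E1 t ^ 4\<bar> \<le> K1" using bounded[OF E1(2)] by blast
  obtain K2 where K2: "\<And>t. \<bar>h (- E1) t ^ 4\<bar> \<le> K2" using bounded[OF E1(3)] by blast
  have C0: "C \<ge> 0"
    using order_trans[OF abs_ge_zero exp[OF E1(2), of 0]] E1 by (simp add: zero_le_mult_iff)
  text \<open>The second order coefficient is bounded, because it can be read off from \<open>h\<^sub>E\<^sup>4 + h\<^sub>-\<^sub>E\<^sup>4\<close> for a fixed \<open>E\<close>.\<close>
  define KG where "KG = (K1 + K2 + 2 + 2 * C * E1 ^ 3) / (2 * E1\<^sup>2)"
  have G: "\<bar>G t\<bar> \<le> KG" for t
  proof -
    have "\<bar>2 * E1\<^sup>2 * G t\<bar> \<le> K1 + K2 + 2 + 2 * C * E1 ^ 3"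
    proof -
      have "\<bar>2 * y\<bar> \<le> k + l + 2 + 2 * z"
        if "\<bar>p - (1 + x + y)\<bar> \<le> z" "\<bar>q - (1 - x + y)\<bar> \<le> z" "\<bar>p\<bar> \<le> k" "\<bar>q\<bar> \<le> l" for p q x y z k l :: real
        using that by linarith
      from this[of "h E1 t ^ 4" "E1 * H t" "E1\<^sup>2 * G t" "C * E1 ^ 3" "h (- E1) t ^ 4" K1 K2]
      show ?thesis using exp[OF E1(2), of t] exp[OF E1(3), of t] K1[of t] K2[of t] E1 by (simp add: mult.assoc)
    qed
    then show ?thesis using E1 by (simp add: KG_def abs_mult field_simps)
  qed
  define K where "K = KG + C"
  have approx: "\<bar>h E t ^ 4 - (1 + E * H t)\<bar> \<le> K * E\<^sup>2" if E: "E \<in> {a<..<b}" "\<bar>E\<bar> \<le> E1" for E t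
  proof -
    have "\<bar>E\<^sup>2 * G t\<bar> \<le> KG * E\<^sup>2" using mult_left_mono[OF G[of t], of "E\<^sup>2"] by (simp add: abs_mult mult.commute)
    moreover have "C * \<bar>E\<bar> ^ 3 \<le> C * E\<^sup>2"
    proof -
      have "\<bar>E\<bar> ^ 3 \<le> \<bar>E\<bar>\<^sup>2" using E E1 by (intro power_decreasing) auto
      then show ?thesis using C0 by (simp add: mult_left_mono)
    qed
    moreover have "\<bar>h E t ^ 4 - (1 + E * H t + E\<^sup>2 * G t)\<bar> \<le> C * \<bar>E\<bar> ^ 3" using exp E E1 by simp
    ultimately show ?thesis by (simp add: K_def algebra_simps)
  qed
  define KH where "KH = (K1 + 1 + K * E1\<^sup>2) / E1"
  have H: "\<bar>H t\<bar> \<le> KH" for t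
  proof -
    have "\<bar>h E1 t ^ 4 - (1 + E1 * H t)\<bar> \<le> K * E1\<^sup>2" using approx[OF E1(2)] E1 by simp
    then have "\<bar>E1 * H t\<bar> \<le> K1 + 1 + K * E1\<^sup>2" using K1[of t] by linarith
    then show ?thesis using E1 by (simp add: KH_def abs_mult field_simps)
  qed
  have small: "eventually (\<lambda>E. c * \<bar>E\<bar> < r) (at (0::real))" if "r > 0" for c r
  proof -
    have "((\<lambda>E. c * \<bar>E\<bar>) \<longlongrightarrow> c * \<bar>0\<bar>) (at (0::real))" by (intro tendsto_intros)
    from order_tendstoD(2)[OF this, of r] that show ?thesis by simp
  qed
  have nz: "eventually (\<lambda>E. E \<noteq> 0) (at (0::real))" by (simp add: eventually_at_filter)
  have near: "eventually (\<lambda>E. E \<in> {a<..<b} \<and> \<bar>E\<bar> \<le> E1) (at 0)"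
    using small[of E1 1, OF E1(1)]
  proof eventually_elim
    case (elim E)
    then show ?case using E1 by auto
  qed
  \<comment> \<open>\<open>H\<close> is the uniform limit of the continuous quotients (h_E^4 - 1) /
    E as E tends to 0; by \<open>approx\<close> the error is at most K |E|.\<close>
  have cH: "continuous_on UNIV H"
  proof (rule uniform_limit_theorem)
    show "eventually (\<lambda>E. continuous_on UNIV (\<lambda>t. (h E t ^ 4 - 1) / E)) (at 0)"
      using near nz
    proof eventually_elim
      case (elim E)
      then show ?case by (intro continuous_intros smooth_on_continuous_on smooth) auto
    qed
    show "uniform_limit UNIV (\<lambda>E t. (h E t ^ 4 - 1) / E) H (at 0)"
    proof (rule uniform_limitI)
      fix r :: real assume "r > 0"
      show "eventually (\<lambda>E. \<forall>t\<in>UNIV. dist ((h E t ^ 4 - 1) / E) (H t) < r) (at 0)"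
        using near nz small[OF \<open>r > 0\<close>, of K]
      proof eventually_elim
        case (elim E)
        have "dist ((h E t ^ 4 - 1) / E) (H t) < r" for t
        proof -
          have "(h E t ^ 4 - 1) / E - H t = (h E t ^ 4 - (1 + E * H t)) / E" using elim by (simp add: field_simps)
          then have "dist ((h E t ^ 4 - 1) / E) (H t) = \<bar>h E t ^ 4 - (1 + E * H t)\<bar> / \<bar>E\<bar>" by (simp add: dist_real_def)
          also have "\<dots> \<le> K * E\<^sup>2 / \<bar>E\<bar>" using approx elim by (intro divide_right_mono) auto
          also have "\<dots> = K * \<bar>E\<bar>" using elim by (simp add: power2_eq_square abs_if)
          finally show ?thesis using elim by linarith
        qed
        then show ?case by blast
      qed
    qed
  qed simp
  \<comment> \<open>A single constant bounds \<open>H\<close>, the quadratic remainder and 1, as the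
    fixed-metric comparison requires.\<close>
  define M where "M = max 1 (max K KH)"
  have M: "M \<ge> 1" "K \<le> M" "KH \<le> M" by (auto simp: M_def)
  let ?A = "integral {0..1} (\<lambda>t. H t * (cos (2 * pi * t))\<^sup>2)"
  let ?B = "integral {0..1} (\<lambda>t. H t * (sin (2 * pi * t))\<^sup>2)"
  have D: "((?A - ?B) / 2)\<^sup>2 > 0" "\<bar>(?A - ?B) / 2\<bar> > 0" using H_integrals by auto
  have hundredth: "(1 / 100 :: real) > 0" by simp
  show ?thesis
    using near nz small[OF hundredth, of M] small[OF D(1), of "60000 * M ^ 3"] small[OF D(2), of "6000 * M\<^sup>2"]
  proof eventually_elim
    case (elim E)
    then have E: "E \<in> {a<..<b}" by blast
    show ?case
    proof (rule mu1_less_lambda1_sq[OF smooth[OF E] h_pos[OF E] h_periodic[OF E] cH])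
      show "\<bar>H t\<bar> \<le> M" for t using H[of t] M by linarith
      show "\<bar>h E t ^ 4 - (1 + E * H t)\<bar> \<le> M * E\<^sup>2" for t
      proof -
        have "K * E\<^sup>2 \<le> M * E\<^sup>2" using M by (intro mult_right_mono) auto
        then show ?thesis using approx[of E t] elim by linarith
      qed
    qed (use elim M in auto)
  qed
qed

end
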